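(* Let $\Sigma$ be a sofic approximation to $G$, and suppose that $(X,\mu,T)$ and $(Y,\nu,S)$ are $G$-systems such that $\mathrm{h}_\Sigma(\nu,S)=\underline{\mathrm{h}}_\Sigma(\nu,S)$. Then $$\mathrm{h}_\Sigma(\mu\times\nu,T\times S)\ \ge\ \mathrm{h}^{\mathrm{dq}}_\Sigma(\mu,T)+\mathrm{h}_\Sigma(\nu,S).$$
   Context: $G$ is a countable discrete sofic group. A sofic approximation $\Sigma=(\sigma_n)_{n\ge1}$ to $G$ is a sequence of nonempty finite sets $V_n$ and maps $\sigma_n:G\to\mathrm{Sym}(V_n)$, $g\mapsto\sigma_n^g$ (not necessarily homomorphisms), such that for all $g,h\in G$ the proportion of $v\in V_n$ with $\sigma_n^g(\sigma_n^h(v))=\sigma_n^{gh}(v)$ tends to $1$, and for all $g\ne e$ the proportion of $v\in V_n$ with $\sigma_n^g(v)\neq v$ tends to $1$. A $G$-system $(X,\mu,T)$ is a standard probability space with a measurable $\mu$-preserving action $T$ of $G$. A metric $G$-process $(\mathcal{X}^G,\mu,S,d)$ consists of a standard measurable space $\mathcal{X}$, a compact metric $d$ on $\mathcal X$ whose Borel $\sigma$-algebra is that of $\mathcal X$, the right-shift action $S^g((x_h)_{h})=(x_{hg})_{h}$, and an $S$-invariant probability measure $\mu$ on $\mathcal{X}^G$. $\mathcal{X}^G$ has the product topology from $d$, and $\mathrm{Prob}(\mathcal X^G)$ the resulting weak$^\ast$ topology. For a finite set $V$, a map $\sigma:G\to\mathrm{Sym}(V)$, $\mathbf{x}\in\mathcal{X}^V$,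 $v\in V$: $\Pi^\sigma_v(\mathbf{x})=(x_{\sigma^g(v)})_{g\in G}\in\mathcal{X}^G$; $P^\sigma_{\mathbf x}=\frac1{|V|}\sum_{v}\delta_{\Pi^\sigma_v(\mathbf x)}$; $\Omega(\mathcal O,\sigma)=\{\mathbf x\in\mathcal X^V: P^\sigma_{\mathbf x}\in\mathcal O\}$ for $\mathcal{O}\subseteq\mathrm{Prob}(\mathcal X^G)$; $d^{(V)}(\mathbf x,\mathbf x')=\frac1{|V|}\sum_v d(x_v,x'_v)$. For a metric space $(Y,d_Y)$, $\mathrm{cov}_\delta(Z,d_Y)$ is the minimum cardinality of a $\delta$-dense subset of $Z\subseteq Y$ (with $\log 0=-\infty$), and for a Borel probability $\nu$ on $Y$, $\mathrm{cov}_{\varepsilon,\delta}(\nu,d_Y)=\min\{|F|: F\subseteq Y,\ \nu(B_\delta(F))>1-\varepsilon\}$, with $B_\delta(F)$ the $\delta$-neighbourhood of $F$. Sofic entropy and lower sofic entropy of a metric $G$-process: $$\mathrm h_\Sigma(\mu)=\sup_{\delta>0}\inf_{\mathcal O}\limsup_{n\to\infty}\tfrac1{|V_n|}\log\mathrm{cov}_\delta(\Omega(\mathcal O,\sigma_n),d^{(V_n)}),$$ and $\underline{\mathrm h}_\Sigma(\mu)$ is defined identically with $\liminf$ in place of $\limsup$; $\mathcal O$ ranges over weak$^\ast$ neighbourhoods of $\mu$. A sequence $\mu_i\in\mathrm{Prob}(\mathcal X^{V_{n_i}})$ quenched converges to $\mu$ over $(\sigma_{n_i})_{i\ge1}$ if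 for every weak$^\ast$ neighbourhood $\mathcal O$ of $\mu$ the proportion of $v\in V_{n_i}$ with $(\Pi^{\sigma_{n_i}}_v)_\ast\mu_i\in\mathcal O$ tends to $1$ and $\mu_i(\Omega(\mathcal O,\sigma_{n_i}))\to1$. It doubly-quenched converges to $\mu$ if $\mu_i\times\mu_i\in\mathrm{Prob}((\mathcal X\times\mathcal X)^{V_{n_i}})$ quenched converges to $\mu\times\mu$ (on $(\mathcal X\times\mathcal X)^G$, with the average of the two copies of $d$). Then $$\mathrm h^{\mathrm{dq}}_\Sigma(\mu)=\sup\Big\{\sup_{\delta,\varepsilon>0}\limsup_{i\to\infty}\tfrac1{|V_{n_i}|}\log\mathrm{cov}_{\varepsilon,\delta}(\mu_i,d^{(V_{n_i})})\Big\},$$ the outer supremum being over all subsequences $n_i\uparrow\infty$ and all sequences $(\mu_i)$ doubly-quenched converging to $\mu$ over $(\sigma_{n_i})_{i\ge1}$ (and $\sup\emptyset=-\infty$). These quantities do not depend on $d$ and are isomorphism invariants of the underlying system. Every $G$-system is isomorphic to a $G$-process (via $x\mapsto(T^hx)_{h\in G}\in X^G$), and the quantities for $(X,\mu,T)$ are defined as those of any isomorphic metric $G$-process. A sum with a term equal to $-\infty$ is interpreted as $-\infty$. *)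

theory Defs
  imports "HOL-Probability.Probability"
begin

text \<open>
  The countable discrete group is a type of sorts \<open>group_add\<close> and \<open>countable\<close>. It is written
  additively but not assumed to be commutative: \<open>g + h\<close> is the product \<open>gh\<close> and \<open>0\<close> is the
  identity. A group is sofic iff it has a sofic approximation, so no separate notion is needed.
\<close>

definition sofic_approximation ::
  "(nat \<Rightarrow> 'v set) \<Rightarrow> (nat \<Rightarrow> 'g::{group_add,countable} \<Rightarrow> 'v \<Rightarrow> 'v) \<Rightarrow> bool" where
  "sofic_approximation V \<sigma> \<longleftrightarrow>
     (\<forall>n. finite (V n) \<and> V n \<noteq> {}) \<and>
     (\<forall>n g. bij_betw (\<sigma> n g) (V n) (V n)) \<and>
     (\<forall>g h. (\<lambda>n. real (card {v \<in> V n. \<sigma> n g (\<sigma> n h v) = \<sigma> n (g + h) v}) / real (card (V n)))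
              \<longlonglongrightarrow> 1) \<and>
     (\<forall>g. g \<noteq> 0 \<longrightarrow>
        (\<lambda>n. real (card {v \<in> V n. \<sigma> n g v \<noteq> v}) / real (card (V n))) \<longlonglongrightarrow> 1)"

subsection \<open>Systems, processes and isomorphism\<close>

text \<open>The carrier and \<open>\<sigma>\<close>-algebra of \<open>M\<close> are those of some Polish space.\<close>

definition standard_measurable :: "'x measure \<Rightarrow> bool" where
  "standard_measurable M \<longleftrightarrow>
     (\<exists>X. completely_metrizable_space X \<and> second_countable X \<and> topspace X = space M \<and>
          sets M = sigma_sets (topspace X) {U. openin X U})"

definition G_system :: "'x measure \<Rightarrow> ('g::{group_add,countable} \<Rightarrow> 'x \<Rightarrow> 'x) \<Rightarrow> bool" where
  "G_system M T \<longleftrightarrow>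
     prob_space M \<and> standard_measurable M \<and>
     (\<forall>g. T g \<in> M \<rightarrow>\<^sub>M M) \<and> (\<forall>g. distr M M (T g) = M) \<and>
     (\<forall>x\<in>space M. T 0 x = x) \<and>
     (\<forall>g h. \<forall>x\<in>space M. T (g + h) x = T g (T h x))"

abbreviation seq_space :: "'i set \<Rightarrow> ('i \<Rightarrow> 'a::topological_space) measure" where
  "seq_space I \<equiv> \<Pi>\<^sub>M i\<in>I. borel"

definition shift :: "'g::{group_add,countable} \<Rightarrow> ('g \<Rightarrow> 'a) \<Rightarrow> ('g \<Rightarrow> 'a)" where
  "shift g x = (\<lambda>h. x (h + g))"

text \<open>
  The state space of a metric process is a type \<open>'a\<close> whose metric is \<open>dist\<close>; its
  compactness is part of the definition. Every compact metric space is Polish, so the sort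
  \<open>polish_space\<close> is no restriction, and \<open>borel\<close> is then a standard Borel structure.
\<close>

definition metric_process :: "('g::{group_add,countable} \<Rightarrow> 'a::polish_space) measure \<Rightarrow> bool" where
  "metric_process \<alpha> \<longleftrightarrow>
     compact (UNIV :: 'a set) \<and>
     prob_space \<alpha> \<and> sets \<alpha> = sets (seq_space UNIV) \<and>
     (\<forall>g. distr \<alpha> \<alpha> (shift g) = \<alpha>)"

definition isomorphic_systems ::
  "'x measure \<Rightarrow> ('g::{group_add,countable} \<Rightarrow> 'x \<Rightarrow> 'x) \<Rightarrow>
   'y measure \<Rightarrow> ('g \<Rightarrow> 'y \<Rightarrow> 'y) \<Rightarrow> bool" where
  "isomorphic_systems M T N S \<longleftrightarrow>
     (\<exists>\<phi> \<psi>. \<phi> \<in> M \<rightarrow>\<^sub>M N \<and> \<psi> \<in> N \<rightarrow>\<^sub>M M \<and> distr M N \<phi> = N \<and> distr N M \<psi> = M \<and>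
        (AE x in M. \<psi> (\<phi> x) = x) \<and> (AE y in N. \<phi> (\<psi> y) = y) \<and>
        (\<forall>g. AE x in M. \<phi> (T g x) = S g (\<phi> x)))"

definition metric_model ::
  "'x measure \<Rightarrow> ('g::{group_add,countable} \<Rightarrow> 'x \<Rightarrow> 'x) \<Rightarrow>
   ('g \<Rightarrow> 'a::polish_space) measure \<Rightarrow> bool" where
  "metric_model M T \<alpha> \<longleftrightarrow> metric_process \<alpha> \<and> isomorphic_systems M T \<alpha> shift"

subsection \<open>The weak* topology and empirical measures\<close>

text \<open>
  The weak* topology on the Borel probability measures on \<open>'a\<^sup>I\<close>. It is only used for
  compact \<open>'a\<close>, so all continuous functions are bounded test functions. Taking \<open>U = UNIV\<close>
  shows that the underlying set is the set of all those probability measures.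
\<close>

definition weak_star :: "('i \<Rightarrow> 'a::topological_space) measure topology" where
  "weak_star = topology_generated_by
     {{\<mu>. prob_space \<mu> \<and> sets \<mu> = sets (seq_space UNIV) \<and> integral\<^sup>L \<mu> f \<in> U} | f U.
        continuous_on UNIV f \<and> open (U :: real set)}"

definition weak_star_nhds ::
  "('i \<Rightarrow> 'a::topological_space) measure \<Rightarrow> ('i \<Rightarrow> 'a) measure set set" where
  "weak_star_nhds \<mu> = {\<O>. openin weak_star \<O> \<and> \<mu> \<in> \<O>}"

definition pullback_name :: "('g \<Rightarrow> 'v \<Rightarrow> 'v) \<Rightarrow> 'v \<Rightarrow> ('v \<Rightarrow> 'a) \<Rightarrow> ('g \<Rightarrow> 'a)" where
  "pullback_name s v x = (\<lambda>g. x (s g v))"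

text \<open>The average of the point masses at \<open>pullback_name s v x\<close>, \<open>v \<in> V\<close>.\<close>

definition empirical_measure ::
  "'v set \<Rightarrow> ('g \<Rightarrow> 'v \<Rightarrow> 'v) \<Rightarrow> ('v \<Rightarrow> 'a::topological_space) \<Rightarrow> ('g \<Rightarrow> 'a) measure" where
  "empirical_measure V s x =
     distr (uniform_count_measure V) (seq_space UNIV) (\<lambda>v. pullback_name s v x)"

definition good_models ::
  "('g \<Rightarrow> 'a::topological_space) measure set \<Rightarrow> 'v set \<Rightarrow> ('g \<Rightarrow> 'v \<Rightarrow> 'v) \<Rightarrow> ('v \<Rightarrow> 'a) set" where
  "good_models \<O> V s = {x \<in> V \<rightarrow>\<^sub>E UNIV. empirical_measure V s x \<in> \<O>}"

subsection \<open>Covering numbers\<close>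

definition hamming_dist :: "'v set \<Rightarrow> ('v \<Rightarrow> 'a::metric_space) \<Rightarrow> ('v \<Rightarrow> 'a) \<Rightarrow> real" where
  "hamming_dist V x y = (\<Sum>v\<in>V. dist (x v) (y v)) / real (card V)"

definition cov :: "real \<Rightarrow> 'y set \<Rightarrow> ('y \<Rightarrow> 'y \<Rightarrow> real) \<Rightarrow> enat" where
  "cov \<delta> Z d = (INF F \<in> {F. finite F \<and> F \<subseteq> Z \<and> (\<forall>z\<in>Z. \<exists>y\<in>F. d y z < \<delta>)}. enat (card F))"

definition cov_measure :: "real \<Rightarrow> real \<Rightarrow> 'y measure \<Rightarrow> ('y \<Rightarrow> 'y \<Rightarrow> real) \<Rightarrow> enat" where
  "cov_measure \<epsilon> \<delta> \<nu> d =
     (INF F \<in> {F. finite F \<and> F \<subseteq> space \<nu> \<and>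
                   measure \<nu> {z \<in> space \<nu>. \<exists>y\<in>F. d y z < \<delta>} > 1 - \<epsilon>}. enat (card F))"

definition log_enat :: "enat \<Rightarrow> ereal" where
  "log_enat k = (case k of enat m \<Rightarrow> (if m = 0 then -\<infinity> else ereal (ln (real m))) | \<infinity> \<Rightarrow> \<infinity>)"

subsection \<open>Sofic entropy and lower sofic entropy\<close>

definition sofic_entropy ::
  "(nat \<Rightarrow> 'v set) \<Rightarrow> (nat \<Rightarrow> 'g \<Rightarrow> 'v \<Rightarrow> 'v) \<Rightarrow>
   ('g::{group_add,countable} \<Rightarrow> 'a::polish_space) measure \<Rightarrow> ereal" where
  "sofic_entropy V \<sigma> \<mu> =
     (SUP \<delta> \<in> {0<..}. INF \<O> \<in> weak_star_nhds \<mu>.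
        limsup (\<lambda>n. log_enat (cov \<delta> (good_models \<O> (V n) (\<sigma> n)) (hamming_dist (V n)))
                      / ereal (real (card (V n)))))"

definition lower_sofic_entropy ::
  "(nat \<Rightarrow> 'v set) \<Rightarrow> (nat \<Rightarrow> 'g \<Rightarrow> 'v \<Rightarrow> 'v) \<Rightarrow>
   ('g::{group_add,countable} \<Rightarrow> 'a::polish_space) measure \<Rightarrow> ereal" where
  "lower_sofic_entropy V \<sigma> \<mu> =
     (SUP \<delta> \<in> {0<..}. INF \<O> \<in> weak_star_nhds \<mu>.
        liminf (\<lambda>n. log_enat (cov \<delta> (good_models \<O> (V n) (\<sigma> n)) (hamming_dist (V n)))
                      / ereal (real (card (V n)))))"

subsection \<open>Doubly-quenched convergence and doubly-quenched entropy\<close>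

text \<open>
  Quenched convergence depends on the topology of the state space only. Hence it makes no
  difference that the library metric on a product type is not the average of the two metrics:
  both induce the product topology.
\<close>

definition quenched_converges ::
  "(nat \<Rightarrow> 'v set) \<Rightarrow> (nat \<Rightarrow> 'g \<Rightarrow> 'v \<Rightarrow> 'v) \<Rightarrow>
   (nat \<Rightarrow> ('v \<Rightarrow> 'a::topological_space) measure) \<Rightarrow> ('g \<Rightarrow> 'a) measure \<Rightarrow> bool" where
  "quenched_converges W s m \<mu> \<longleftrightarrow>
     (\<forall>i. prob_space (m i) \<and> sets (m i) = sets (seq_space (W i))) \<and>
     (\<forall>\<O> \<in> weak_star_nhds \<mu>.
        (\<lambda>i. real (card {v \<in> W i. distr (m i) (seq_space UNIV) (pullback_name (s i) v) \<in> \<O>})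
               / real (card (W i))) \<longlonglongrightarrow> 1 \<and>
        (\<lambda>i. measure (m i) (good_models \<O> (W i) (s i))) \<longlonglongrightarrow> 1)"

text \<open>The product \<open>\<mu> \<times> \<nu>\<close> regarded as a measure on \<open>('a \<times> 'b)\<^sup>I\<close>.\<close>

definition joint_measure ::
  "'i set \<Rightarrow> ('i \<Rightarrow> 'a::topological_space) measure \<Rightarrow> ('i \<Rightarrow> 'b::topological_space) measure \<Rightarrow>
   ('i \<Rightarrow> 'a \<times> 'b) measure" where
  "joint_measure I \<mu> \<nu> = distr (\<mu> \<Otimes>\<^sub>M \<nu>) (seq_space I) (\<lambda>(x, y). \<lambda>i\<in>I. (x i, y i))"

definition doubly_quenched_converges ::
  "(nat \<Rightarrow> 'v set) \<Rightarrow> (nat \<Rightarrow> 'g \<Rightarrow> 'v \<Rightarrow> 'v) \<Rightarrow>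
   (nat \<Rightarrow> ('v \<Rightarrow> 'a::topological_space) measure) \<Rightarrow> ('g \<Rightarrow> 'a) measure \<Rightarrow> bool" where
  "doubly_quenched_converges W s m \<mu> \<longleftrightarrow>
     (\<forall>i. prob_space (m i) \<and> sets (m i) = sets (seq_space (W i))) \<and>
     quenched_converges W s (\<lambda>i. joint_measure (W i) (m i) (m i)) (joint_measure UNIV \<mu> \<mu>)"

definition dq_entropy ::
  "(nat \<Rightarrow> 'v set) \<Rightarrow> (nat \<Rightarrow> 'g \<Rightarrow> 'v \<Rightarrow> 'v) \<Rightarrow>
   ('g::{group_add,countable} \<Rightarrow> 'a::polish_space) measure \<Rightarrow> ereal" where
  "dq_entropy V \<sigma> \<mu> =
     (SUP (r, m) \<in> {(r :: nat \<Rightarrow> nat, m). strict_mono r \<and>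
                      doubly_quenched_converges (\<lambda>i. V (r i)) (\<lambda>i. \<sigma> (r i)) m \<mu>}.
        SUP (\<delta>, \<epsilon>) \<in> {0<..} \<times> {0<..}.
          limsup (\<lambda>i. log_enat (cov_measure \<epsilon> \<delta> (m i) (hamming_dist (V (r i))))
                        / ereal (real (card (V (r i))))))"

text \<open>In \<open>ereal\<close> one has \<open>-\<infinity> + \<infinity> = \<infinity>\<close>; here a summand \<open>-\<infinity>\<close> is absorbing instead.\<close>

definition entropy_plus :: "ereal \<Rightarrow> ereal \<Rightarrow> ereal" where
  "entropy_plus a b = (if a = -\<infinity> \<or> b = -\<infinity> then -\<infinity> else a + b)"

end

theory Submission
  imports Defs
begin

text \<open>
  Write \<open>\<alpha>\<close>, \<open>\<beta>\<close> and \<open>\<gamma>\<close> for metric models of the two systems and of their product. Then \<open>\<gamma>\<close> is the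
  image of the joint process \<open>\<alpha> \<times> \<beta>\<close> under an equivariant map \<open>\<phi>\<close> that is injective almost
  everywhere. Fix a real \<open>a\<close> below the doubly-quenched entropy of \<open>\<alpha>\<close> and a real \<open>b\<close> below the lower
  sofic entropy of \<open>\<beta>\<close>. Along a subsequence there are measures \<open>m\<^sub>i\<close> on models of \<open>\<alpha>\<close> whose covering
  numbers infinitely often exceed \<open>exp (a |V|)\<close>, and for all large \<open>n\<close>, hence along that subsequence, the good models
  of \<open>\<beta>\<close> have covering numbers exceeding \<open>exp (b |V|)\<close>. The good models of \<open>\<gamma>\<close> turn out to have
  covering numbers at least the product of the two.

  The heart of the matter is \<open>generic_product\<close>: whenever \<open>y\<close> is a good model of \<open>\<beta>\<close>, most samples \<open>x\<close>
  of \<open>m\<^sub>i\<close> make \<open>(x, y)\<close> a good model of \<open>\<alpha> \<times> \<beta>\<close>, no matter how \<open>y\<close> was chosen. The deviation of an orbit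
  average of \<open>p \<otimes> q\<close> is a mean over \<open>V\<close> of centred random variables with bounded deterministic
  coefficients. Its second moment is bounded, uniformly in the coefficients, by the expected size of the
  empirical correlation of two independent samples (\<open>second_moment_decoupling\<close>), and the latter
  tends to \<open>0\<close> because \<open>m\<^sub>i \<times> m\<^sub>i\<close> concentrates on good models of \<open>\<alpha> \<times> \<alpha>\<close>
  (\<open>doubly_quenched_decorrelation\<close>).

  Two facts transport the pairs to models of \<open>\<gamma>\<close>. A good model \<open>w\<close> of \<open>\<alpha> \<times> \<beta>\<close> lifts to a pair \<open>(w, z)\<close> that
  resembles the graph of \<open>\<phi>\<close> (\<open>lift_models\<close>); to this end \<open>\<phi>\<close> is replaced by maps with finitely many
  values that are continuous up to an error detectable by orbit averages
  (\<open>almost_continuous_approximation\<close>). Conversely, the inverse of \<open>\<phi>\<close> is approximated by continuous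
  functions of \<open>z\<close>, so that lifts which are close to each other come from pairs which are close to each
  other (\<open>lift_separates\<close>). Hence a cover of the good models of \<open>\<gamma>\<close> distinguishes separated
  models \<open>y\<close>, and for each of them it yields a cover of most samples \<open>x\<close>
  (\<open>cov_measure_mult_cov_le\<close>). Taking logarithms gives \<open>a + b\<close>.
\<close>

section \<open>Continuous functions on a compact power space\<close>

lemma compact_UNIV_fun:
  assumes "compact (UNIV :: 'a::topological_space set)"
  shows "compact (UNIV :: ('i \<Rightarrow> 'a) set)"
proof -
  have "compact_space (product_topology (\<lambda>i::'i. euclidean :: 'a topology) UNIV)"
    unfolding compact_space_product_topology using assms by (simp add: compact_space_def)
  then show ?thesis
    by (simp add: euclidean_product_topology compact_space_def)
qed

lemma compact_UNIV_prod:
  assumes "compact (UNIV :: 'a::topological_space set)" "compact (UNIV :: 'b::topological_space set)"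
  shows "compact (UNIV :: ('a \<times> 'b) set)"
  using compact_Times[OF assms] by simp

lemma continuous_bounded_compact:
  fixes f :: "'a::topological_space \<Rightarrow> real"
  assumes "compact (UNIV :: 'a set)" "continuous_on UNIV f"
  obtains B where "B > 0" "\<And>x. \<bar>f x\<bar> \<le> B"
proof -
  have "compact (range f)"
    using assms compact_continuous_image by blast
  then have "bounded (range f)"
    by (rule compact_imp_bounded)
  then show thesis
    using that by (auto simp: bounded_pos)
qed

lemma continuous_measurable_seq_space:
  fixes f :: "('i::countable \<Rightarrow> 'a::second_countable_topology) \<Rightarrow> 'b::topological_space"
  assumes "continuous_on UNIV f"
  shows "f \<in> borel_measurable (seq_space UNIV)"
  using borel_measurable_continuous_onI[OF assms] measurable_cong_sets[OF sets_PiM_equal_borel refl]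
  by blast

lemma integrable_continuous_compact:
  fixes f :: "('i::countable \<Rightarrow> 'a::second_countable_topology) \<Rightarrow> real"
  assumes "compact (UNIV :: 'a set)" "continuous_on UNIV f" "prob_space \<mu>"
    and "sets \<mu> = sets (seq_space UNIV)"
  shows "integrable \<mu> f"
proof -
  interpret prob_space \<mu> by fact
  obtain B where B: "\<And>x. \<bar>f x\<bar> \<le> B"
    using continuous_bounded_compact[OF compact_UNIV_fun[OF assms(1)] assms(2)] by blast
  have "f \<in> borel_measurable \<mu>"
    using continuous_measurable_seq_space[OF assms(2)] measurable_cong_sets[OF assms(4) refl] by blast
  then show ?thesis
    by (intro integrable_const_bound[where B = B]) (auto simp: B)
qed

text \<open>
  A continuous function on a compact power space is Lipschitz in finitely many coordinates up to a
  uniform error: the library metric of a countable power is controlled by an initial segment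
  of the coordinates, and pairs of points at distance at least \<open>\<delta>\<close> are taken care of by a large
  Lipschitz constant. This is what turns smallness of a normalized Hamming distance into
  closeness of orbit averages.
\<close>

lemma continuous_almost_Lipschitz:
  fixes f :: "('i::countable \<Rightarrow> 'a::metric_space) \<Rightarrow> real"
  assumes "compact (UNIV :: 'a set)" "continuous_on UNIV f" "\<eta> > 0"
  obtains k C where "C > 0"
    "\<And>x y. \<bar>f x - f y\<bar> \<le> \<eta> + C * (\<Sum>n\<le>k. dist (x (from_nat n :: 'i)) (y (from_nat n)))"
proof -
  note cpt = compact_UNIV_fun[OF assms(1), where 'i = 'i]
  obtain B where B: "B > 0" "\<And>x. \<bar>f x\<bar> \<le> B"
    using continuous_bounded_compact[OF cpt assms(2)] by blast
  have "uniformly_continuous_on UNIV f"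
    by (rule compact_uniformly_continuous[OF assms(2) cpt])
  then obtain \<delta> where \<delta>: "\<delta> > 0" "\<And>x y. dist x y < \<delta> \<Longrightarrow> dist (f x) (f y) < \<eta>"
    unfolding uniformly_continuous_on_def using assms(3) by (metis UNIV_I)
  obtain k :: nat where k: "(1/2) ^ k < \<delta> / 2"
    using real_arch_pow_inv[of "\<delta>/2" "1/2"] \<delta>(1) by auto
  let ?S = "\<lambda>x y. \<Sum>n\<le>k. dist (x (from_nat n :: 'i)) (y (from_nat n))"
  have S0: "?S x y \<ge> 0" for x y :: "'i \<Rightarrow> 'a"
    by (intro sum_nonneg) auto
  have "\<bar>f x - f y\<bar> \<le> \<eta> + (8 * B / \<delta>) * ?S x y" for x y
  proof (cases "dist x y < \<delta>")
    case True
    have "0 \<le> (8 * B / \<delta>) * ?S x y"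
      using S0[of x y] B(1) \<delta>(1) by simp
    then show ?thesis
      using \<delta>(2)[OF True] by (simp add: dist_real_def)
  next
    case False
    have "Max {dist (x (from_nat n)) (y (from_nat n))|n. n \<le> k} \<le> ?S x y"
    proof (rule Max.boundedI)
      fix a assume "a \<in> {dist (x (from_nat n)) (y (from_nat n))|n. n \<le> k}"
      then obtain n where "n \<le> k" "a = dist (x (from_nat n)) (y (from_nat n))" by blast
      then show "a \<le> ?S x y"
        using member_le_sum[of n "{..k}" "\<lambda>n. dist (x (from_nat n)) (y (from_nat n))"] by simp
    qed auto
    then have "\<delta> \<le> 2 * ?S x y + \<delta> / 2"
      using dist_fun_le_dist_first_terms[of x y k] False k by linarith
    then have "1 \<le> 4 * ?S x y / \<delta>"
      using \<delta>(1) by (simp add: field_simps)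
    then have "2 * B * 1 \<le> 2 * B * (4 * ?S x y / \<delta>)"
      using B(1) by (intro mult_left_mono) auto
    then have "2 * B \<le> (8 * B / \<delta>) * ?S x y"
      by simp
    then show ?thesis
      using B(2)[of x] B(2)[of y] assms(3) by linarith
  qed
  then show thesis
    using that[of "8 * B / \<delta>" k] B(1) \<delta>(1) by simp
qed

inductive add_span :: "('a \<Rightarrow> real) set \<Rightarrow> ('a \<Rightarrow> real) \<Rightarrow> bool" for P where
  base: "p \<in> P \<Longrightarrow> add_span P p"
| add: "add_span P f \<Longrightarrow> add_span P g \<Longrightarrow> add_span P (\<lambda>x. f x + g x)"

lemma add_span_mult:
  assumes P: "\<And>p q. p \<in> P \<Longrightarrow> q \<in> P \<Longrightarrow> (\<lambda>x. p x * q x) \<in> P"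
    and "add_span P f" "add_span P g"
  shows "add_span P (\<lambda>x. f x * g x)"
  using assms(2)
proof induction
  case (base p)
  show ?case
    using assms(3)
  proof induction
    case (base q)
    then show ?case using \<open>p \<in> P\<close> P by (blast intro: add_span.base)
  next
    case (add q r)
    then show ?case using add_span.add by (auto simp: distrib_left)
  qed
next
  case (add f h)
  then show ?case using add_span.add by (auto simp: distrib_right)
qed

text \<open>
  Stone--Weierstrass as an induction principle. The statements about test functions below are
  stable under sums and uniform limits but not under products, so the products have to be
  taken inside the generating family \<open>P\<close>.
\<close>

lemma continuous_function_induct:
  fixes f :: "'a::t2_space \<Rightarrow> real"
  assumes "compact (UNIV :: 'a set)" "continuous_on UNIV f"
    and cont: "\<And>p. p \<in> P \<Longrightarrow> continuous_on UNIV p"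
    and const: "\<And>c. (\<lambda>_. c) \<in> P"
    and mult: "\<And>p q. p \<in> P \<Longrightarrow> q \<in> P \<Longrightarrow> (\<lambda>x. p x * q x) \<in> P"
    and sep: "\<And>x y. x \<noteq> y \<Longrightarrow> \<exists>p\<in>P. p x \<noteq> p y"
    and base: "\<And>p. p \<in> P \<Longrightarrow> A p"
    and add: "\<And>f g. continuous_on UNIV f \<Longrightarrow> continuous_on UNIV g \<Longrightarrow> A f \<Longrightarrow> A g
                \<Longrightarrow> A (\<lambda>x. f x + g x)"
    and lim: "\<And>f. continuous_on UNIV f \<Longrightarrow>
                (\<And>\<epsilon>. \<epsilon> > 0 \<Longrightarrow> \<exists>g. continuous_on UNIV g \<and> A g \<and> (\<forall>x. \<bar>f x - g x\<bar> < \<epsilon>)) \<Longrightarrow> A f"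
  shows "A f"
proof (rule lim[OF assms(2)])
  have span: "continuous_on UNIV g \<and> A g" if "add_span P g" for g
    using that by induction (auto intro!: continuous_intros simp: cont base add)
  fix \<epsilon> :: real assume "\<epsilon> > 0"
  have "\<exists>g. add_span P g \<and> (\<forall>x\<in>UNIV. \<bar>f x - g x\<bar> < \<epsilon>)"
  proof (rule Stone_Weierstrass_HOL[OF assms(1)])
    show "\<exists>f. add_span P f \<and> f x \<noteq> f y" if "x \<in> UNIV \<and> y \<in> UNIV \<and> x \<noteq> y" for x y
      using sep that add_span.base by blast
  qed (use span assms(2) \<open>\<epsilon> > 0\<close> const in
        \<open>auto intro: add_span.intros add_span_mult[OF mult]\<close>)
  then show "\<exists>g. continuous_on UNIV g \<and> A g \<and> (\<forall>x. \<bar>f x - g x\<bar> < \<epsilon>)"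
    using span by blast
qed

subsection \<open>Density in mean\<close>

lemma Urysohn_compact_open:
  fixes K U :: "'a::metric_space set"
  assumes "compact K" "open U" "K \<subseteq> U"
  obtains f :: "'a \<Rightarrow> real" where "continuous_on UNIV f" "\<And>x. 0 \<le> f x" "\<And>x. f x \<le> 1"
    "\<And>x. x \<in> K \<Longrightarrow> f x = 1" "\<And>x. x \<notin> U \<Longrightarrow> f x = 0"
proof -
  consider "K = {}" | "U = UNIV" | "K \<noteq> {}" "U \<noteq> UNIV" by blast
  then show thesis
  proof cases
    case 1
    then show thesis using that[of "\<lambda>_. 0"] by auto
  next
    case 2
    then show thesis using that[of "\<lambda>_. 1"] by auto
  next
    case 3
    have cl: "closed K" "closed (- U)"
      using assms compact_imp_closed by (auto simp: closed_def)
    have pos: "infdist x K + infdist x (- U) > 0" for x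
    proof (rule ccontr)
      assume "\<not> ?thesis"
      then have "infdist x K = 0" "infdist x (- U) = 0"
        using infdist_nonneg[of x K] infdist_nonneg[of x "- U"] by linarith+
      then have "x \<in> K" "x \<in> - U"
        using cl 3 in_closed_iff_infdist_zero[of K x] in_closed_iff_infdist_zero[of "- U" x] by auto
      then show False using assms by blast
    qed
    show thesis
    proof (rule that[of "\<lambda>x. infdist x (- U) / (infdist x K + infdist x (- U))"])
      show "continuous_on UNIV (\<lambda>x. infdist x (- U) / (infdist x K + infdist x (- U)))"
        using pos by (intro continuous_intros) (simp add: less_le)
      show "infdist x (- U) / (infdist x K + infdist x (- U)) \<le> 1" for x
        using pos[of x] infdist_nonneg[of x K] by (simp add: field_simps)
      show "infdist x (- U) / (infdist x K + infdist x (- U)) = 1" if "x \<in> K" for x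
        using pos[of x] that by simp
      show "infdist x (- U) / (infdist x K + infdist x (- U)) = 0" if "x \<notin> U" for x
        using that by simp
    qed (auto simp: infdist_nonneg)
  qed
qed

lemma indicator_approx_continuous:
  fixes \<mu> :: "'a::{second_countable_topology, complete_space} measure"
  assumes "prob_space \<mu>" "sets \<mu> = sets borel" "A \<in> sets borel" "\<epsilon> > 0"
  obtains f :: "'a \<Rightarrow> real" where "continuous_on UNIV f" "\<And>x. 0 \<le> f x" "\<And>x. f x \<le> 1"
    "(\<integral>x. \<bar>indicator A x - f x\<bar> \<partial>\<mu>) < \<epsilon>"
proof -
  interpret prob_space \<mu> by fact
  have fin: "emeasure \<mu> (space \<mu>) \<noteq> \<infinity>"
    by (simp add: emeasure_space_1)
  have A: "emeasure \<mu> A = ennreal (measure \<mu> A)"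
    by (simp add: emeasure_eq_measure)
  obtain K where K: "K \<subseteq> A" "compact K" "measure \<mu> A - \<epsilon>/3 < measure \<mu> K"
  proof (cases "measure \<mu> A - \<epsilon>/3 < 0")
    case True
    then show thesis using that[of "{}"] by simp
  next
    case False
    then have "ennreal (measure \<mu> A - \<epsilon>/3) < emeasure \<mu> A"
      using assms(4) by (simp add: A ennreal_less_iff)
    then show thesis
      using that unfolding inner_regular[OF assms(2) fin assms(3)] less_SUP_iff
      by (auto simp: emeasure_eq_measure ennreal_less_iff[OF False[unfolded not_less]])
  qed
  have "emeasure \<mu> A < ennreal (measure \<mu> A + \<epsilon>/3)"
    using assms(4) by (simp add: A ennreal_less_iff)
  then obtain U where U: "A \<subseteq> U" "open U" "measure \<mu> U < measure \<mu> A + \<epsilon>/3"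
    unfolding outer_regular[OF assms(2) fin assms(3)] INF_less_iff
    by (auto simp: emeasure_eq_measure ennreal_less_iff)
  obtain f :: "'a \<Rightarrow> real" where f: "continuous_on UNIV f" "\<And>x. 0 \<le> f x" "\<And>x. f x \<le> 1"
    "\<And>x. x \<in> K \<Longrightarrow> f x = 1" "\<And>x. x \<notin> U \<Longrightarrow> f x = 0"
    using Urysohn_compact_open[OF K(2) U(2)] K(1) U(1) by blast
  have meas: "K \<in> sets \<mu>" "U \<in> sets \<mu>" "A \<in> sets \<mu>"
    using K U assms by (auto simp: borel_open borel_compact)
  have "(\<integral>x. \<bar>indicator A x - f x\<bar> \<partial>\<mu>) \<le> (\<integral>x. indicator (U - K) x \<partial>\<mu>)"
  proof (rule integral_mono')
    show "integrable \<mu> (\<lambda>x. indicator (U - K) x :: real)"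
      using meas by (intro integrable_real_indicator) (auto simp: emeasure_eq_measure)
    show "\<bar>indicator A x - f x\<bar> \<le> indicator (U - K) x" for x
      using f(2,3)[of x] f(4,5)[of x] K(1) U(1) by (auto simp: indicator_def abs_le_iff)
  qed auto
  also have "\<dots> = measure \<mu> U - measure \<mu> K"
    using meas K(1) U(1) finite_measure_Diff[of U K] sets_eq_imp_space_eq[OF assms(2)] by simp
  also have "\<dots> < \<epsilon>"
    using K(3) U(3) assms(4) by linarith
  finally show thesis
    using that f by blast
qed

lemma integrable_approx_continuous:
  fixes \<mu> :: "'a::{second_countable_topology, complete_space} measure" and h :: "'a \<Rightarrow> real"
  assumes "prob_space \<mu>" "sets \<mu> = sets borel" "compact (UNIV :: 'a set)" "integrable \<mu> h" "\<epsilon> > 0"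
  shows "\<exists>f. continuous_on UNIV f \<and> (\<integral>x. \<bar>h x - f x\<bar> \<partial>\<mu>) < \<epsilon>"
  using assms(4,5)
proof (induction h arbitrary: \<epsilon>)
  interpret prob_space \<mu> by fact
  have int: "integrable \<mu> f" if f: "continuous_on UNIV f" for f :: "'a \<Rightarrow> real"
  proof -
    obtain B where B: "\<And>x. \<bar>f x\<bar> \<le> B"
      using continuous_bounded_compact[OF assms(3) f] by blast
    have "f \<in> borel_measurable \<mu>"
      using borel_measurable_continuous_onI[OF f] measurable_cong_sets[OF assms(2) refl] by blast
    then show ?thesis
      by (intro integrable_const_bound[where B = B]) (auto simp: B)
  qed
  {
    case (base A c)
    obtain f where f: "continuous_on UNIV f" "(\<integral>x. \<bar>indicator A x - f x\<bar> \<partial>\<mu>) < \<epsilon> / (\<bar>c\<bar> + 1)"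
    proof (rule indicator_approx_continuous[OF assms(1,2)])
      show "A \<in> sets borel" "0 < \<epsilon> / (\<bar>c\<bar> + 1)"
        using base assms(2) by auto
    qed
    have "(\<integral>x. \<bar>indicator A x *\<^sub>R c - c * f x\<bar> \<partial>\<mu>) = (\<integral>x. \<bar>c\<bar> * \<bar>indicator A x - f x\<bar> \<partial>\<mu>)"
      by (intro Bochner_Integration.integral_cong) (auto simp: abs_mult[symmetric] algebra_simps)
    also have "\<dots> \<le> (\<bar>c\<bar> + 1) * (\<integral>x. \<bar>indicator A x - f x\<bar> \<partial>\<mu>)"
      by (simp add: mult_right_mono)
    also have "\<dots> < \<epsilon>"
      using f(2) by (simp add: field_simps)
    finally show ?case
      using f(1) by (intro exI[of _ "\<lambda>x. c * f x"]) (auto intro!: continuous_intros)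
  next
    case (add h k)
    obtain f where f: "continuous_on UNIV f" "(\<integral>x. \<bar>h x - f x\<bar> \<partial>\<mu>) < \<epsilon>/2"
      using add.IH(1)[of "\<epsilon>/2"] add.prems by auto
    obtain g where g: "continuous_on UNIV g" "(\<integral>x. \<bar>k x - g x\<bar> \<partial>\<mu>) < \<epsilon>/2"
      using add.IH(2)[of "\<epsilon>/2"] add.prems by auto
    have "(\<integral>x. \<bar>h x + k x - (f x + g x)\<bar> \<partial>\<mu>) \<le> (\<integral>x. \<bar>h x - f x\<bar> + \<bar>k x - g x\<bar> \<partial>\<mu>)"
      using add int[OF f(1)] int[OF g(1)] by (intro integral_mono) auto
    also have "\<dots> < \<epsilon>"
      using add int[OF f(1)] int[OF g(1)] f(2) g(2) by simp
    finally show ?case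
      using f(1) g(1) by (intro exI[of _ "\<lambda>x. f x + g x"]) (auto intro!: continuous_intros)
  next
    case (lim h s)
    have "(\<lambda>i. \<integral>x. \<bar>h x - s i x\<bar> \<partial>\<mu>) \<longlonglongrightarrow> (\<integral>x. 0 \<partial>\<mu>)"
    proof (rule integral_dominated_convergence)
      show "AE x in \<mu>. (\<lambda>i. \<bar>h x - s i x\<bar>) \<longlonglongrightarrow> 0"
      proof (rule AE_I2)
        fix x assume "x \<in> space \<mu>"
        then have "(\<lambda>i. \<bar>h x - s i x\<bar>) \<longlonglongrightarrow> \<bar>h x - h x\<bar>"
          using lim.hyps(2) by (intro tendsto_intros) auto
        then show "(\<lambda>i. \<bar>h x - s i x\<bar>) \<longlonglongrightarrow> 0" by simp
      qed
      show "AE x in \<mu>. norm \<bar>h x - s i x\<bar> \<le> 3 * \<bar>h x\<bar>" for i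
      proof (rule AE_I2)
        fix x assume "x \<in> space \<mu>"
        then show "norm \<bar>h x - s i x\<bar> \<le> 3 * \<bar>h x\<bar>"
          using lim.hyps(3)[of x i] abs_triangle_ineq4[of "h x" "s i x"] by simp
      qed
    qed (use lim in auto)
    then have "eventually (\<lambda>i. (\<integral>x. \<bar>h x - s i x\<bar> \<partial>\<mu>) < \<epsilon>/2) sequentially"
      using lim.prems by (intro order_tendstoD) auto
    then obtain i where i: "(\<integral>x. \<bar>h x - s i x\<bar> \<partial>\<mu>) < \<epsilon>/2"
      using eventually_sequentially by auto
    obtain f where f: "continuous_on UNIV f" "(\<integral>x. \<bar>s i x - f x\<bar> \<partial>\<mu>) < \<epsilon>/2"
      using lim.IH[of "\<epsilon>/2" i] lim.prems by auto
    have "(\<integral>x. \<bar>h x - f x\<bar> \<partial>\<mu>) \<le> (\<integral>x. \<bar>h x - s i x\<bar> + \<bar>s i x - f x\<bar> \<partial>\<mu>)"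
      using lim.hyps(1,4) int[OF f(1)] by (intro integral_mono) auto
    also have "\<dots> < \<epsilon>"
      using lim.hyps(1,4) int[OF f(1)] i f(2) by simp
    finally show ?case
      using f(1) by blast
  }
qed

section \<open>Weak* neighbourhoods and orbit averages\<close>

text \<open>The integral of \<open>f\<close> against the empirical measure of \<open>x\<close>.\<close>

definition orbit_mean :: "'v set \<Rightarrow> ('g \<Rightarrow> 'v \<Rightarrow> 'v) \<Rightarrow> (('g \<Rightarrow> 'a) \<Rightarrow> real) \<Rightarrow> ('v \<Rightarrow> 'a) \<Rightarrow> real" where
  "orbit_mean V s f x = (\<Sum>v\<in>V. f (pullback_name s v x)) / real (card V)"

definition weak_star_ball ::
  "(('i \<Rightarrow> 'a::topological_space) \<Rightarrow> real) set \<Rightarrow> real \<Rightarrow> ('i \<Rightarrow> 'a) measure \<Rightarrow> ('i \<Rightarrow> 'a) measure set" where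
  "weak_star_ball F \<eta> \<mu> = {\<nu>. prob_space \<nu> \<and> sets \<nu> = sets (seq_space UNIV) \<and>
      (\<forall>f\<in>F. \<bar>integral\<^sup>L \<nu> f - integral\<^sup>L \<mu> f\<bar> < \<eta>)}"

lemma weak_star_ball_nhd:
  fixes \<mu> :: "('i \<Rightarrow> 'a::topological_space) measure"
  assumes "finite F" "\<And>f. f \<in> F \<Longrightarrow> continuous_on UNIV f" "\<eta> > 0"
    and "prob_space \<mu>" "sets \<mu> = sets (seq_space UNIV)"
  shows "weak_star_ball F \<eta> \<mu> \<in> weak_star_nhds \<mu>"
proof -
  let ?B = "\<lambda>f (U :: real set). {\<nu> :: ('i \<Rightarrow> 'a) measure. prob_space \<nu> \<and> sets \<nu> = sets (seq_space UNIV) \<and> integral\<^sup>L \<nu> f \<in> U}"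
  have basic: "openin weak_star (?B f U)" if "continuous_on UNIV f" "open U" for f and U :: "real set"
    unfolding weak_star_def using that by (intro topology_generated_by_Basis) blast
  have "weak_star_ball F \<eta> \<mu> = ?B (\<lambda>_. 0) UNIV \<inter> (\<Inter>f\<in>F. ?B f (ball (integral\<^sup>L \<mu> f) \<eta>))"
    if "F \<noteq> {}"
    using that by (auto simp: weak_star_ball_def dist_real_def abs_minus_commute)
  moreover have "openin weak_star (?B (\<lambda>_. 0) UNIV)"
    by (rule basic) auto
  moreover have "openin weak_star (\<Inter>f\<in>F. ?B f (ball (integral\<^sup>L \<mu> f) \<eta>))" if "F \<noteq> {}"
    using that assms by (intro openin_Inter) (auto simp del: mem_ball intro!: basic)
  moreover have "weak_star_ball {} \<eta> \<mu> = ?B (\<lambda>_. 0) UNIV"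
    by (auto simp: weak_star_ball_def)
  ultimately have "openin weak_star (weak_star_ball F \<eta> \<mu>)"
    by (cases "F = {}") (simp_all add: openin_Int)
  then show ?thesis
    using assms by (auto simp: weak_star_nhds_def weak_star_ball_def)
qed

lemma weak_star_nhd_contains_ball:
  fixes \<mu> :: "('i \<Rightarrow> 'a::topological_space) measure"
  assumes "\<O> \<in> weak_star_nhds \<mu>"
  obtains F \<eta> where "finite F" "\<And>f. f \<in> F \<Longrightarrow> continuous_on UNIV f" "\<eta> > 0"
    "weak_star_ball F \<eta> \<mu> \<subseteq> \<O>"
proof -
  let ?S = "{{\<nu> :: ('i \<Rightarrow> 'a) measure. prob_space \<nu> \<and> sets \<nu> = sets (seq_space UNIV) \<and> integral\<^sup>L \<nu> f \<in> U} | f U.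
        continuous_on UNIV f \<and> open (U :: real set)}"
  have "generate_topology_on ?S \<O>" "\<mu> \<in> \<O>"
    using assms by (auto simp: weak_star_nhds_def weak_star_def openin_topology_generated_by_iff)
  then have "\<exists>F \<eta>. finite F \<and> (\<forall>f\<in>F. continuous_on UNIV f) \<and> \<eta> > 0 \<and> weak_star_ball F \<eta> \<mu> \<subseteq> \<O>"
  proof induction
    case (Int a b)
    from Int.prems have "\<mu> \<in> a" "\<mu> \<in> b" by auto
    from Int.IH(1)[OF this(1)] Int.IH(2)[OF this(2)]
    obtain F \<eta> G \<theta> where "finite F \<and> (\<forall>f\<in>F. continuous_on UNIV f) \<and> \<eta> > 0 \<and> weak_star_ball F \<eta> \<mu> \<subseteq> a"
      "finite G \<and> (\<forall>f\<in>G. continuous_on UNIV f) \<and> \<theta> > 0 \<and> weak_star_ball G \<theta> \<mu> \<subseteq> b"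
      by (elim exE)
    then show ?case
      by (intro exI[of _ "F \<union> G"] exI[of _ "min \<eta> \<theta>"]) (auto simp: weak_star_ball_def)
  next
    case (UN K)
    from UN.prems obtain k where k: "k \<in> K" "\<mu> \<in> k" by blast
    from UN.IH[OF this] k(1) show ?case by (elim exE conjE) (blast intro: order_trans)
  next
    case (Basis s)
    then obtain f and U :: "real set" where s: "continuous_on UNIV f" "open U" "integral\<^sup>L \<mu> f \<in> U"
      "s = {\<nu>. prob_space \<nu> \<and> sets \<nu> = sets (seq_space UNIV) \<and> integral\<^sup>L \<nu> f \<in> U}"
      by auto
    then obtain \<eta> where "\<eta> > 0" "ball (integral\<^sup>L \<mu> f) \<eta> \<subseteq> U"
      using open_contains_ball by blast
    then show ?case
      using s by (intro exI[of _ "{f}"] exI[of _ \<eta>])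
        (auto simp: weak_star_ball_def ball_def dist_real_def abs_minus_commute)
  qed auto
  then show thesis using that by blast
qed

lemma measurable_from_uniform_count_measure:
  "space N = UNIV \<Longrightarrow> f \<in> uniform_count_measure V \<rightarrow>\<^sub>M N"
  by (auto simp: measurable_def sets_uniform_count_measure space_uniform_count_measure)

lemma space_seq_space_UNIV: "space (seq_space UNIV) = UNIV"
  by (simp add: space_PiM)

lemma integral_empirical_measure:
  assumes "finite V" "f \<in> borel_measurable (seq_space UNIV)"
  shows "integral\<^sup>L (empirical_measure V s x) f = orbit_mean V s f x"
  unfolding empirical_measure_def orbit_mean_def using assms
  by (subst integral_distr)
     (auto simp: measurable_from_uniform_count_measure space_seq_space_UNIV
        integral_uniform_count_measure)

lemma prob_space_empirical_measure:
  assumes "finite V" "V \<noteq> {}"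
  shows "prob_space (empirical_measure V s x)"
  unfolding empirical_measure_def
  by (intro prob_space.prob_space_distr prob_space_uniform_count_measure assms
        measurable_from_uniform_count_measure space_seq_space_UNIV)

lemma good_models_weak_star_ball:
  fixes \<mu> :: "('g::countable \<Rightarrow> 'a::second_countable_topology) measure"
  assumes "finite V" "V \<noteq> {}" "\<And>f. f \<in> F \<Longrightarrow> continuous_on UNIV f"
  shows "good_models (weak_star_ball F \<eta> \<mu>) V s =
    {x \<in> V \<rightarrow>\<^sub>E UNIV. \<forall>f\<in>F. \<bar>orbit_mean V s f x - integral\<^sup>L \<mu> f\<bar> < \<eta>}"
  using prob_space_empirical_measure[OF assms(1,2)]
    integral_empirical_measure[OF assms(1) continuous_measurable_seq_space[OF assms(3)]]
  by (auto simp: good_models_def weak_star_ball_def) (simp_all add: empirical_measure_def)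

lemma good_models_weak_star_ballD:
  fixes \<mu> :: "('g::countable \<Rightarrow> 'a::second_countable_topology) measure"
  assumes "x \<in> good_models (weak_star_ball F \<eta> \<mu>) V s" "finite V" "V \<noteq> {}"
    and "\<And>f. f \<in> F \<Longrightarrow> continuous_on UNIV f" "f \<in> F"
  shows "\<bar>orbit_mean V s f x - integral\<^sup>L \<mu> f\<bar> < \<eta>"
proof -
  have "good_models (weak_star_ball F \<eta> \<mu>) V s =
      {x \<in> V \<rightarrow>\<^sub>E UNIV. \<forall>f\<in>F. \<bar>orbit_mean V s f x - integral\<^sup>L \<mu> f\<bar> < \<eta>}"
    by (rule good_models_weak_star_ball[OF assms(2,3)]) (rule assms(4))
  then show ?thesis using assms(1,5) by blast
qed

lemma good_models_weak_star_ballI: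
  fixes \<mu> :: "('g::countable \<Rightarrow> 'a::second_countable_topology) measure"
  assumes "finite V" "V \<noteq> {}" "\<And>f. f \<in> F \<Longrightarrow> continuous_on UNIV f" "x \<in> V \<rightarrow>\<^sub>E UNIV"
    and "\<And>f. f \<in> F \<Longrightarrow> \<bar>orbit_mean V s f x - integral\<^sup>L \<mu> f\<bar> < \<eta>"
  shows "x \<in> good_models (weak_star_ball F \<eta> \<mu>) V s"
proof -
  have "good_models (weak_star_ball F \<eta> \<mu>) V s =
      {x \<in> V \<rightarrow>\<^sub>E UNIV. \<forall>f\<in>F. \<bar>orbit_mean V s f x - integral\<^sup>L \<mu> f\<bar> < \<eta>}"
    by (rule good_models_weak_star_ball[OF assms(1,2)]) (rule assms(3))
  then show ?thesis using assms(4,5) by blast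
qed

subsection \<open>Estimates for orbit averages\<close>

lemma orbit_mean_add: "orbit_mean V s (\<lambda>x. f x + g x) x = orbit_mean V s f x + orbit_mean V s g x"
  by (simp add: orbit_mean_def sum.distrib add_divide_distrib)

abbreviation mean :: "'v set \<Rightarrow> ('v \<Rightarrow> real) \<Rightarrow> real" where
  "mean V h \<equiv> (\<Sum>v\<in>V. h v) / real (card V)"

lemma mean_mono: "(\<And>v. v \<in> V \<Longrightarrow> h v \<le> k v) \<Longrightarrow> mean V h \<le> mean V k"
  by (intro divide_right_mono sum_mono) auto

lemma mean_add: "mean V (\<lambda>v. h v + k v) = mean V h + mean V k"
  by (simp add: sum.distrib add_divide_distrib)

lemma mean_diff: "mean V (\<lambda>v. h v - k v) = mean V h - mean V k"
  by (simp add: sum_subtractf diff_divide_distrib)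

lemma mean_cmult: "mean V (\<lambda>v. c * h v) = c * mean V h"
  by (simp add: sum_distrib_left)

lemma mean_sum: "mean V (\<lambda>v. \<Sum>i\<in>I. h i v) = (\<Sum>i\<in>I. mean V (h i))"
  by (subst sum.swap) (simp add: sum_divide_distrib)

lemma abs_mean_le: "\<bar>mean V h\<bar> \<le> mean V (\<lambda>v. \<bar>h v\<bar>)"
  by (simp add: divide_right_mono)

lemma mean_le_bound:
  assumes "finite V" "V \<noteq> {}" "\<And>v. v \<in> V \<Longrightarrow> h v \<le> c"
  shows "mean V h \<le> c"
  using mean_mono[of V h "\<lambda>_. c"] assms by simp

lemma abs_mean_mult_le:
  assumes "finite V" "V \<noteq> {}" "\<And>v. v \<in> V \<Longrightarrow> \<bar>h v\<bar> \<le> B" "\<And>v. v \<in> V \<Longrightarrow> \<bar>k v\<bar> \<le> C"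
  shows "\<bar>mean V (\<lambda>v. h v * k v)\<bar> \<le> B * C"
  using assms
  by (intro order.trans[OF abs_mean_le] mean_le_bound) (auto simp: abs_mult intro!: mult_mono')

lemma mean_bij:
  assumes "bij_betw p V V"
  shows "mean V (\<lambda>v. h (p v)) = mean V h"
  using sum.reindex_bij_betw[OF assms, of h] by simp

lemma orbit_mean_eq_mean: "orbit_mean V s f x = mean V (\<lambda>v. f (pullback_name s v x))"
  by (simp add: orbit_mean_def)

lemma orbit_mean_uniform_close:
  assumes "finite V" "V \<noteq> {}" "\<And>x. \<bar>f x - g x\<bar> < \<epsilon>"
  shows "\<bar>orbit_mean V s f x - orbit_mean V s g x\<bar> \<le> \<epsilon>"
proof -
  have "\<bar>orbit_mean V s f x - orbit_mean V s g x\<bar>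
      \<le> mean V (\<lambda>v. \<bar>f (pullback_name s v x) - g (pullback_name s v x)\<bar>)"
    unfolding orbit_mean_eq_mean mean_diff[symmetric] by (rule abs_mean_le)
  also have "\<dots> \<le> \<epsilon>"
    using assms less_imp_le by (intro mean_le_bound) auto
  finally show ?thesis .
qed

lemma integral_uniform_close:
  assumes "prob_space \<mu>" "integrable \<mu> f" "integrable \<mu> g" "\<And>x. \<bar>f x - g x\<bar> < (\<epsilon>::real)"
  shows "\<bar>integral\<^sup>L \<mu> f - integral\<^sup>L \<mu> g\<bar> \<le> \<epsilon>"
proof -
  interpret prob_space \<mu> by fact
  have "\<bar>integral\<^sup>L \<mu> f - integral\<^sup>L \<mu> g\<bar> = \<bar>\<integral>x. f x - g x \<partial>\<mu>\<bar>"
    using assms by simp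
  also have "\<dots> \<le> (\<integral>x. \<bar>f x - g x\<bar> \<partial>\<mu>)"
    by (rule integral_abs_bound)
  also have "\<dots> \<le> (\<integral>x. \<epsilon> \<partial>\<mu>)"
    using assms less_imp_le by (intro integral_mono) auto
  finally show ?thesis by (simp add: prob_space)
qed

subsection \<open>Properties of all good models\<close>

text \<open>
  As a predicate of \<open>R\<close> this is closed under conjunction and weakening, so that finitely many estimates
  can be combined without naming neighbourhoods.
\<close>

definition for_good_models ::
  "(nat \<Rightarrow> 'v set) \<Rightarrow> (nat \<Rightarrow> 'g \<Rightarrow> 'v \<Rightarrow> 'v) \<Rightarrow> ('g \<Rightarrow> 'a::topological_space) measure \<Rightarrow>
    (nat \<Rightarrow> ('v \<Rightarrow> 'a) \<Rightarrow> bool) \<Rightarrow> bool" where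
  "for_good_models V \<sigma> \<mu> R \<longleftrightarrow>
     (\<exists>\<O> \<in> weak_star_nhds \<mu>. \<forall>\<^sub>F n in sequentially. \<forall>w \<in> good_models \<O> (V n) (\<sigma> n). R n w)"

lemma for_good_models_conj:
  assumes "for_good_models V \<sigma> \<mu> R" "for_good_models V \<sigma> \<mu> Q"
  shows "for_good_models V \<sigma> \<mu> (\<lambda>n w. R n w \<and> Q n w)"
proof -
  obtain \<O>1 \<O>2 where 1: "\<O>1 \<in> weak_star_nhds \<mu>" "\<forall>\<^sub>F n in sequentially. \<forall>w \<in> good_models \<O>1 (V n) (\<sigma> n). R n w"
    and 2: "\<O>2 \<in> weak_star_nhds \<mu>" "\<forall>\<^sub>F n in sequentially. \<forall>w \<in> good_models \<O>2 (V n) (\<sigma> n). Q n w"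
    using assms unfolding for_good_models_def by blast
  have "\<O>1 \<inter> \<O>2 \<in> weak_star_nhds \<mu>"
    using 1(1) 2(1) by (auto simp: weak_star_nhds_def)
  moreover have "\<forall>\<^sub>F n in sequentially. \<forall>w \<in> good_models (\<O>1 \<inter> \<O>2) (V n) (\<sigma> n). R n w \<and> Q n w"
    using 1(2) 2(2) by eventually_elim (auto simp: good_models_def)
  ultimately show ?thesis
    unfolding for_good_models_def by blast
qed

lemma for_good_models_mono:
  assumes "for_good_models V \<sigma> \<mu> R" "\<forall>\<^sub>F n in sequentially. \<forall>w. R n w \<longrightarrow> Q n w"
  shows "for_good_models V \<sigma> \<mu> Q"
proof -
  obtain \<O> where \<O>: "\<O> \<in> weak_star_nhds \<mu>" "\<forall>\<^sub>F n in sequentially. \<forall>w \<in> good_models \<O> (V n) (\<sigma> n). R n w"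
    using assms(1) unfolding for_good_models_def by blast
  have "\<forall>\<^sub>F n in sequentially. \<forall>w \<in> good_models \<O> (V n) (\<sigma> n). Q n w"
    using \<O>(2) assms(2) by eventually_elim blast
  with \<O>(1) show ?thesis unfolding for_good_models_def by blast
qed

lemma for_good_models_orbit_mean:
  fixes \<mu> :: "('g::countable \<Rightarrow> 'a::second_countable_topology) measure"
  assumes "prob_space \<mu>" "sets \<mu> = sets (seq_space UNIV)" "\<And>n. finite (V n)" "\<And>n. V n \<noteq> {}"
    and "continuous_on UNIV f" "\<eta> > 0"
  shows "for_good_models V \<sigma> \<mu> (\<lambda>n w. \<bar>orbit_mean (V n) (\<sigma> n) f w - integral\<^sup>L \<mu> f\<bar> < \<eta>)"
  unfolding for_good_models_def
proof
  show "weak_star_ball {f} \<eta> \<mu> \<in> weak_star_nhds \<mu>"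
    using assms by (intro weak_star_ball_nhd) auto
  show "\<forall>\<^sub>F n in sequentially. \<forall>w\<in>good_models (weak_star_ball {f} \<eta> \<mu>) (V n) (\<sigma> n).
      \<bar>orbit_mean (V n) (\<sigma> n) f w - integral\<^sup>L \<mu> f\<bar> < \<eta>"
    using assms(5) by (intro always_eventually allI ballI good_models_weak_star_ballD[OF _ assms(3,4)]) auto
qed

lemma for_good_models_ball:
  assumes "finite F" "\<And>f. f \<in> F \<Longrightarrow> for_good_models V \<sigma> \<mu> (R f)"
    and "for_good_models V \<sigma> \<mu> (\<lambda>_ _. True)"
  shows "for_good_models V \<sigma> \<mu> (\<lambda>n w. \<forall>f\<in>F. R f n w)"
  using assms(1,2)
proof (induction F rule: finite_induct)
  case empty
  then show ?case using assms(3) by simp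
next
  case (insert f F)
  then show ?case
    using for_good_models_conj[of V \<sigma> \<mu> "R f" "\<lambda>n w. \<forall>f\<in>F. R f n w"] by simp
qed

lemma for_good_models_True:
  fixes \<mu> :: "('g \<Rightarrow> 'a::topological_space) measure"
  assumes "prob_space \<mu>" "sets \<mu> = sets (seq_space UNIV)"
  shows "for_good_models V \<sigma> \<mu> (\<lambda>_ _. True)"
  unfolding for_good_models_def
  using weak_star_ball_nhd[of "{}" 1 \<mu>] assms by (intro bexI[of _ "weak_star_ball {} 1 \<mu>"]) auto

section \<open>Joint measures\<close>

lemma measurable_joint:
  fixes \<mu> :: "('i \<Rightarrow> 'a::second_countable_topology) measure"
    and \<nu> :: "('i \<Rightarrow> 'b::second_countable_topology) measure"
  assumes "sets \<mu> = sets (seq_space I)" "sets \<nu> = sets (seq_space I)"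
  shows "(\<lambda>(x, y). \<lambda>i\<in>I. (x i, y i)) \<in> \<mu> \<Otimes>\<^sub>M \<nu> \<rightarrow>\<^sub>M seq_space I"
proof -
  have "(\<lambda>(x, y). \<lambda>i\<in>I. (x i, y i)) \<in> seq_space I \<Otimes>\<^sub>M seq_space I \<rightarrow>\<^sub>M (seq_space I :: ('i \<Rightarrow> 'a \<times> 'b) measure)"
    unfolding split_beta'
    by (intro measurable_restrict borel_measurable_Pair) measurable
  then show ?thesis
    using measurable_cong_sets[OF sets_pair_measure_cong[OF assms] refl] by blast
qed

lemma prob_space_joint_measure:
  fixes \<mu> :: "('i \<Rightarrow> 'a::second_countable_topology) measure"
    and \<nu> :: "('i \<Rightarrow> 'b::second_countable_topology) measure"
  assumes "prob_space \<mu>" "prob_space \<nu>" "sets \<mu> = sets (seq_space I)" "sets \<nu> = sets (seq_space I)"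
  shows "prob_space (joint_measure I \<mu> \<nu>)"
proof -
  interpret M: prob_space \<mu> by fact
  interpret N: prob_space \<nu> by fact
  interpret P: pair_prob_space \<mu> \<nu> ..
  show ?thesis
    unfolding joint_measure_def
    by (intro P.P.prob_space_distr measurable_joint assms)
qed

lemma sets_joint_measure [simp]: "sets (joint_measure I \<mu> \<nu>) = sets (seq_space I)"
  by (simp add: joint_measure_def)

lemma integral_pair_mult:
  fixes f :: "'a \<Rightarrow> real" and g :: "'b \<Rightarrow> real"
  assumes "prob_space M" "prob_space N" "f \<in> borel_measurable M" "g \<in> borel_measurable N"
    and "\<And>x. \<bar>f x\<bar> \<le> B" "\<And>y. \<bar>g y\<bar> \<le> C"
  shows "integrable (M \<Otimes>\<^sub>M N) (\<lambda>z. f (fst z) * g (snd z))"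
    and "(\<integral>z. f (fst z) * g (snd z) \<partial>(M \<Otimes>\<^sub>M N)) = integral\<^sup>L M f * integral\<^sup>L N g"
proof -
  interpret M: prob_space M by fact
  interpret N: prob_space N by fact
  interpret P: pair_prob_space M N ..
  note [measurable] = assms(3,4)
  show int: "integrable (M \<Otimes>\<^sub>M N) (\<lambda>z. f (fst z) * g (snd z))"
  proof (rule P.P.integrable_const_bound[where B = "B * C"])
    show "AE z in M \<Otimes>\<^sub>M N. norm (f (fst z) * g (snd z)) \<le> B * C"
    proof (rule AE_I2)
      fix z
      show "norm (f (fst z) * g (snd z)) \<le> B * C"
        using assms(5)[of "fst z"] assms(6)[of "snd z"] by (simp add: abs_mult mult_mono')
    qed
  qed measurable
  show "(\<integral>z. f (fst z) * g (snd z) \<partial>(M \<Otimes>\<^sub>M N)) = integral\<^sup>L M f * integral\<^sup>L N g"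
    using P.integral_fst'[OF int] by simp
qed

lemma integral_joint_measure_mult:
  fixes \<mu> :: "('i::countable \<Rightarrow> 'a::second_countable_topology) measure"
    and \<nu> :: "('i \<Rightarrow> 'b::second_countable_topology) measure"
  assumes "prob_space \<mu>" "prob_space \<nu>" "sets \<mu> = sets (seq_space UNIV)" "sets \<nu> = sets (seq_space UNIV)"
    and "compact (UNIV :: 'a set)" "compact (UNIV :: 'b set)"
    and "continuous_on UNIV f" "continuous_on UNIV g"
  shows "(\<integral>w. f (\<lambda>i. fst (w i)) * g (\<lambda>i. snd (w i)) \<partial>joint_measure UNIV \<mu> \<nu>)
    = integral\<^sup>L \<mu> f * (integral\<^sup>L \<nu> g :: real)"
proof -
  obtain B where B: "\<And>x. \<bar>f x\<bar> \<le> B"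
    using continuous_bounded_compact[OF compact_UNIV_fun[OF assms(5)] assms(7)] by blast
  obtain C where C: "\<And>x. \<bar>g x\<bar> \<le> C"
    using continuous_bounded_compact[OF compact_UNIV_fun[OF assms(6)] assms(8)] by blast
  have "continuous_on UNIV (\<lambda>w::'i \<Rightarrow> 'a \<times> 'b. f (\<lambda>i. fst (w i)) * g (\<lambda>i. snd (w i)))"
    by (intro continuous_intros continuous_on_compose2[OF assms(7)] continuous_on_compose2[OF assms(8)]) auto
  from continuous_measurable_seq_space[OF this]
  have "(\<integral>w. f (\<lambda>i. fst (w i)) * g (\<lambda>i. snd (w i)) \<partial>joint_measure UNIV \<mu> \<nu>)
    = (\<integral>z. f (fst z) * g (snd z) \<partial>(\<mu> \<Otimes>\<^sub>M \<nu>))"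
    unfolding joint_measure_def
    by (subst integral_distr[OF measurable_joint[OF assms(3,4)]]) (auto simp: split_beta')
  also have "\<dots> = integral\<^sup>L \<mu> f * integral\<^sup>L \<nu> g"
    using continuous_measurable_seq_space[OF assms(7)] continuous_measurable_seq_space[OF assms(8)]
      measurable_cong_sets[OF assms(3) refl] measurable_cong_sets[OF assms(4) refl]
    by (intro integral_pair_mult(2)[OF assms(1,2) _ _ B C]) blast+
  finally show ?thesis .
qed

lemma pullback_name_pair:
  assumes "\<And>g. s g v \<in> V"
  shows "(\<lambda>g. fst (pullback_name s v (\<lambda>v\<in>V. (x v, y v)) g)) = pullback_name s v x"
    and "(\<lambda>g. snd (pullback_name s v (\<lambda>v\<in>V. (x v, y v)) g)) = pullback_name s v y"
  using assms by (auto simp: pullback_name_def)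

lemma measurable_pullback_name:
  assumes "\<And>g. s g v \<in> V"
  shows "pullback_name s v \<in> seq_space V \<rightarrow>\<^sub>M (seq_space UNIV :: ('g \<Rightarrow> 'a::topological_space) measure)"
  unfolding pullback_name_def
  by (rule measurable_PiM_single') (use assms in \<open>auto intro!: measurable_component_singleton\<close>)

lemma measurable_orbit_mean:
  assumes "\<And>g v. v \<in> V \<Longrightarrow> s g v \<in> V" "f \<in> borel_measurable (seq_space UNIV)"
  shows "orbit_mean V s f \<in> borel_measurable (seq_space V)"
  unfolding orbit_mean_def
  by (intro borel_measurable_divide borel_measurable_sum borel_measurable_const
      measurable_compose[OF measurable_pullback_name assms(2)]) (use assms in auto)

lemma measurable_pair_with:
  fixes y :: "'v \<Rightarrow> 'b::second_countable_topology"
  shows "(\<lambda>x. \<lambda>v\<in>V. (x v, y v)) \<in> seq_space V \<rightarrow>\<^sub>M (seq_space V :: ('v \<Rightarrow> 'a::second_countable_topology \<times> 'b) measure)"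
  by (intro measurable_restrict borel_measurable_Pair) auto

lemma measurable_pair_orbit_mean:
  fixes m :: "('v \<Rightarrow> 'a::second_countable_topology) measure" and y :: "'v \<Rightarrow> 'b::second_countable_topology"
    and f :: "('g::countable \<Rightarrow> 'a \<times> 'b) \<Rightarrow> real"
  assumes "sets m = sets (seq_space V)" "\<And>g v. v \<in> V \<Longrightarrow> s g v \<in> V" "continuous_on UNIV f"
  shows "(\<lambda>x. orbit_mean V s f (\<lambda>v\<in>V. (x v, y v))) \<in> borel_measurable m"
  unfolding measurable_cong_sets[OF assms(1) refl]
  using assms(2) by (intro measurable_compose[OF measurable_pair_with measurable_orbit_mean]
      continuous_measurable_seq_space[OF assms(3)]) auto

lemma measurable_shift:
  assumes "sets \<mu> = sets (seq_space UNIV)"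
  shows "shift g \<in> \<mu> \<rightarrow>\<^sub>M \<mu>"
  unfolding measurable_cong_sets[OF assms assms] shift_def
  by (rule measurable_PiM_single') (auto intro!: measurable_component_singleton)

section \<open>Pairing a model with a doubly-quenched random model\<close>

text \<open>
  Writing \<open>h\<close> for the random mean \<open>\<Sum>\<^sub>v \<phi>\<^sub>v g\<^sub>v / |V|\<close>, one has
  \<open>E[h\<^sup>2] = \<Sum>\<^sub>v g\<^sub>v E[h \<phi>\<^sub>v] / |V|\<close>. Cauchy--Schwarz removes the coefficients \<open>g\<^sub>v\<close>, and squaring
  the expectations \<open>E[h \<phi>\<^sub>v]\<close> introduces an independent copy. The resulting bound is uniform in
  the coefficients, although they may be chosen with knowledge of the distribution of \<open>\<phi>\<close>.
\<close>

lemma second_moment_decoupling: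
  fixes \<phi> :: "'v \<Rightarrow> 'x \<Rightarrow> real"
  assumes "prob_space m" "finite V" "V \<noteq> {}"
    and meas: "\<And>v. v \<in> V \<Longrightarrow> \<phi> v \<in> borel_measurable m"
    and B: "\<And>v x. \<bar>\<phi> v x\<bar> \<le> B" and C: "\<And>v. \<bar>g v\<bar> \<le> C"
  shows "(\<integral>x. (mean V (\<lambda>v. \<phi> v x * g v))\<^sup>2 \<partial>m)\<^sup>2
    \<le> C\<^sup>2 * (B * C)\<^sup>2 * (\<integral>z. \<bar>mean V (\<lambda>v. \<phi> v (fst z) * \<phi> v (snd z))\<bar> \<partial>(m \<Otimes>\<^sub>M m))"
proof -
  interpret prob_space m by fact
  interpret P: pair_prob_space m m ..
  have B0: "B \<ge> 0" and C0: "C \<ge> 0"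
    using B C abs_ge_zero order_trans by blast+
  define h where "h x = mean V (\<lambda>v. \<phi> v x * g v)" for x
  define a where "a v = (\<integral>x. h x * \<phi> v x \<partial>m)" for v
  define D where "D z = mean V (\<lambda>v. \<phi> v (fst z) * \<phi> v (snd z))" for z
  have hm: "h \<in> borel_measurable m"
    unfolding h_def using meas by (intro borel_measurable_divide borel_measurable_sum) auto
  have hb: "\<bar>h x\<bar> \<le> B * C" for x
    unfolding h_def using B C by (rule abs_mean_mult_le[OF assms(2,3)])
  have hpb: "\<bar>h x * \<phi> v x\<bar> \<le> B * C * B" for x v
    using hb[of x] B[of v x] B0 C0 by (auto simp: abs_mult intro!: mult_mono)
  have hpm: "(\<lambda>x. h x * \<phi> v x) \<in> borel_measurable m" if "v \<in> V" for v
    using hm meas[OF that] by measurable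
  have hpi: "integrable m (\<lambda>x. h x * \<phi> v x)" if "v \<in> V" for v
    by (rule integrable_const_bound[where B = "B * C * B"]) (use hpb hpm[OF that] in auto)
  have "(\<integral>x. (h x)\<^sup>2 \<partial>m) = (\<integral>x. mean V (\<lambda>v. g v * (h x * \<phi> v x)) \<partial>m)"
  proof (rule Bochner_Integration.integral_cong[OF refl])
    fix x
    have "(h x)\<^sup>2 = h x * mean V (\<lambda>v. \<phi> v x * g v)"
      by (simp add: power2_eq_square h_def)
    then show "(h x)\<^sup>2 = mean V (\<lambda>v. g v * (h x * \<phi> v x))"
      by (simp add: sum_distrib_left algebra_simps)
  qed
  also have "\<dots> = mean V (\<lambda>v. g v * a v)"
    using hpi by (simp add: a_def)
  finally have Eh: "(\<integral>x. (h x)\<^sup>2 \<partial>m) = mean V (\<lambda>v. g v * a v)" .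
  have "\<bar>mean V (\<lambda>v. g v * a v)\<bar> \<le> mean V (\<lambda>v. \<bar>g v * a v\<bar>)"
    by (rule abs_mean_le)
  also have "\<dots> \<le> mean V (\<lambda>v. C * \<bar>a v\<bar>)"
    using C by (intro mean_mono) (auto simp: abs_mult intro!: mult_right_mono)
  finally have "\<bar>mean V (\<lambda>v. g v * a v)\<bar> \<le> C * mean V (\<lambda>v. \<bar>a v\<bar>)"
    by (simp add: mean_cmult)
  then have "(mean V (\<lambda>v. g v * a v))\<^sup>2 \<le> (C * mean V (\<lambda>v. \<bar>a v\<bar>))\<^sup>2"
    by (rule power2_le_iff_abs_le[THEN iffD2, rotated])
       (intro mult_nonneg_nonneg C0 divide_nonneg_nonneg sum_nonneg, auto)
  also have "\<dots> = C\<^sup>2 * (\<Sum>v\<in>V. \<bar>a v\<bar>)\<^sup>2 / (real (card V))\<^sup>2"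
    by (simp add: power_mult_distrib power_divide)
  also have "\<dots> \<le> C\<^sup>2 * (real (card V) * (\<Sum>v\<in>V. (a v)\<^sup>2)) / (real (card V))\<^sup>2"
    using sum_squared_le_sum_of_squares[of "\<lambda>v. \<bar>a v\<bar>" V] assms(2)
    by (intro divide_right_mono mult_left_mono) (auto simp: mult.commute)
  also have "\<dots> = C\<^sup>2 * mean V (\<lambda>v. (a v)\<^sup>2)"
    using assms(2,3) by (simp add: power2_eq_square)
  also have "mean V (\<lambda>v. (a v)\<^sup>2) \<le> (B * C)\<^sup>2 * (\<integral>z. \<bar>D z\<bar> \<partial>(m \<Otimes>\<^sub>M m))"
  proof -
    have Dm: "D \<in> borel_measurable (m \<Otimes>\<^sub>M m)"
      unfolding D_def
      by (intro borel_measurable_divide borel_measurable_sum borel_measurable_times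
          measurable_compose[OF measurable_fst meas] measurable_compose[OF measurable_snd meas]) auto
    have Db: "\<bar>D z\<bar> \<le> B * B" for z
      unfolding D_def using B B by (rule abs_mean_mult_le[OF assms(2,3)])
    have Di: "integrable (m \<Otimes>\<^sub>M m) D"
      by (rule P.P.integrable_const_bound[where B = "B * B"]) (use Db Dm in auto)
    have sq: "integrable (m \<Otimes>\<^sub>M m) (\<lambda>z. (h (fst z) * \<phi> v (fst z)) * (h (snd z) * \<phi> v (snd z)))"
      "(a v)\<^sup>2 = (\<integral>z. (h (fst z) * \<phi> v (fst z)) * (h (snd z) * \<phi> v (snd z)) \<partial>(m \<Otimes>\<^sub>M m))" if "v \<in> V" for v
      using integral_pair_mult[OF assms(1,1) hpm[OF that] hpm[OF that], of "B * C * B" "B * C * B"] hpb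
      by (simp_all add: a_def power2_eq_square)
    have "mean V (\<lambda>v. (a v)\<^sup>2) =
        (\<integral>z. mean V (\<lambda>v. (h (fst z) * \<phi> v (fst z)) * (h (snd z) * \<phi> v (snd z))) \<partial>(m \<Otimes>\<^sub>M m))"
      using sq by simp
    also have "\<dots> = (\<integral>z. h (fst z) * h (snd z) * D z \<partial>(m \<Otimes>\<^sub>M m))"
      by (intro Bochner_Integration.integral_cong refl)
         (simp add: D_def sum_distrib_left sum_divide_distrib algebra_simps)
    also have "\<dots> \<le> (\<integral>z. (B * C)\<^sup>2 * \<bar>D z\<bar> \<partial>(m \<Otimes>\<^sub>M m))"
    proof (rule integral_mono')
      fix z
      have "h (fst z) * h (snd z) * D z \<le> \<bar>h (fst z)\<bar> * \<bar>h (snd z)\<bar> * \<bar>D z\<bar>"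
        by (metis abs_mult abs_ge_self)
      also have "\<dots> \<le> (B * C) * (B * C) * \<bar>D z\<bar>"
        using hb B0 C0 by (intro mult_right_mono mult_mono) auto
      finally show "h (fst z) * h (snd z) * D z \<le> (B * C)\<^sup>2 * \<bar>D z\<bar>"
        by (simp add: power2_eq_square)
    qed (use Di in auto)
    finally show ?thesis by simp
  qed
  finally show ?thesis
    unfolding Eh[symmetric] h_def[symmetric] D_def[symmetric]
    by (simp add: mult_left_mono mult.assoc)
qed

text \<open>
  The mean over \<open>v\<close> is the orbit average of \<open>f \<otimes> f\<close> over a pair of independent samples, and a typical
  such pair is a good model of the joint process \<open>\<alpha> \<times> \<alpha>\<close>, for which \<open>f \<otimes> f\<close> has integral \<open>0\<close>.
\<close>

lemma doubly_quenched_decorrelation: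
  fixes \<alpha> :: "('g::countable \<Rightarrow> 'a::{complete_space, second_countable_topology}) measure"
  assumes cpt: "compact (UNIV :: 'a set)"
    and \<alpha>: "prob_space \<alpha>" "sets \<alpha> = sets (seq_space UNIV)"
    and V: "\<And>i. finite (V i)" "\<And>i. V i \<noteq> {}" "\<And>i g v. v \<in> V i \<Longrightarrow> s i g v \<in> V i"
    and dq: "doubly_quenched_converges V s m \<alpha>"
    and f: "continuous_on UNIV f" "integral\<^sup>L \<alpha> f = 0"
  shows "(\<lambda>i. \<integral>z. \<bar>mean (V i) (\<lambda>v. f (pullback_name (s i) v (fst z)) * f (pullback_name (s i) v (snd z)))\<bar>
             \<partial>(m i \<Otimes>\<^sub>M m i)) \<longlonglongrightarrow> 0"
proof (rule tendstoI)
  fix \<epsilon> :: real assume \<epsilon>: "\<epsilon> > 0"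
  define D where "D i z = mean (V i) (\<lambda>v. f (pullback_name (s i) v (fst z)) * f (pullback_name (s i) v (snd z)))" for i z
  obtain B where B: "B > 0" "\<And>x. \<bar>f x\<bar> \<le> B"
    using continuous_bounded_compact[OF compact_UNIV_fun[OF cpt] f(1)] by blast
  define F where "F w = f (\<lambda>g. fst (w g)) * f (\<lambda>g. snd (w g))" for w :: "'g \<Rightarrow> 'a \<times> 'a"
  have F: "continuous_on UNIV F"
    unfolding F_def by (intro continuous_intros continuous_on_compose2[OF f(1)]) auto
  have F0: "integral\<^sup>L (joint_measure UNIV \<alpha> \<alpha>) F = 0"
    unfolding F_def using integral_joint_measure_mult[OF \<alpha>(1,1,2,2) cpt cpt f(1) f(1)] f(2) by simp
  \<comment> \<open>The integrand is at most \<open>\<kappa>\<close> on good pairs; on the others, of probability at most \<open>\<kappa> / B\<^sup>2\<close>, it is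
    at most \<open>B\<^sup>2\<close>.\<close>
  define \<kappa> where "\<kappa> = \<epsilon> / 3"
  define \<O> where "\<O> = weak_star_ball {F} \<kappa> (joint_measure UNIV \<alpha> \<alpha>)"
  have "\<O> \<in> weak_star_nhds (joint_measure UNIV \<alpha> \<alpha>)"
    unfolding \<O>_def using F \<epsilon> prob_space_joint_measure[OF \<alpha>(1,1,2,2)]
    by (intro weak_star_ball_nhd) (auto simp: \<kappa>_def)
  then have lim: "(\<lambda>i. measure (joint_measure (V i) (m i) (m i)) (good_models \<O> (V i) (s i))) \<longlonglongrightarrow> 1"
    using dq unfolding doubly_quenched_converges_def quenched_converges_def by blast
  have m: "prob_space (m i)" "sets (m i) = sets (seq_space (V i))" for i
    using dq unfolding doubly_quenched_converges_def by auto
  have "eventually (\<lambda>i. measure (joint_measure (V i) (m i) (m i)) (good_models \<O> (V i) (s i)) > 1 - \<kappa> / B\<^sup>2) sequentially"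
    using lim \<epsilon> B(1) by (intro order_tendstoD) (auto simp: \<kappa>_def)
  then show "\<forall>\<^sub>F i in sequentially. dist (\<integral>z. \<bar>mean (V i) (\<lambda>v. f (pullback_name (s i) v (fst z)) * f (pullback_name (s i) v (snd z)))\<bar>
             \<partial>(m i \<Otimes>\<^sub>M m i)) 0 < \<epsilon>"
  proof eventually_elim
    case (elim i)
    interpret M: prob_space "m i" by (rule m)
    interpret P: pair_prob_space "m i" "m i" ..
    let ?J = "\<lambda>z. \<lambda>v\<in>V i. (fst z v, snd z v)"
    let ?P = "m i \<Otimes>\<^sub>M m i"
    have J: "?J \<in> ?P \<rightarrow>\<^sub>M seq_space (V i)"
      using measurable_joint[OF m(2) m(2)] by (simp add: split_beta')
    have JD: "orbit_mean (V i) (s i) F (?J z) = D i z" for z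
      unfolding orbit_mean_def D_def F_def
      by (intro arg_cong2[where f = "(/)"] sum.cong refl) (simp add: pullback_name_pair V)
    have Jm: "orbit_mean (V i) (s i) F \<in> borel_measurable (seq_space (V i))"
      using V(3) continuous_measurable_seq_space[OF F] by (intro measurable_orbit_mean) auto
    have Dm: "D i \<in> borel_measurable ?P"
      using measurable_compose[OF J Jm] by (simp add: JD)
    have good: "good_models \<O> (V i) (s i) = {x \<in> space (seq_space (V i)). \<bar>orbit_mean (V i) (s i) F x\<bar> < \<kappa>}"
      unfolding \<O>_def using F F0 V by (subst good_models_weak_star_ball) (auto simp: space_PiM)
    have good_meas: "good_models \<O> (V i) (s i) \<in> sets (seq_space (V i))"
      unfolding good using Jm by measurable
    define G where "G = {z \<in> space ?P. \<bar>D i z\<bar> < \<kappa>}"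
    have G: "G \<in> sets ?P"
      unfolding G_def using Dm by measurable
    have "measure (joint_measure (V i) (m i) (m i)) (good_models \<O> (V i) (s i)) = measure ?P G"
      unfolding joint_measure_def split_beta'
      by (subst measure_distr[OF J good_meas])
         (use measurable_space[OF J] in \<open>auto simp: good G_def JD intro!: arg_cong[where f = "measure _"]\<close>)
    then have PG: "1 - P.prob G < \<kappa> / B\<^sup>2"
      using elim by simp
    have Db: "\<bar>D i z\<bar> \<le> B\<^sup>2" for z
      unfolding D_def power2_eq_square by (intro abs_mean_mult_le V B(2))
    have "(\<integral>z. \<bar>D i z\<bar> \<partial>?P) \<le> (\<integral>z. \<kappa> + B\<^sup>2 * indicator (space ?P - G) z \<partial>?P)"
    proof (rule integral_mono')
      show "integrable ?P (\<lambda>z. \<kappa> + B\<^sup>2 * indicator (space ?P - G) z)"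
        using G by (intro Bochner_Integration.integrable_add integrable_mult_right integrable_real_indicator)
          (auto simp: P.P.emeasure_eq_measure)
      fix z assume "z \<in> space ?P"
      then show "\<bar>D i z\<bar> \<le> \<kappa> + B\<^sup>2 * indicator (space ?P - G) z"
        using Db[of z] \<epsilon> by (cases "z \<in> G") (auto simp: G_def \<kappa>_def)
    qed (use \<epsilon> in \<open>auto simp: \<kappa>_def\<close>)
    also have "\<dots> = \<kappa> + B\<^sup>2 * (1 - P.prob G)"
      using G P.P.prob_compl[OF G] by (simp add: P.P.prob_space P.P.emeasure_eq_measure sets.compl_sets)
    also have "\<dots> < \<kappa> + B\<^sup>2 * (\<kappa> / B\<^sup>2)"
      using PG B(1) by (intro add_strict_left_mono mult_strict_left_mono) auto
    also have "\<dots> < \<epsilon>"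
      using B(1) \<epsilon> by (simp add: \<kappa>_def)
    finally show ?case
      unfolding D_def[symmetric] by (simp add: dist_real_def)
  qed
qed

text \<open>
  For product test functions \<open>p \<otimes> q\<close> this is Chebyshev's inequality together with the decoupling
  bound, applied to \<open>p\<close> minus its integral. These products are closed under multiplication and separate
  points, so their sums are dense.
\<close>

lemma generic_product:
  fixes \<alpha> :: "('g::countable \<Rightarrow> 'a::{complete_space, second_countable_topology}) measure"
    and \<beta> :: "('g \<Rightarrow> 'b::{complete_space, second_countable_topology}) measure"
    and f :: "('g \<Rightarrow> 'a \<times> 'b) \<Rightarrow> real"
  assumes cpt: "compact (UNIV :: 'a set)" "compact (UNIV :: 'b set)"
    and \<alpha>: "prob_space \<alpha>" "sets \<alpha> = sets (seq_space UNIV)"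
    and \<beta>: "prob_space \<beta>" "sets \<beta> = sets (seq_space UNIV)"
    and V: "\<And>i. finite (V i)" "\<And>i. V i \<noteq> {}" "\<And>i g v. v \<in> V i \<Longrightarrow> s i g v \<in> V i"
    and dq: "doubly_quenched_converges V s m \<alpha>"
    and f: "continuous_on UNIV f" and "\<epsilon> > 0" "\<eta> > 0"
  shows "for_good_models V s \<beta> (\<lambda>i y.
    measure (m i) {x \<in> space (m i). \<eta> \<le> \<bar>orbit_mean (V i) (s i) f (\<lambda>v\<in>V i. (x v, y v))
        - integral\<^sup>L (joint_measure UNIV \<alpha> \<beta>) f\<bar>} < \<epsilon>)"
proof -
  let ?J = "joint_measure UNIV \<alpha> \<beta>"
  have J: "prob_space ?J" "sets ?J = sets (seq_space UNIV)"
    using prob_space_joint_measure[OF \<alpha>(1) \<beta>(1) \<alpha>(2) \<beta>(2)] by auto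
  note cptW = compact_UNIV_prod[OF cpt]
  have intJ: "integrable ?J h" if h: "continuous_on UNIV h" for h :: "_ \<Rightarrow> real"
    by (rule integrable_continuous_compact[OF cptW h J])
  have m: "prob_space (m i)" "sets (m i) = sets (seq_space (V i))" for i
    using dq unfolding doubly_quenched_converges_def by auto
  define E where "E h i \<eta> y = {x \<in> space (m i). \<eta> \<le> \<bar>orbit_mean (V i) (s i) h (\<lambda>v\<in>V i. (x v, y v)) - integral\<^sup>L ?J h\<bar>}"
    for h i and \<eta> :: real and y
  have E: "E h i \<eta> y \<in> sets (m i)" if "continuous_on UNIV h" for h i \<eta> y
  proof -
    note [measurable] = measurable_pair_orbit_mean[OF m(2) V(3) that]
    show ?thesis unfolding E_def by measurable
  qed
  define A where "A h \<longleftrightarrow>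
      (\<forall>\<epsilon>>0. \<forall>\<eta>>0. for_good_models V s \<beta> (\<lambda>i y. measure (m i) (E h i \<eta> y) < \<epsilon>))" for h
  define P where "P = {\<lambda>w :: 'g \<Rightarrow> 'a \<times> 'b. p (\<lambda>g. fst (w g)) * q (\<lambda>g. snd (w g)) | p q.
      continuous_on UNIV p \<and> continuous_on UNIV (q :: ('g \<Rightarrow> 'b) \<Rightarrow> real)}"
  have PI: "(\<lambda>w. p (\<lambda>g. fst (w g)) * q (\<lambda>g. snd (w g))) \<in> P"
    if "continuous_on UNIV p" "continuous_on UNIV q" for p q
    unfolding P_def using that by blast
  have Pcont: "continuous_on UNIV h" if hP: "h \<in> P" for h
  proof -
    obtain p q where pq: "continuous_on UNIV p" "continuous_on UNIV q"
      "h = (\<lambda>w. p (\<lambda>g. fst (w g)) * q (\<lambda>g. snd (w g)))"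
      using hP unfolding P_def by blast
    show ?thesis
      unfolding pq(3)
      by (intro continuous_intros continuous_on_compose2[OF pq(1)] continuous_on_compose2[OF pq(2)]) auto
  qed
  have "A f"
  proof (rule continuous_function_induct[OF compact_UNIV_fun[OF cptW] f, where P = P])
    show "(\<lambda>_. c) \<in> P" for c
      using PI[of "\<lambda>_. c" "\<lambda>_. 1"] by simp
    show "(\<lambda>x. p x * q x) \<in> P" if pq: "p \<in> P" "q \<in> P" for p q
    proof -
      obtain p1 p2 where p: "continuous_on UNIV p1" "continuous_on UNIV p2"
          "p = (\<lambda>w. p1 (\<lambda>g. fst (w g)) * p2 (\<lambda>g. snd (w g)))"
        using pq(1) unfolding P_def by blast
      obtain q1 q2 where q: "continuous_on UNIV q1" "continuous_on UNIV q2"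
          "q = (\<lambda>w. q1 (\<lambda>g. fst (w g)) * q2 (\<lambda>g. snd (w g)))"
        using pq(2) unfolding P_def by blast
      show ?thesis
        using PI[OF continuous_on_mult[OF p(1) q(1)] continuous_on_mult[OF p(2) q(2)]]
        by (simp add: p(3) q(3) mult.assoc mult.left_commute)
    qed
    show "\<exists>p\<in>P. p x \<noteq> p y" if xy: "x \<noteq> y" for x y
    proof -
      obtain g where g: "x g \<noteq> y g" using xy by auto
      have *: "continuous_on UNIV (\<lambda>w :: 'g \<Rightarrow> 'z::metric_space. dist (w g) a)" for a
        by (intro continuous_on_dist continuous_on_const) simp
      show ?thesis
      proof (cases "fst (x g) = fst (y g)")
        case False
        then show ?thesis
          using PI[OF *[of "fst (x g)"] continuous_on_const[of _ 1]] by (intro bexI) auto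
      next
        case True
        then have "snd (x g) \<noteq> snd (y g)" using g by (simp add: prod_eq_iff)
        then show ?thesis
          using PI[OF continuous_on_const[of _ 1] *[of "snd (x g)"]] by (intro bexI) auto
      qed
    qed
    show "A h" if "h \<in> P" for h
      unfolding A_def
    proof (intro allI impI)
      fix \<epsilon> \<eta> :: real assume \<epsilon>: "\<epsilon> > 0" and \<eta>: "\<eta> > 0"
      obtain p q where pq: "continuous_on UNIV p" "continuous_on UNIV q"
        "h = (\<lambda>w. p (\<lambda>g. fst (w g)) * q (\<lambda>g. snd (w g)))"
        using \<open>h \<in> P\<close> unfolding P_def by blast
      interpret \<alpha>: prob_space \<alpha> by fact
      define c where "c = integral\<^sup>L \<alpha> p"
      define d where "d = integral\<^sup>L \<beta> q"
      define r where "r x = p x - c" for x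
      have r: "continuous_on UNIV r"
        unfolding r_def by (intro continuous_intros pq)
      have r0: "integral\<^sup>L \<alpha> r = 0"
        using integrable_continuous_compact[OF cpt(1) pq(1) \<alpha>]
        unfolding r_def by (simp add: c_def \<alpha>.prob_space)
      have hJ: "integral\<^sup>L ?J h = c * d"
        unfolding pq(3) c_def d_def
        by (rule integral_joint_measure_mult[OF \<alpha>(1) \<beta>(1) \<alpha>(2) \<beta>(2) cpt pq(1,2)])
      obtain B where B: "B > 0" "\<And>x. \<bar>r x\<bar> \<le> B"
        using continuous_bounded_compact[OF compact_UNIV_fun[OF cpt(1)] r] by blast
      obtain C where C: "C > 0" "\<And>x. \<bar>q x\<bar> \<le> C"
        using continuous_bounded_compact[OF compact_UNIV_fun[OF cpt(2)] pq(2)] by blast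
      define \<tau> where "\<tau> = \<eta> / (2 * (\<bar>c\<bar> + 1))"
      have \<tau>: "\<tau> > 0" using \<eta> by (simp add: \<tau>_def)
      define D where "D i = (\<integral>z. \<bar>mean (V i) (\<lambda>v. r (pullback_name (s i) v (fst z)) * r (pullback_name (s i) v (snd z)))\<bar>
             \<partial>(m i \<Otimes>\<^sub>M m i))" for i
      have "D \<longlonglongrightarrow> 0"
        unfolding D_def by (rule doubly_quenched_decorrelation[OF cpt(1) \<alpha> V dq r r0])
      then have *: "(\<lambda>i. C\<^sup>2 * (B * C)\<^sup>2 * D i) \<longlonglongrightarrow> 0"
        by (rule tendsto_mult_right_zero)
      have "eventually (\<lambda>i. C\<^sup>2 * (B * C)\<^sup>2 * D i < (\<epsilon> * (\<eta>/2)\<^sup>2)\<^sup>2) sequentially"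
        by (rule order_tendstoD(2)[OF *]) (use \<epsilon> \<eta> in simp)
      then have ev: "\<forall>\<^sub>F i in sequentially. \<forall>y. \<bar>orbit_mean (V i) (s i) q y - d\<bar> < \<tau> \<longrightarrow>
          measure (m i) (E h i \<eta> y) < \<epsilon>"
      proof eventually_elim
        case (elim i)
        show ?case
        proof (intro allI impI)
          fix y assume y: "\<bar>orbit_mean (V i) (s i) q y - d\<bar> < \<tau>"
          interpret M: prob_space "m i" by (rule m)
          define \<phi> where "\<phi> v x = (if v \<in> V i then r (pullback_name (s i) v x) else 0)" for v x
          define k where "k x = mean (V i) (\<lambda>v. \<phi> v x * q (pullback_name (s i) v y))" for x
          have \<phi>m: "\<phi> v \<in> borel_measurable (m i)" if "v \<in> V i" for v
          proof -
            have "(\<lambda>x. r (pullback_name (s i) v x)) \<in> borel_measurable (seq_space (V i))"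
              using V(3)[OF that]
              by (intro measurable_compose[OF measurable_pullback_name] continuous_measurable_seq_space[OF r])
            then show ?thesis
              using that measurable_cong_sets[OF m(2) refl] unfolding \<phi>_def by auto
          qed
          have \<phi>B: "\<bar>\<phi> v x\<bar> \<le> B" for v x
            using B by (auto simp: \<phi>_def less_imp_le)
          have km: "k \<in> borel_measurable (m i)"
            unfolding k_def using \<phi>m by (intro borel_measurable_divide borel_measurable_sum) auto
          have kb: "\<bar>k x\<bar> \<le> B * C" for x
            unfolding k_def by (intro abs_mean_mult_le V(1,2) \<phi>B C(2))
          have ki: "integrable (m i) (\<lambda>x. (k x)\<^sup>2)"
          proof (rule M.integrable_const_bound[where B = "(B * C)\<^sup>2"])
            show "AE x in m i. norm ((k x)\<^sup>2) \<le> (B * C)\<^sup>2"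
              using kb power_mono[of "\<bar>k _\<bar>" "B * C" 2] by (intro AE_I2) simp
          qed (use km in measurable)
          have "(\<integral>x. (k x)\<^sup>2 \<partial>m i)\<^sup>2 \<le> C\<^sup>2 * (B * C)\<^sup>2 *
              (\<integral>z. \<bar>mean (V i) (\<lambda>v. \<phi> v (fst z) * \<phi> v (snd z))\<bar> \<partial>(m i \<Otimes>\<^sub>M m i))"
            unfolding k_def using \<phi>m \<phi>B C by (intro second_moment_decoupling m V) auto
          also have "(\<integral>z. \<bar>mean (V i) (\<lambda>v. \<phi> v (fst z) * \<phi> v (snd z))\<bar> \<partial>(m i \<Otimes>\<^sub>M m i)) = D i"
            unfolding D_def \<phi>_def by (intro Bochner_Integration.integral_cong refl) simp
          finally have "(\<integral>x. (k x)\<^sup>2 \<partial>m i) < \<epsilon> * (\<eta>/2)\<^sup>2"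
            using elim \<epsilon> by (intro power2_less_imp_less[of _ "\<epsilon> * (\<eta>/2)\<^sup>2"]) auto
          then have Ek: "(\<integral>x. (k x)\<^sup>2 \<partial>m i) / (\<eta>/2)\<^sup>2 < \<epsilon>"
            using \<eta> by (simp add: field_simps)
          have sub: "E h i \<eta> y \<subseteq> {x \<in> space (m i). (\<eta>/2)\<^sup>2 \<le> (k x)\<^sup>2}"
          proof
            fix x assume x: "x \<in> E h i \<eta> y"
            have "orbit_mean (V i) (s i) h (\<lambda>v\<in>V i. (x v, y v))
                = mean (V i) (\<lambda>v. p (pullback_name (s i) v x) * q (pullback_name (s i) v y))"
              unfolding orbit_mean_def pq(3)
              by (intro arg_cong2[where f = "(/)"] sum.cong refl) (simp add: pullback_name_pair V)
            also have "\<dots> = mean (V i) (\<lambda>v. \<phi> v x * q (pullback_name (s i) v y) + c * q (pullback_name (s i) v y))"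
              by (intro arg_cong2[where f = "(/)"] sum.cong refl) (simp add: \<phi>_def r_def algebra_simps)
            also have "\<dots> = k x + c * orbit_mean (V i) (s i) q y"
              by (simp only: mean_add mean_cmult k_def orbit_mean_eq_mean)
            finally have "\<eta> \<le> \<bar>k x + c * (orbit_mean (V i) (s i) q y - d)\<bar>"
              using x by (simp add: E_def hJ algebra_simps)
            moreover have "\<bar>c * (orbit_mean (V i) (s i) q y - d)\<bar> \<le> \<eta> / 2"
            proof -
              have "\<bar>c * (orbit_mean (V i) (s i) q y - d)\<bar> \<le> (\<bar>c\<bar> + 1) * \<tau>"
                unfolding abs_mult using y \<tau> by (intro mult_mono) auto
              also have "\<dots> = \<eta> / 2" by (simp add: \<tau>_def divide_simps)
              finally show ?thesis .
            qed
            ultimately have "\<eta> / 2 \<le> \<bar>k x\<bar>" by linarith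
            then have "(\<eta>/2)\<^sup>2 \<le> \<bar>k x\<bar>\<^sup>2"
              using \<eta> by (intro power_mono) auto
            then show "x \<in> {x \<in> space (m i). (\<eta>/2)\<^sup>2 \<le> (k x)\<^sup>2}"
              using x by (simp add: E_def)
          qed
          have "measure (m i) (E h i \<eta> y) \<le> measure (m i) {x \<in> space (m i). (\<eta>/2)\<^sup>2 \<le> (k x)\<^sup>2}"
            using sub km by (intro M.finite_measure_mono) measurable
          also have "\<dots> \<le> (\<integral>x. (k x)\<^sup>2 \<partial>m i) / (\<eta>/2)\<^sup>2"
            using \<eta> ki by (intro integral_Markov_inequality_measure[where A = "{}"]) auto
          finally show "measure (m i) (E h i \<eta> y) < \<epsilon>"
            using Ek by simp
        qed
      qed
      show "for_good_models V s \<beta> (\<lambda>i y. measure (m i) (E h i \<eta> y) < \<epsilon>)"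
        by (rule for_good_models_mono[OF _ ev[unfolded d_def]])
           (rule for_good_models_orbit_mean[OF \<beta> V(1,2) pq(2) \<tau>])
    qed
    show "A (\<lambda>x. h x + k x)" if hk: "continuous_on UNIV h" "continuous_on UNIV k" "A h" "A k" for h k
      unfolding A_def
    proof (intro allI impI)
      fix \<epsilon> \<eta> :: real assume "\<epsilon> > 0" "\<eta> > 0"
      then have pos: "\<epsilon>/2 > 0" "\<eta>/2 > 0" by auto
      have sum: "measure (m i) (E (\<lambda>x. h x + k x) i \<eta> y) < \<epsilon>"
        if y: "measure (m i) (E h i (\<eta>/2) y) < \<epsilon>/2" "measure (m i) (E k i (\<eta>/2) y) < \<epsilon>/2" for i y
      proof -
        interpret M: prob_space "m i" by (rule m)
        have "E (\<lambda>x. h x + k x) i \<eta> y \<subseteq> E h i (\<eta>/2) y \<union> E k i (\<eta>/2) y"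
        proof
          fix x assume x: "x \<in> E (\<lambda>x. h x + k x) i \<eta> y"
          have "integral\<^sup>L ?J (\<lambda>x. h x + k x) = integral\<^sup>L ?J h + integral\<^sup>L ?J k"
            by (rule Bochner_Integration.integral_add[OF intJ[OF hk(1)] intJ[OF hk(2)]])
          with x show "x \<in> E h i (\<eta>/2) y \<union> E k i (\<eta>/2) y"
            unfolding E_def orbit_mean_add Un_iff mem_Collect_eq by linarith
        qed
        then have "measure (m i) (E (\<lambda>x. h x + k x) i \<eta> y) \<le> measure (m i) (E h i (\<eta>/2) y \<union> E k i (\<eta>/2) y)"
          using E[OF hk(1)] E[OF hk(2)] by (intro M.finite_measure_mono) auto
        also have "\<dots> \<le> measure (m i) (E h i (\<eta>/2) y) + measure (m i) (E k i (\<eta>/2) y)"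
          using E[OF hk(1)] E[OF hk(2)] by (intro measure_Un_le)
        finally show "measure (m i) (E (\<lambda>x. h x + k x) i \<eta> y) < \<epsilon>"
          using y by simp
      qed
      show "for_good_models V s \<beta> (\<lambda>i y. measure (m i) (E (\<lambda>x. h x + k x) i \<eta> y) < \<epsilon>)"
        by (rule for_good_models_mono[OF for_good_models_conj[OF hk(3,4)[unfolded A_def, rule_format, OF pos]]])
           (intro always_eventually allI impI sum; simp)
    qed
    show "A h" if h: "continuous_on UNIV h"
      "\<And>\<epsilon>. \<epsilon> > 0 \<Longrightarrow> \<exists>k. continuous_on UNIV k \<and> A k \<and> (\<forall>x. \<bar>h x - k x\<bar> < \<epsilon>)" for h
      unfolding A_def
    proof (intro allI impI)
      fix \<epsilon> \<eta> :: real assume \<epsilon>: "\<epsilon> > 0" and \<eta>: "\<eta> > 0"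
      then obtain k where k: "continuous_on UNIV k" "A k" "\<And>x. \<bar>h x - k x\<bar> < \<eta>/4"
        using h(2)[of "\<eta>/4"] by auto
      have "E h i \<eta> y \<subseteq> E k i (\<eta>/2) y" for i y
      proof
        fix x assume x: "x \<in> E h i \<eta> y"
        let ?w = "\<lambda>v\<in>V i. (x v, y v)"
        have "\<bar>orbit_mean (V i) (s i) h ?w - orbit_mean (V i) (s i) k ?w\<bar> \<le> \<eta>/4"
          by (rule orbit_mean_uniform_close[OF V(1,2) k(3)])
        moreover have "\<bar>integral\<^sup>L ?J h - integral\<^sup>L ?J k\<bar> \<le> \<eta>/4"
          by (rule integral_uniform_close[OF J(1) intJ[OF h(1)] intJ[OF k(1)] k(3)])
        ultimately show "x \<in> E k i (\<eta>/2) y"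
          using x unfolding E_def mem_Collect_eq by linarith
      qed
      then have le: "measure (m i) (E h i \<eta> y) \<le> measure (m i) (E k i (\<eta>/2) y)" for i y
        using E[OF k(1)] m(1) by (intro finite_measure.finite_measure_mono) (auto simp: prob_space_def)
      have "for_good_models V s \<beta> (\<lambda>i y. measure (m i) (E k i (\<eta>/2) y) < \<epsilon>)"
        using k(2) \<epsilon> \<eta> unfolding A_def by simp
      then show "for_good_models V s \<beta> (\<lambda>i y. measure (m i) (E h i \<eta> y) < \<epsilon>)"
        by (rule for_good_models_mono) (intro always_eventually allI impI le_less_trans[OF le])
    qed
  qed (fact Pcont)
  then show ?thesis
    using \<open>\<epsilon> > 0\<close> \<open>\<eta> > 0\<close> unfolding A_def E_def by blast
qed

section \<open>Approximating a measurable factor map by almost continuous maps\<close>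

text \<open>
  Bumps with disjoint supports that approximate a finite measurable partition in mean: subtract
  from each approximate indicator the sum of the others. At a point where one bump
  is positive, its approximate indicator exceeds all the others.
\<close>

lemma disjoint_bumps:
  fixes \<mu> :: "'x::{second_countable_topology, complete_space} measure" and A :: "nat \<Rightarrow> 'x set"
  assumes "prob_space \<mu>" "sets \<mu> = sets borel" "compact (UNIV :: 'x set)"
    and A: "\<And>j. j < n \<Longrightarrow> A j \<in> sets \<mu>" "\<And>i j. i < n \<Longrightarrow> j < n \<Longrightarrow> i \<noteq> j \<Longrightarrow> A i \<inter> A j = {}"
    and "\<kappa> > 0"
  obtains u :: "nat \<Rightarrow> 'x \<Rightarrow> real" where "\<And>j. continuous_on UNIV (u j)"
    "\<And>j x. 0 \<le> u j x" "\<And>j x. u j x \<le> 1"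
    "\<And>i j x. i < n \<Longrightarrow> j < n \<Longrightarrow> i \<noteq> j \<Longrightarrow> u i x = 0 \<or> u j x = 0"
    "(\<Sum>j<n. \<integral>x. \<bar>indicator (A j) x - u j x\<bar> \<partial>\<mu>) < \<kappa>"
proof -
  interpret prob_space \<mu> by fact
  define \<epsilon> where "\<epsilon> = \<kappa> / (real n * real n + 1)"
  have "real n * real n + 1 > 0"
    by (simp add: add_nonneg_pos)
  then have \<epsilon>: "\<epsilon> > 0" "real n * (real n * \<epsilon>) < \<kappa>"
    using \<open>\<kappa> > 0\<close> by (auto simp: \<epsilon>_def field_simps)
  have "\<exists>v. continuous_on UNIV v \<and> (\<forall>x. 0 \<le> v x) \<and> (\<forall>x. v x \<le> 1) \<and>
      (\<integral>x. \<bar>indicator (A j) x - v x\<bar> \<partial>\<mu>) < \<epsilon>" if "j < n" for j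
    using indicator_approx_continuous[OF assms(1,2), of "A j" \<epsilon>] A(1)[OF that] assms(2) \<epsilon>(1) by metis
  then obtain v :: "nat \<Rightarrow> 'x \<Rightarrow> real" where v: "\<And>j. j < n \<Longrightarrow> continuous_on UNIV (v j)"
    "\<And>j x. j < n \<Longrightarrow> 0 \<le> v j x" "\<And>j x. j < n \<Longrightarrow> v j x \<le> 1"
    "\<And>j. j < n \<Longrightarrow> (\<integral>x. \<bar>indicator (A j) x - v j x\<bar> \<partial>\<mu>) < \<epsilon>"
    by metis
  define u where "u j x = (if j < n then max 0 (v j x - (\<Sum>k\<in>{..<n}-{j}. v k x)) else 0)" for j x
  have other: "v i x \<le> (\<Sum>k\<in>{..<n}-{j}. v k x)" if "i < n" "j < n" "i \<noteq> j" for i j x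
    using that v(2) by (intro member_le_sum) auto
  have int: "integrable \<mu> (\<lambda>x. \<bar>indicator (A j) x - v j x\<bar>)" if "j < n" for j
  proof -
    have "v j \<in> borel_measurable \<mu>"
      using borel_measurable_continuous_onI[OF v(1)[OF that]] measurable_cong_sets[OF assms(2) refl] by blast
    then have "(\<lambda>x. \<bar>indicator (A j) x - v j x\<bar>) \<in> borel_measurable \<mu>"
      using A(1)[OF that] by measurable
    then show ?thesis
      by (rule integrable_const_bound[where B = 1, rotated])
         (use v(2,3)[OF that] in \<open>auto simp: indicator_def\<close>)
  qed
  let ?v = "\<lambda>j x. \<Sum>k\<in>{..<n}-{j}. v k x" and ?A = "\<lambda>j x. \<Sum>k\<in>{..<n}-{j}. indicator (A k) x :: real"
  let ?e = "\<lambda>x. \<Sum>k<n. \<bar>indicator (A k) x - v k x\<bar>"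
  show thesis
  proof (rule that)
    show "continuous_on UNIV (u j)" for j
    proof (cases "j < n")
      case True
      then show ?thesis
        unfolding u_def using v(1) by (auto intro!: continuous_intros)
    next
      case False
      then show ?thesis by (simp add: u_def)
    qed
    show "0 \<le> u j x" for j x by (simp add: u_def)
    show "u j x \<le> 1" for j x
    proof (cases "j < n")
      case True
      have "0 \<le> ?v j x"
        using v(2) by (intro sum_nonneg) auto
      then show ?thesis
        using v(3)[OF True, of x] True by (simp add: u_def)
    qed (simp add: u_def)
    show "u i x = 0 \<or> u j x = 0" if "i < n" "j < n" "i \<noteq> j" for i j x
      using other[OF that, of x] other[OF that(2,1), of x] that by (auto simp: u_def max_def)
    have "(\<Sum>j<n. \<integral>x. \<bar>indicator (A j) x - u j x\<bar> \<partial>\<mu>)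
        \<le> (\<Sum>j<n. \<integral>x. ?e x \<partial>\<mu>)"
    proof (rule sum_mono, rule integral_mono')
      fix j assume "j \<in> {..<n}"
      then have j: "j < n" by simp
      show "integrable \<mu> (\<lambda>x. \<Sum>k<n. \<bar>indicator (A k) x - v k x\<bar>)"
        using int by (intro Bochner_Integration.integrable_sum) auto
      fix x
      \<comment> \<open>The construction applied to exact indicators reproduces them, and \<open>max 0\<close> is 1-Lipschitz.\<close>
      have "indicator (A j) x = (max 0 (indicator (A j) x - ?A j x) :: real)"
      proof (cases "x \<in> A j")
        case True
        then have "(\<Sum>k\<in>{..<n}-{j}. indicator (A k) x :: real) = 0"
          using A(2)[OF _ j] by (intro sum.neutral) (auto simp: indicator_def)
        then show ?thesis by simp
      next
        case False
        have "(\<Sum>k\<in>{..<n}-{j}. indicator (A k) x :: real) \<ge> 0"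
          by (intro sum_nonneg) auto
        then show ?thesis using False by simp
      qed
      moreover have "u j x = max 0 (v j x - ?v j x)"
        using j by (simp add: u_def)
      moreover have "\<bar>max 0 a - max 0 b\<bar> \<le> \<bar>a - b\<bar>" for a b :: real
        by (auto simp: max_def)
      ultimately have "\<bar>indicator (A j) x - u j x\<bar>
        \<le> \<bar>(indicator (A j) x - ?A j x) - (v j x - ?v j x)\<bar>"
        by metis
      also have "\<dots> = \<bar>(indicator (A j) x - v j x) - (\<Sum>k\<in>{..<n}-{j}. indicator (A k) x - v k x)\<bar>"
        by (simp add: sum_subtractf)
      also have "\<dots> \<le> \<bar>indicator (A j) x - v j x\<bar> + (\<Sum>k\<in>{..<n}-{j}. \<bar>indicator (A k) x - v k x\<bar>)"
        by (intro order.trans[OF abs_triangle_ineq4] add_left_mono sum_abs)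
      also have "\<dots> = ?e x"
        using j by (subst sum.remove[of _ j]) auto
      finally show "\<bar>indicator (A j) x - u j x\<bar> \<le> ?e x" .
    qed (auto intro: sum_nonneg)
    also have "\<dots> = real n * (\<Sum>k<n. \<integral>x. \<bar>indicator (A k) x - v k x\<bar> \<partial>\<mu>)"
      using int by (subst Bochner_Integration.integral_sum) auto
    also have "\<dots> \<le> real n * (\<Sum>k<n. \<epsilon>)"
      using v(4) less_imp_le by (intro mult_left_mono sum_mono) auto
    also have "\<dots> < \<kappa>"
      using \<epsilon>(2) by simp
    finally show "(\<Sum>j<n. \<integral>x. \<bar>indicator (A j) x - u j x\<bar> \<partial>\<mu>) < \<kappa>" .
  qed
qed

text \<open>
  A function \<open>h\<close> can be close to \<open>k\<close> in mean without orbit averages noticing, since these see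
  individual points. Here the pointwise error is dominated by a function \<open>\<rho>\<close> that is
  itself continuous and small in mean, so that its orbit averages over good models are small.
\<close>

definition tamely_approximates :: "'x::topological_space measure \<Rightarrow> ('x \<Rightarrow> real) \<Rightarrow> ('x \<Rightarrow> real) \<Rightarrow> real \<Rightarrow> bool" where
  "tamely_approximates \<mu> h k \<tau> \<longleftrightarrow> (\<exists>U \<rho>. continuous_on UNIV U \<and> continuous_on UNIV \<rho> \<and> (\<forall>x. \<bar>U x\<bar> \<le> 1) \<and>
     (\<forall>x. \<bar>h x - U x\<bar> \<le> \<rho> x) \<and> integral\<^sup>L \<mu> \<rho> < \<tau> \<and> (\<integral>x. \<bar>U x - k x\<bar> \<partial>\<mu>) < \<tau>)"

lemma tamely_approximates_mono:
  assumes "tamely_approximates \<mu> h k \<tau>" "\<tau> \<le> \<tau>'"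
  shows "tamely_approximates \<mu> h k \<tau>'"
  using assms unfolding tamely_approximates_def by (meson less_le_trans)

text \<open>
  A continuous map close to \<open>\<phi>\<close> need not exist, because the target may be disconnected. Instead
  \<open>\<Phi>\<close> takes finitely many values, the value \<open>p\<^sub>j\<close> being taken on the support of the \<open>j\<close>-th bump.
\<close>

lemma almost_continuous_approximation_step:
  fixes \<mu> :: "'x::{second_countable_topology, complete_space} measure"
    and \<phi> :: "'x \<Rightarrow> 'c::{second_countable_topology, metric_space}"
  assumes "prob_space \<mu>" "sets \<mu> = sets borel" "compact (UNIV :: 'x set)" "compact (UNIV :: 'c set)"
    and \<phi>: "\<phi> \<in> borel_measurable \<mu>" and \<kappa>: "\<kappa> > 0"
  shows "\<exists>\<Phi> :: 'x \<Rightarrow> 'c. \<forall>c \<tau>. continuous_on UNIV c \<longrightarrow> (\<forall>z. \<bar>c z\<bar> \<le> (1::real)) \<longrightarrow>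
    (\<forall>y z. dist y z < \<kappa> \<longrightarrow> \<bar>c y - c z\<bar> < \<tau>) \<longrightarrow>
      tamely_approximates \<mu> (\<lambda>x. c (\<Phi> x)) (\<lambda>x. c (\<phi> x)) (\<kappa> + \<tau>)"
proof -
  interpret prob_space \<mu> by fact
  obtain D where D: "finite D" "UNIV \<subseteq> (\<Union>z\<in>D. ball z \<kappa> :: 'c set)"
  proof (rule compactE_image[OF assms(4), of UNIV "\<lambda>z. ball z \<kappa>"])
    show "UNIV \<subseteq> (\<Union>c\<in>UNIV. ball c \<kappa> :: 'c set)"
      using \<kappa> by (metis UN_I UNIV_I centre_in_ball subsetI)
  qed (use that in auto)
  obtain p :: "nat \<Rightarrow> 'c" and n where p: "D = p ` {..<n}"
    using finite_imp_nat_seg_image_inj_on[OF D(1)] by (auto simp: lessThan_def)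
  have cover: "\<exists>j<n. dist (p j) z < \<kappa>" for z
    using D(2) p by (auto simp: subset_iff)
  define A where "A j = {x \<in> space \<mu>. dist (p j) (\<phi> x) < \<kappa> \<and> (\<forall>i<j. \<not> dist (p i) (\<phi> x) < \<kappa>)}" for j
  have Am: "A j \<in> sets \<mu>" for j
    unfolding A_def using \<phi> by measurable
  have Adisj: "A i \<inter> A j = {}" if "i \<noteq> j" for i j
    using that by (cases i j rule: linorder_cases) (auto simp: A_def)
  have sp: "space \<mu> = UNIV"
    using sets_eq_imp_space_eq[OF assms(2)] by simp
  have Acover: "(\<Sum>j<n. indicator (A j) x) = (1::real)" for x
  proof -
    define j where "j = (LEAST j. dist (p j) (\<phi> x) < \<kappa>)"
    obtain j0 where j0: "j0 < n" "dist (p j0) (\<phi> x) < \<kappa>" using cover by blast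
    have j: "x \<in> A j" "j < n"
      unfolding j_def A_def using LeastI[of "\<lambda>j. dist (p j) (\<phi> x) < \<kappa>", OF j0(2)]
        Least_le[of "\<lambda>j. dist (p j) (\<phi> x) < \<kappa>", OF j0(2)] j0(1) not_less_Least by (auto simp: sp)
    have "(\<Sum>i<n. indicator (A i) x) = (\<Sum>i<n. if i = j then 1 else (0::real))"
      using j Adisj by (intro sum.cong) (auto simp: indicator_def)
    then show ?thesis using j by simp
  qed
  obtain u where u: "\<And>j. continuous_on UNIV (u j)" "\<And>j x. 0 \<le> u j x" "\<And>j x. u j x \<le> 1"
    "\<And>i j x. i < n \<Longrightarrow> j < n \<Longrightarrow> i \<noteq> j \<Longrightarrow> u i x = 0 \<or> u j x = 0"
    "(\<Sum>j<n. \<integral>x. \<bar>indicator (A j) x - u j x\<bar> \<partial>\<mu>) < \<kappa>"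
    using disjoint_bumps[OF assms(1-3), of n A \<kappa>] Am Adisj \<kappa> by blast
  define \<Phi> where "\<Phi> x = (if \<exists>j<n. u j x > 0 then p (SOME j. j < n \<and> u j x > 0) else p 0)" for x
  define \<rho> where "\<rho> x = 1 - (\<Sum>j<n. u j x)" for x
  have um: "u j \<in> borel_measurable \<mu>" for j
    using borel_measurable_continuous_onI[OF u(1)] measurable_cong_sets[OF assms(2) refl] by blast
  have ui: "integrable \<mu> (\<lambda>x. \<bar>indicator (A j) x - u j x\<bar>)" for j
  proof -
    have "(\<lambda>x. \<bar>indicator (A j) x - u j x\<bar>) \<in> borel_measurable \<mu>"
      using um Am by measurable
    then show ?thesis
      by (rule integrable_const_bound[where B = 1, rotated])
         (use u(2,3) in \<open>auto simp: indicator_def\<close>)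
  qed
  have sumu: "(\<Sum>i<n. u i x * a i) = u j x * a j" if "j < n" "u j x > 0" for j x and a :: "nat \<Rightarrow> real"
  proof -
    have "(\<Sum>i<n. u i x * a i) = (\<Sum>i<n. if i = j then u j x * a j else 0)"
      using that u(4)[of _ j x] by (intro sum.cong) auto
    then show ?thesis using that by simp
  qed
  have sumu0: "(\<Sum>i<n. u i x * a i) = 0" if "\<not> (\<exists>j<n. u j x > 0)" for x and a :: "nat \<Rightarrow> real"
    using that u(2)[of _ x] by (intro sum.neutral) (auto simp: less_le)
  have "tamely_approximates \<mu> (\<lambda>x. c (\<Phi> x)) (\<lambda>x. c (\<phi> x)) (\<kappa> + \<tau>)"
    if c: "continuous_on UNIV c" "\<And>z. \<bar>c z\<bar> \<le> (1::real)" "\<And>y z. dist y z < \<kappa> \<Longrightarrow> \<bar>c y - c z\<bar> < \<tau>" for c \<tau>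
    unfolding tamely_approximates_def
  proof (intro exI conjI allI)
    let ?U = "\<lambda>x. \<Sum>j<n. u j x * c (p j)"
    have \<tau>: "\<tau> > 0" using c(3)[of undefined undefined] \<kappa> by simp
    show "continuous_on UNIV ?U" "continuous_on UNIV \<rho>"
      unfolding \<rho>_def by (intro continuous_intros u)+
    show "\<bar>?U x\<bar> \<le> 1" for x
    proof (cases "\<exists>j<n. u j x > 0")
      case True
      then obtain j where j: "j < n" "u j x > 0" by blast
      have "\<bar>u j x\<bar> * \<bar>c (p j)\<bar> \<le> 1 * 1"
        using u(2,3)[of j x] c(2) by (intro mult_mono) auto
      then show ?thesis
        unfolding sumu[OF j] by (simp add: abs_mult)
    next
      case False
      then show ?thesis by (simp add: sumu0)
    qed
    show "\<bar>c (\<Phi> x) - ?U x\<bar> \<le> \<rho> x" for x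
    proof (cases "\<exists>j<n. u j x > 0")
      case True
      define j where "j = (SOME j. j < n \<and> u j x > 0)"
      have j: "j < n" "u j x > 0"
        using someI_ex[of "\<lambda>j. j < n \<and> u j x > 0"] True by (auto simp: j_def)
      have "\<Phi> x = p j" using True by (simp add: \<Phi>_def j_def)
      then have "\<bar>c (\<Phi> x) - ?U x\<bar> = \<bar>c (p j)\<bar> * (1 - u j x)"
        unfolding sumu[OF j] using u(3)[of j x] abs_mult[of "c (p j)" "1 - u j x"]
        by (simp add: algebra_simps)
      also have "\<dots> \<le> 1 * (1 - u j x)"
        using c(2) u(3) by (intro mult_right_mono) auto
      also have "\<dots> = \<rho> x"
        using sumu[OF j, of "\<lambda>_. 1"] by (simp add: \<rho>_def)
      finally show ?thesis .
    next
      case False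
      then show ?thesis
        using sumu0[OF False, of "\<lambda>_. 1"] c(2) by (simp add: sumu0 \<rho>_def)
    qed
    let ?e = "\<lambda>x. \<Sum>j<n. \<bar>indicator (A j) x - u j x\<bar>"
    have sum_ui: "integrable \<mu> ?e"
      using ui by (intro Bochner_Integration.integrable_sum) auto
    have "integral\<^sup>L \<mu> \<rho> \<le> (\<integral>x. ?e x \<partial>\<mu>)"
    proof (rule integral_mono'[OF sum_ui])
      fix x
      have "\<rho> x = (\<Sum>j<n. indicator (A j) x - u j x)"
        by (simp add: \<rho>_def sum_subtractf Acover)
      also have "\<dots> \<le> ?e x"
        by (intro sum_mono) auto
      finally show "\<rho> x \<le> ?e x" .
    qed (auto intro: sum_nonneg)
    also have "\<dots> < \<kappa>"
      using u(5) ui by (subst Bochner_Integration.integral_sum) auto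
    finally show "integral\<^sup>L \<mu> \<rho> < \<kappa> + \<tau>" using \<tau> by simp
    have "(\<integral>x. \<bar>?U x - c (\<phi> x)\<bar> \<partial>\<mu>) \<le> (\<integral>x. ?e x + \<tau> \<partial>\<mu>)"
    proof (rule integral_mono')
      fix x
      have "?U x - c (\<phi> x) = (\<Sum>j<n. u j x * c (p j)) - (\<Sum>j<n. indicator (A j) x) * c (\<phi> x)"
        by (simp add: Acover)
      also have "\<dots> = (\<Sum>j<n. (u j x - indicator (A j) x) * c (p j) + indicator (A j) x * (c (p j) - c (\<phi> x)))"
        unfolding sum_distrib_right sum_subtractf[symmetric]
        by (intro sum.cong refl) (simp add: algebra_simps)
      finally have "\<bar>?U x - c (\<phi> x)\<bar>
          \<le> (\<Sum>j<n. \<bar>(u j x - indicator (A j) x) * c (p j) + indicator (A j) x * (c (p j) - c (\<phi> x))\<bar>)"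
        by simp
      also have "\<dots> \<le> (\<Sum>j<n. \<bar>indicator (A j) x - u j x\<bar> + indicator (A j) x * \<tau>)"
      proof (rule sum_mono)
        fix j
        have "\<bar>(u j x - indicator (A j) x) * c (p j)\<bar> \<le> \<bar>indicator (A j) x - u j x\<bar> * 1"
          unfolding abs_mult using c(2) by (subst abs_minus_commute) (intro mult_left_mono, auto)
        moreover have "\<bar>indicator (A j) x * (c (p j) - c (\<phi> x))\<bar> \<le> indicator (A j) x * \<tau>"
          using c(3)[of "p j" "\<phi> x"] by (auto simp: indicator_def A_def less_imp_le)
        ultimately show "\<bar>(u j x - indicator (A j) x) * c (p j) + indicator (A j) x * (c (p j) - c (\<phi> x))\<bar>
            \<le> \<bar>indicator (A j) x - u j x\<bar> + indicator (A j) x * \<tau>"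
          unfolding mult_1_right by (intro order.trans[OF abs_triangle_ineq] add_mono)
      qed
      also have "\<dots> = ?e x + \<tau>"
        by (simp add: sum.distrib sum_distrib_right[symmetric] Acover)
      finally show "\<bar>?U x - c (\<phi> x)\<bar> \<le> ?e x + \<tau>" .
    qed (use sum_ui \<tau> in \<open>auto intro!: add_nonneg_nonneg sum_nonneg\<close>)
    also have "\<dots> < \<kappa> + \<tau>"
      using u(5) ui sum_ui by (simp add: prob_space)
    finally show "(\<integral>x. \<bar>?U x - c (\<phi> x)\<bar> \<partial>\<mu>) < \<kappa> + \<tau>" .
  qed
  then show ?thesis by blast
qed

lemma almost_continuous_approximation:
  fixes \<mu> :: "'x::{second_countable_topology, complete_space} measure"
    and \<phi> :: "'x \<Rightarrow> 'c::{second_countable_topology, metric_space}"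
  assumes "prob_space \<mu>" "sets \<mu> = sets borel" "compact (UNIV :: 'x set)" "compact (UNIV :: 'c set)"
    and "\<phi> \<in> borel_measurable \<mu>"
  obtains \<Phi> :: "nat \<Rightarrow> 'x \<Rightarrow> 'c" where
    "\<And>c \<tau>. continuous_on UNIV c \<Longrightarrow> (\<And>z. \<bar>c z\<bar> \<le> (1::real)) \<Longrightarrow> \<tau> > 0 \<Longrightarrow>
      \<forall>\<^sub>F k in sequentially. tamely_approximates \<mu> (\<lambda>x. c (\<Phi> k x)) (\<lambda>x. c (\<phi> x)) \<tau>"
proof -
  have "\<forall>k. \<exists>\<Phi> :: 'x \<Rightarrow> 'c. \<forall>c \<tau>. continuous_on UNIV c \<longrightarrow> (\<forall>z. \<bar>c z\<bar> \<le> (1::real)) \<longrightarrow>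
    (\<forall>y z. dist y z < 1 / real (Suc k) \<longrightarrow> \<bar>c y - c z\<bar> < \<tau>) \<longrightarrow>
      tamely_approximates \<mu> (\<lambda>x. c (\<Phi> x)) (\<lambda>x. c (\<phi> x)) (1 / real (Suc k) + \<tau>)"
    by (intro allI almost_continuous_approximation_step assms) simp
  then obtain \<Phi> :: "nat \<Rightarrow> 'x \<Rightarrow> 'c" where \<Phi>:
    "\<And>k c \<tau>. continuous_on UNIV c \<Longrightarrow> (\<forall>z. \<bar>c z\<bar> \<le> (1::real)) \<Longrightarrow>
    (\<forall>y z. dist y z < 1 / real (Suc k) \<longrightarrow> \<bar>c y - c z\<bar> < \<tau>) \<Longrightarrow>
      tamely_approximates \<mu> (\<lambda>x. c (\<Phi> k x)) (\<lambda>x. c (\<phi> x)) (1 / real (Suc k) + \<tau>)"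
    by (elim choice[THEN exE]) blast
  show thesis
  proof (rule that[of \<Phi>])
    fix c :: "'c \<Rightarrow> real" and \<tau> :: real
    assume c: "continuous_on UNIV c" "\<And>z. \<bar>c z\<bar> \<le> 1" and \<tau>: "\<tau> > 0"
    have "uniformly_continuous_on UNIV c"
      by (rule compact_uniformly_continuous[OF c(1) assms(4)])
    then obtain \<delta> where \<delta>: "\<delta> > 0" "\<And>y z. dist z y < \<delta> \<Longrightarrow> dist (c z) (c y) < \<tau>/2"
      unfolding uniformly_continuous_on_def using \<tau> by (metis UNIV_I half_gt_zero)
    have "(\<lambda>k. 1 / real (Suc k)) \<longlonglongrightarrow> 0"
      using LIMSEQ_inverse_real_of_nat by (simp add: inverse_eq_divide)
    then have "\<forall>\<^sub>F k in sequentially. 1 / real (Suc k) < min \<delta> (\<tau>/2)"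
      using \<delta>(1) \<tau> by (intro order_tendstoD(2)) auto
    then show "\<forall>\<^sub>F k in sequentially. tamely_approximates \<mu> (\<lambda>x. c (\<Phi> k x)) (\<lambda>x. c (\<phi> x)) \<tau>"
    proof eventually_elim
      case (elim k)
      have "\<forall>y z. dist y z < 1 / real (Suc k) \<longrightarrow> \<bar>c y - c z\<bar> < \<tau>/2"
        using elim \<delta>(2) by (auto simp: dist_real_def)
      moreover have "\<forall>z. \<bar>c z\<bar> \<le> 1" using c(2) by blast
      ultimately have "tamely_approximates \<mu> (\<lambda>x. c (\<Phi> k x)) (\<lambda>x. c (\<phi> x)) (1 / real (Suc k) + \<tau>/2)"
        by (intro \<Phi> c(1))
      then show ?case
        by (rule tamely_approximates_mono) (use elim in linarith)
    qed
  qed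
qed

section \<open>Lifting models along the factor map\<close>

lemma sofic_approximationD:
  assumes "sofic_approximation V \<sigma>"
  shows "finite (V n)" "V n \<noteq> {}" "bij_betw (\<sigma> n g) (V n) (V n)" "v \<in> V n \<Longrightarrow> \<sigma> n g v \<in> V n"
  using assms bij_betwE unfolding sofic_approximation_def by blast+

text \<open>
  The maps \<open>\<sigma>\<^sub>n\<close> need not be actions, so moving the base point of a pullback name is a shift only up to
  the points where \<open>\<sigma>\<^sub>n\<close> fails to be multiplicative.
\<close>

lemma pullback_name_shift:
  fixes V :: "nat \<Rightarrow> 'v set" and \<sigma> :: "nat \<Rightarrow> 'g::{group_add,countable} \<Rightarrow> 'v \<Rightarrow> 'v"
    and U :: "('g \<Rightarrow> 'a::metric_space) \<Rightarrow> real"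
  assumes sof: "sofic_approximation V \<sigma>" and cpt: "compact (UNIV :: 'a set)"
    and U: "continuous_on UNIV U" and "\<epsilon> > 0"
  shows "\<forall>\<^sub>F n in sequentially. \<forall>w. mean (V n) (\<lambda>v. \<bar>U (pullback_name (\<sigma> n) (\<sigma> n g v) w)
      - U (shift g (pullback_name (\<sigma> n) v w))\<bar>) < \<epsilon>"
proof -
  note V = sofic_approximationD[OF sof]
  have "\<epsilon>/2 > 0" using \<open>\<epsilon> > 0\<close> by simp
  then obtain k C where C: "C > 0"
    "\<And>x y. \<bar>U x - U y\<bar> \<le> \<epsilon>/2 + C * (\<Sum>i\<le>k. dist (x (from_nat i :: 'g)) (y (from_nat i)))"
    using continuous_almost_Lipschitz[OF cpt U] by metis
  obtain D where D: "D > 0" "\<And>a b :: 'a. dist a b \<le> D"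
  proof -
    obtain D where "\<And>a b :: 'a. dist a b \<le> D"
      using bounded_two_points[of "UNIV :: 'a set"] compact_imp_bounded[OF cpt] by auto
    then show thesis
      using that[of "max D 1"] by (meson le_max_iff_disj less_max_iff_disj zero_less_one)
  qed
  define r where "r h n = real (card {v \<in> V n. \<sigma> n h (\<sigma> n g v) = \<sigma> n (h + g) v}) / real (card (V n))" for h n
  have "(\<lambda>n. \<epsilon>/2 + C * (\<Sum>i\<le>k. D * (1 - r (from_nat i) n))) \<longlonglongrightarrow> \<epsilon>/2 + C * (\<Sum>i\<le>k. D * (1 - 1))"
    using sof unfolding sofic_approximation_def r_def by (intro tendsto_intros) blast
  from order_tendstoD(2)[OF this, of \<epsilon>]
  have "\<forall>\<^sub>F n in sequentially. \<epsilon>/2 + C * (\<Sum>i\<le>k. D * (1 - r (from_nat i) n)) < \<epsilon>"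
    using \<open>\<epsilon> > 0\<close> by simp
  then show ?thesis
  proof eventually_elim
    case (elim n)
    show ?case
    proof
      fix w :: "'v \<Rightarrow> 'a"
      have *: "mean (V n) (\<lambda>v. dist (w (\<sigma> n h (\<sigma> n g v))) (w (\<sigma> n (h + g) v))) \<le> D * (1 - r h n)" for h
      proof -
        let ?A = "{v. \<sigma> n h (\<sigma> n g v) = \<sigma> n (h + g) v}"
        have "mean (V n) (\<lambda>v. dist (w (\<sigma> n h (\<sigma> n g v))) (w (\<sigma> n (h + g) v)))
          \<le> mean (V n) (\<lambda>v. D * (1 - indicator ?A v))"
          using D by (intro mean_mono) (auto simp: indicator_def)
        also have "\<dots> = D * (mean (V n) (\<lambda>_. 1) - mean (V n) (indicator ?A))"
          unfolding mean_cmult mean_diff ..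
        also have "(\<Sum>v\<in>V n. indicator ?A v :: real)
            = real (card {v \<in> V n. \<sigma> n h (\<sigma> n g v) = \<sigma> n (h + g) v})"
          using V(1)[of n] by (simp add: indicator_def sum.If_cases Int_def)
        finally show ?thesis
          using V(1,2)[of n] by (simp add: r_def)
      qed
      let ?d = "\<lambda>i v. dist (w (\<sigma> n (from_nat i) (\<sigma> n g v))) (w (\<sigma> n (from_nat i + g) v))"
      have "mean (V n) (\<lambda>v. \<bar>U (pullback_name (\<sigma> n) (\<sigma> n g v) w) - U (shift g (pullback_name (\<sigma> n) v w))\<bar>)
        \<le> mean (V n) (\<lambda>v. \<epsilon>/2 + C * (\<Sum>i\<le>k. ?d i v))"
        by (rule mean_mono, rule order.trans[OF C(2)]) (simp add: pullback_name_def shift_def)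
      also have "\<dots> = mean (V n) (\<lambda>_. \<epsilon>/2) + C * (\<Sum>i\<le>k. mean (V n) (?d i))"
        unfolding mean_add mean_cmult mean_sum ..
      also have "\<dots> \<le> \<epsilon>/2 + C * (\<Sum>i\<le>k. D * (1 - r (from_nat i) n))"
        using C(1) V(1,2)[of n] * by (intro add_mono mult_left_mono sum_mono) auto
      also have "\<dots> < \<epsilon>" by (rule elim)
      finally show "mean (V n) (\<lambda>v. \<bar>U (pullback_name (\<sigma> n) (\<sigma> n g v) w)
          - U (shift g (pullback_name (\<sigma> n) v w))\<bar>) < \<epsilon>" .
    qed
  qed
qed

text \<open>
  For \<open>\<Phi>\<close> close to the coordinate at the identity of an equivariant map \<open>\<phi>\<close>, the lift of a model \<open>w\<close>
  takes at \<open>v\<close> the value of \<open>\<Phi>\<close> at the name of \<open>v\<close>. In a product of functions \<open>c g\<close> of single coordinates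
  of the lift, each factor may be replaced by the continuous \<open>U g\<close> at the name of \<open>\<sigma> g v\<close>, hence by \<open>U g\<close>
  at the shifted name of \<open>v\<close>. The resulting function of the name of \<open>v\<close> is continuous, and its mean is known for
  good models. Per factor, and up to the bound of \<open>p\<close>, the two replacements cost \<open>2 \<tau>\<close> and \<open>\<tau>\<close>,
  and passing from \<open>U g\<close> to \<open>c g \<circ> \<phi>\<close> in
  the integral costs another \<open>\<tau>\<close>; this is the constant \<open>4\<close>.
\<close>

lemma lift_models_product:
  fixes \<mu> :: "('g::{group_add,countable} \<Rightarrow> 'a::{complete_space, second_countable_topology}) measure"
    and \<phi> :: "('g \<Rightarrow> 'a) \<Rightarrow> ('g \<Rightarrow> 'c::{complete_space, second_countable_topology})"
    and V :: "nat \<Rightarrow> 'v set"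
  assumes sof: "sofic_approximation V \<sigma>"
    and cpt: "compact (UNIV :: 'a set)"
    and \<mu>: "prob_space \<mu>" "sets \<mu> = sets (seq_space UNIV)" "\<And>g. distr \<mu> \<mu> (shift g) = \<mu>"
    and \<phi>: "\<phi> \<in> \<mu> \<rightarrow>\<^sub>M seq_space UNIV" "\<And>g. AE w in \<mu>. \<phi> (shift g w) = shift g (\<phi> w)"
    and p: "continuous_on UNIV p" "\<And>x. \<bar>p x\<bar> \<le> B" "B > 0"
    and c: "\<And>g. continuous_on UNIV (c g)" "\<And>g z. \<bar>c g z\<bar> \<le> (1::real)" and "finite E"
    and U: "\<And>g. g \<in> E \<Longrightarrow> continuous_on UNIV (U g)" "\<And>g x. g \<in> E \<Longrightarrow> \<bar>U g x\<bar> \<le> 1"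
    and \<rho>: "\<And>g. g \<in> E \<Longrightarrow> continuous_on UNIV (\<rho> g)" "\<And>g. g \<in> E \<Longrightarrow> integral\<^sup>L \<mu> (\<rho> g) < \<tau>"
    and \<Phi>: "\<And>g x. g \<in> E \<Longrightarrow> \<bar>c g (\<Phi> x) - U g x\<bar> \<le> \<rho> g x"
      "\<And>g. g \<in> E \<Longrightarrow> (\<integral>x. \<bar>U g x - c g (\<phi> x 0)\<bar> \<partial>\<mu>) < \<tau>"
    and "\<tau> > 0"
  shows "for_good_models V \<sigma> \<mu> (\<lambda>n w.
    \<bar>orbit_mean (V n) (\<sigma> n) (\<lambda>x. p (\<lambda>g. fst (x g)) * (\<Prod>g\<in>E. c g (snd (x g))))
        (\<lambda>v\<in>V n. (w v, \<Phi> (pullback_name (\<sigma> n) v w)))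
      - (\<integral>w. p w * (\<Prod>g\<in>E. c g (\<phi> w g)) \<partial>\<mu>)\<bar> < (4 * B * real (card E) + 1) * \<tau>)"
proof -
  interpret prob_space \<mu> by fact
  note V = sofic_approximationD[OF sof]
  have sp: "space \<mu> = UNIV"
    using sets_eq_imp_space_eq[OF \<mu>(2)] by (simp add: space_PiM)
  note shift_meas = measurable_shift[OF \<mu>(2)]
  have shift_cont: "continuous_on UNIV (shift g :: ('g \<Rightarrow> 'a) \<Rightarrow> _)" for g
    unfolding shift_def by (intro continuous_on_coordinatewise_then_product) simp
  note int = integrable_continuous_compact[OF cpt _ \<mu>(1,2)]
  define H where "H x = p x * (\<Prod>g\<in>E. U g (shift g x))" for x
  have H: "continuous_on UNIV H"
    unfolding H_def
    by (intro continuous_intros p continuous_on_compose2[OF U(1) shift_cont]) auto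
  have cm: "(\<lambda>w. c g (\<phi> w h)) \<in> borel_measurable \<mu>" for g h
    by (intro measurable_compose[OF \<phi>(1)] measurable_compose[OF measurable_component_singleton]
         borel_measurable_continuous_onI[OF c(1)]) simp
  have cont_meas: "h \<in> borel_measurable \<mu>" if "continuous_on UNIV h" for h :: "('g \<Rightarrow> 'a) \<Rightarrow> real"
    using continuous_measurable_seq_space[OF that] measurable_cong_sets[OF \<mu>(2) refl] by blast
  define f where "f x = p (\<lambda>g. fst (x g)) * (\<Prod>g\<in>E. c g (snd (x g)))" for x
  have prod_bound: "\<bar>p x * (\<Prod>g\<in>E. a g) - p x * (\<Prod>g\<in>E. b g)\<bar> \<le> B * (\<Sum>g\<in>E. \<bar>a g - b g\<bar>)"
    if "\<And>g. g \<in> E \<Longrightarrow> \<bar>a g\<bar> \<le> 1" "\<And>g. g \<in> E \<Longrightarrow> \<bar>b g\<bar> \<le> 1" for a b x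
  proof -
    have "\<bar>p x * (\<Prod>g\<in>E. a g) - p x * (\<Prod>g\<in>E. b g)\<bar> = \<bar>p x\<bar> * \<bar>(\<Prod>g\<in>E. a g) - (\<Prod>g\<in>E. b g)\<bar>"
      by (simp add: abs_mult[symmetric] right_diff_distrib)
    also have "\<dots> \<le> B * (\<Sum>g\<in>E. \<bar>a g - b g\<bar>)"
      using norm_prod_diff[of E a b] that p(2,3) by (intro mult_mono) auto
    finally show ?thesis .
  qed
  have int_close: "\<bar>integral\<^sup>L \<mu> H - (\<integral>w. p w * (\<Prod>g\<in>E. c g (\<phi> w g)) \<partial>\<mu>)\<bar> \<le> B * real (card E) * \<tau>"
  proof -
    have di: "integrable \<mu> (\<lambda>w. \<bar>U g (shift g w) - c g (\<phi> w g)\<bar>)" if "g \<in> E" for g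
    proof -
      have "(\<lambda>w. U g (shift g w)) \<in> borel_measurable \<mu>"
        by (rule measurable_compose[OF shift_meas cont_meas[OF U(1)[OF that]]])
      then show ?thesis
        using cm[of g g] U(2)[OF that] c(2)[of g]
        by (intro integrable_abs Bochner_Integration.integrable_diff integrable_const_bound[where B = 1]) auto
    qed
    have pm: "(\<lambda>w. p w * (\<Prod>g\<in>E. c g (\<phi> w g))) \<in> borel_measurable \<mu>"
      by (intro borel_measurable_times borel_measurable_prod cm cont_meas p)
    have pi: "integrable \<mu> (\<lambda>w. p w * (\<Prod>g\<in>E. c g (\<phi> w g)))"
    proof (rule integrable_const_bound[where B = B, OF _ pm])
      have "\<bar>\<Prod>g\<in>E. c g (\<phi> w g)\<bar> \<le> 1" for w
        unfolding abs_prod using c(2) by (intro prod_le_1) auto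
      then have "\<bar>p w\<bar> * \<bar>\<Prod>g\<in>E. c g (\<phi> w g)\<bar> \<le> B * 1" for w
        using p(2,3) by (intro mult_mono) auto
      then show "AE w in \<mu>. norm (p w * (\<Prod>g\<in>E. c g (\<phi> w g))) \<le> B"
        by (simp add: abs_mult)
    qed
    have one: "(\<integral>w. \<bar>U g (shift g w) - c g (\<phi> w g)\<bar> \<partial>\<mu>) \<le> \<tau>" if "g \<in> E" for g
    proof -
      have "(\<integral>w. \<bar>U g (shift g w) - c g (\<phi> w g)\<bar> \<partial>\<mu>) = (\<integral>w. \<bar>U g (shift g w) - c g (\<phi> (shift g w) 0)\<bar> \<partial>\<mu>)"
      proof (rule integral_cong_AE)
        show "(\<lambda>w. \<bar>U g (shift g w) - c g (\<phi> w g)\<bar>) \<in> borel_measurable \<mu>"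
          using di[OF that] by auto
        show "(\<lambda>w. \<bar>U g (shift g w) - c g (\<phi> (shift g w) 0)\<bar>) \<in> borel_measurable \<mu>"
          by (intro borel_measurable_abs borel_measurable_diff
              measurable_compose[OF shift_meas cont_meas[OF U(1)[OF that]]] measurable_compose[OF shift_meas cm])
        show "AE w in \<mu>. \<bar>U g (shift g w) - c g (\<phi> w g)\<bar> = \<bar>U g (shift g w) - c g (\<phi> (shift g w) 0)\<bar>"
          using \<phi>(2)[of g] by eventually_elim (simp add: shift_def[of g "\<phi> _"])
      qed
      also have "\<dots> = (\<integral>x. \<bar>U g x - c g (\<phi> x 0)\<bar> \<partial>distr \<mu> \<mu> (shift g))"
        by (rule integral_distr[symmetric, OF shift_meas])
           (intro borel_measurable_abs borel_measurable_diff cm cont_meas U(1)[OF that])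
      finally show ?thesis
        using \<Phi>(2)[OF that] by (simp add: \<mu>(3))
    qed
    have "\<bar>integral\<^sup>L \<mu> H - (\<integral>w. p w * (\<Prod>g\<in>E. c g (\<phi> w g)) \<partial>\<mu>)\<bar>
        = \<bar>\<integral>w. H w - p w * (\<Prod>g\<in>E. c g (\<phi> w g)) \<partial>\<mu>\<bar>"
      using int[OF H] pi by simp
    also have "\<dots> \<le> (\<integral>w. \<bar>H w - p w * (\<Prod>g\<in>E. c g (\<phi> w g))\<bar> \<partial>\<mu>)"
      by (rule integral_abs_bound)
    also have "\<dots> \<le> (\<integral>w. B * (\<Sum>g\<in>E. \<bar>U g (shift g w) - c g (\<phi> w g)\<bar>) \<partial>\<mu>)"
    proof (rule integral_mono')
      show "integrable \<mu> (\<lambda>w. B * (\<Sum>g\<in>E. \<bar>U g (shift g w) - c g (\<phi> w g)\<bar>))"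
        using di by (intro integrable_mult_right Bochner_Integration.integrable_sum) auto
      show "\<bar>H w - p w * (\<Prod>g\<in>E. c g (\<phi> w g))\<bar> \<le> B * (\<Sum>g\<in>E. \<bar>U g (shift g w) - c g (\<phi> w g)\<bar>)" for w
        unfolding H_def using U(2) c(2) by (intro prod_bound) auto
    qed (use p(3) in \<open>auto intro!: mult_nonneg_nonneg sum_nonneg\<close>)
    also have "\<dots> = B * (\<Sum>g\<in>E. \<integral>w. \<bar>U g (shift g w) - c g (\<phi> w g)\<bar> \<partial>\<mu>)"
      using di by simp
    also have "\<dots> \<le> B * (\<Sum>g\<in>E. \<tau>)"
      using one p(3) by (intro mult_left_mono sum_mono) auto
    finally show ?thesis by simp
  qed
  have good: "for_good_models V \<sigma> \<mu> (\<lambda>n w. \<bar>orbit_mean (V n) (\<sigma> n) H w - integral\<^sup>L \<mu> H\<bar> < \<tau> \<and>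
      (\<forall>g\<in>E. \<bar>orbit_mean (V n) (\<sigma> n) (\<rho> g) w - integral\<^sup>L \<mu> (\<rho> g)\<bar> < \<tau>))"
    by (intro for_good_models_conj for_good_models_ball for_good_models_orbit_mean
        for_good_models_True \<mu> V H \<rho> \<open>finite E\<close> \<open>\<tau> > 0\<close>)
  have "\<forall>\<^sub>F n in sequentially. \<forall>g\<in>E. \<forall>w. mean (V n) (\<lambda>v. \<bar>U g (pullback_name (\<sigma> n) (\<sigma> n g v) w)
      - U g (shift g (pullback_name (\<sigma> n) v w))\<bar>) < \<tau>"
    using pullback_name_shift[OF sof cpt U(1) \<open>\<tau> > 0\<close>] \<open>finite E\<close> by (intro eventually_ball_finite) auto
  then have "\<forall>\<^sub>F n in sequentially. \<forall>w. \<bar>orbit_mean (V n) (\<sigma> n) H w - integral\<^sup>L \<mu> H\<bar> < \<tau> \<and>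
      (\<forall>g\<in>E. \<bar>orbit_mean (V n) (\<sigma> n) (\<rho> g) w - integral\<^sup>L \<mu> (\<rho> g)\<bar> < \<tau>) \<longrightarrow>
      \<bar>orbit_mean (V n) (\<sigma> n) f (\<lambda>v\<in>V n. (w v, \<Phi> (pullback_name (\<sigma> n) v w)))
        - (\<integral>w. p w * (\<Prod>g\<in>E. c g (\<phi> w g)) \<partial>\<mu>)\<bar> < (4 * B * real (card E) + 1) * \<tau>"
  proof eventually_elim
    case (elim n)
    show ?case
    proof (intro allI impI, elim conjE)
      fix w
      assume wH: "\<bar>orbit_mean (V n) (\<sigma> n) H w - integral\<^sup>L \<mu> H\<bar> < \<tau>"
        and w\<rho>: "\<forall>g\<in>E. \<bar>orbit_mean (V n) (\<sigma> n) (\<rho> g) w - integral\<^sup>L \<mu> (\<rho> g)\<bar> < \<tau>"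
      let ?P = "\<lambda>v. pullback_name (\<sigma> n) v w"
      let ?wz = "\<lambda>v\<in>V n. (w v, \<Phi> (?P v))"
      have "\<bar>orbit_mean (V n) (\<sigma> n) f ?wz - orbit_mean (V n) (\<sigma> n) H w\<bar>
          \<le> mean (V n) (\<lambda>v. \<bar>f (pullback_name (\<sigma> n) v ?wz) - H (?P v)\<bar>)"
        unfolding orbit_mean_eq_mean mean_diff[symmetric] by (rule abs_mean_le)
      also have "\<dots> \<le> mean (V n) (\<lambda>v. B * (\<Sum>g\<in>E. \<rho> g (?P (\<sigma> n g v)) + \<bar>U g (?P (\<sigma> n g v)) - U g (shift g (?P v))\<bar>))"
      proof (rule mean_mono)
        fix v assume v: "v \<in> V n"
        have "f (pullback_name (\<sigma> n) v ?wz) = p (?P v) * (\<Prod>g\<in>E. c g (\<Phi> (?P (\<sigma> n g v))))"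
          using pullback_name_pair[of "\<sigma> n" v "V n" w "\<lambda>v. \<Phi> (?P v)"] V(4)[OF v]
          unfolding f_def by (simp add: pullback_name_def)
        then have "\<bar>f (pullback_name (\<sigma> n) v ?wz) - H (?P v)\<bar>
            \<le> B * (\<Sum>g\<in>E. \<bar>c g (\<Phi> (?P (\<sigma> n g v))) - U g (shift g (?P v))\<bar>)"
          unfolding H_def using U(2) c(2) by (simp add: prod_bound)
        also have "\<dots> \<le> B * (\<Sum>g\<in>E. \<rho> g (?P (\<sigma> n g v)) + \<bar>U g (?P (\<sigma> n g v)) - U g (shift g (?P v))\<bar>)"
          using p(3)
        proof (intro mult_left_mono sum_mono)
          fix g assume "g \<in> E"
          from \<Phi>(1)[OF this, of "?P (\<sigma> n g v)"]
          show "\<bar>c g (\<Phi> (?P (\<sigma> n g v))) - U g (shift g (?P v))\<bar>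
            \<le> \<rho> g (?P (\<sigma> n g v)) + \<bar>U g (?P (\<sigma> n g v)) - U g (shift g (?P v))\<bar>"
            by linarith
        qed simp
        finally show "\<bar>f (pullback_name (\<sigma> n) v ?wz) - H (?P v)\<bar>
            \<le> B * (\<Sum>g\<in>E. \<rho> g (?P (\<sigma> n g v)) + \<bar>U g (?P (\<sigma> n g v)) - U g (shift g (?P v))\<bar>)" .
      qed
      also have "\<dots> = B * (\<Sum>g\<in>E. mean (V n) (\<lambda>v. \<rho> g (?P (\<sigma> n g v)))
          + mean (V n) (\<lambda>v. \<bar>U g (?P (\<sigma> n g v)) - U g (shift g (?P v))\<bar>))"
        unfolding mean_cmult mean_sum mean_add ..
      also have "\<dots> = B * (\<Sum>g\<in>E. orbit_mean (V n) (\<sigma> n) (\<rho> g) w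
          + mean (V n) (\<lambda>v. \<bar>U g (?P (\<sigma> n g v)) - U g (shift g (?P v))\<bar>))"
        by (simp only: mean_bij[OF V(3), where h = "\<lambda>v. \<rho> _ (?P v)"] orbit_mean_eq_mean)
      also have "\<dots> \<le> B * (\<Sum>g\<in>E. 3 * \<tau>)"
        using p(3)
      proof (intro mult_left_mono sum_mono)
        fix g assume g: "g \<in> E"
        have "orbit_mean (V n) (\<sigma> n) (\<rho> g) w < 2 * \<tau>"
          using w\<rho> \<rho>(2)[OF g] g by fastforce
        moreover have "mean (V n) (\<lambda>v. \<bar>U g (?P (\<sigma> n g v)) - U g (shift g (?P v))\<bar>) < \<tau>"
          using elim g by blast
        ultimately show "orbit_mean (V n) (\<sigma> n) (\<rho> g) w
          + mean (V n) (\<lambda>v. \<bar>U g (?P (\<sigma> n g v)) - U g (shift g (?P v))\<bar>) \<le> 3 * \<tau>"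
          by linarith
      qed simp
      also have "\<dots> = 3 * (B * real (card E) * \<tau>)" by simp
      finally have "\<bar>orbit_mean (V n) (\<sigma> n) f ?wz - orbit_mean (V n) (\<sigma> n) H w\<bar> \<le> 3 * (B * real (card E) * \<tau>)" .
      moreover have "(4 * B * real (card E) + 1) * \<tau> = 4 * (B * real (card E) * \<tau>) + \<tau>"
        by (simp add: algebra_simps)
      ultimately show "\<bar>orbit_mean (V n) (\<sigma> n) f ?wz - (\<integral>w. p w * (\<Prod>g\<in>E. c g (\<phi> w g)) \<partial>\<mu>)\<bar>
          < (4 * B * real (card E) + 1) * \<tau>"
        using wH int_close by linarith
    qed
  qed
  then show ?thesis
    unfolding f_def by (rule for_good_models_mono[OF good])
qed

lemma measurable_graph:
  fixes \<phi> :: "('g \<Rightarrow> 'a::second_countable_topology) \<Rightarrow> ('g \<Rightarrow> 'c::second_countable_topology)"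
  assumes "sets \<mu> = sets (seq_space UNIV)" "\<phi> \<in> \<mu> \<rightarrow>\<^sub>M seq_space UNIV"
  shows "(\<lambda>w g. (w g, \<phi> w g)) \<in> \<mu> \<rightarrow>\<^sub>M seq_space UNIV"
proof (rule measurable_PiM_single')
  fix g :: 'g
  have "(\<lambda>w. w g) \<in> borel_measurable \<mu>"
    using measurable_component_singleton[of g UNIV "\<lambda>_. borel"] measurable_cong_sets[OF assms(1) refl] by blast
  moreover have "(\<lambda>w. \<phi> w g) \<in> borel_measurable \<mu>"
    by (rule measurable_compose[OF assms(2) measurable_component_singleton]) simp
  ultimately show "(\<lambda>w. (w g, \<phi> w g)) \<in> borel_measurable \<mu>"
    by (rule borel_measurable_Pair)
qed auto

text \<open>
  One sequence \<open>\<Phi> k\<close> serves every test function for large \<open>k\<close>, so that finitely many test functions are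
  met by a single lift.
\<close>

lemma lift_models:
  fixes \<mu> :: "('g::{group_add,countable} \<Rightarrow> 'a::{complete_space, second_countable_topology}) measure"
    and \<phi> :: "('g \<Rightarrow> 'a) \<Rightarrow> ('g \<Rightarrow> 'c::{complete_space, second_countable_topology})"
    and V :: "nat \<Rightarrow> 'v set" and F :: "(('g \<Rightarrow> 'a \<times> 'c) \<Rightarrow> real) set"
  assumes sof: "sofic_approximation V \<sigma>"
    and cpt: "compact (UNIV :: 'a set)" "compact (UNIV :: 'c set)"
    and \<mu>: "prob_space \<mu>" "sets \<mu> = sets (seq_space UNIV)" "\<And>g. distr \<mu> \<mu> (shift g) = \<mu>"
    and \<phi>: "\<phi> \<in> \<mu> \<rightarrow>\<^sub>M seq_space UNIV" "\<And>g. AE w in \<mu>. \<phi> (shift g w) = shift g (\<phi> w)"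
    and F: "finite F" "\<And>f. f \<in> F \<Longrightarrow> continuous_on UNIV f" and "\<eta> > 0"
  shows "for_good_models V \<sigma> \<mu> (\<lambda>n w. \<exists>z \<in> V n \<rightarrow>\<^sub>E UNIV. \<forall>f\<in>F.
    \<bar>orbit_mean (V n) (\<sigma> n) f (\<lambda>v\<in>V n. (w v, z v)) - (\<integral>w. f (\<lambda>g. (w g, \<phi> w g)) \<partial>\<mu>)\<bar> < \<eta>)"
proof -
  interpret prob_space \<mu> by fact
  note V = sofic_approximationD[OF sof]
  have cptac: "compact (UNIV :: ('a \<times> 'c) set)"
    by (rule compact_UNIV_prod[OF cpt])
  have borel: "sets \<mu> = sets borel"
    using \<mu>(2) sets_PiM_equal_borel by blast
  have \<phi>0: "(\<lambda>w. \<phi> w 0) \<in> borel_measurable \<mu>"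
    by (rule measurable_compose[OF \<phi>(1) measurable_component_singleton]) simp
  obtain \<Phi> :: "nat \<Rightarrow> ('g \<Rightarrow> 'a) \<Rightarrow> 'c" where \<Phi>:
    "\<And>c \<tau>. continuous_on UNIV c \<Longrightarrow> (\<And>z. \<bar>c z\<bar> \<le> (1::real)) \<Longrightarrow> \<tau> > 0 \<Longrightarrow>
      \<forall>\<^sub>F k in sequentially. tamely_approximates \<mu> (\<lambda>x. c (\<Phi> k x)) (\<lambda>x. c (\<phi> x 0)) \<tau>"
  proof -
    show thesis
      by (rule almost_continuous_approximation[OF \<mu>(1) borel compact_UNIV_fun[OF cpt(1)] cpt(2) \<phi>0]) (fact that)
  qed
  define I where "I f = (\<integral>w. f (\<lambda>g. (w g, \<phi> w g)) \<partial>\<mu>)" for f :: "('g \<Rightarrow> 'a \<times> 'c) \<Rightarrow> real"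
  have int: "integrable \<mu> (\<lambda>w. f (\<lambda>g. (w g, \<phi> w g)))" if f: "continuous_on UNIV f" for f :: "('g \<Rightarrow> 'a \<times> 'c) \<Rightarrow> real"
  proof -
    obtain B where B: "\<And>x. \<bar>f x\<bar> \<le> B"
      using continuous_bounded_compact[OF compact_UNIV_fun[OF cptac] f] by blast
    have "(\<lambda>w. f (\<lambda>g. (w g, \<phi> w g))) \<in> borel_measurable \<mu>"
      by (rule measurable_compose[OF measurable_graph[OF \<mu>(2) \<phi>(1)] continuous_measurable_seq_space[OF f]])
    then show ?thesis
      by (intro integrable_const_bound[where B = B]) (auto simp: B)
  qed
  define lift where "lift k n w = (\<lambda>v\<in>V n. (w v, \<Phi> k (pullback_name (\<sigma> n) v w)))" for k n w
  define A where "A f \<longleftrightarrow> (\<forall>\<tau>>0. \<forall>\<^sub>F k in sequentially.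
      for_good_models V \<sigma> \<mu> (\<lambda>n w. \<bar>orbit_mean (V n) (\<sigma> n) f (lift k n w) - I f\<bar> < \<tau>))" for f
  \<comment> \<open>The factors outside \<open>E\<close> are \<open>1\<close>, so that two such products can be written over a common index set.\<close>
  define P where "P = {\<lambda>x :: 'g \<Rightarrow> 'a \<times> 'c. p (\<lambda>g. fst (x g)) * (\<Prod>g\<in>E. c g (snd (x g))) | p c E.
      continuous_on UNIV p \<and> finite E \<and> (\<forall>g. continuous_on UNIV (c g)) \<and> (\<forall>g z. \<bar>c g z\<bar> \<le> 1) \<and>
      (\<forall>g. g \<notin> E \<longrightarrow> c g = (\<lambda>_. 1 :: real))}"
  have PI: "(\<lambda>x. p (\<lambda>g. fst (x g)) * (\<Prod>g\<in>E. c g (snd (x g)))) \<in> P"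
    if "continuous_on UNIV p" "finite E" "\<And>g. continuous_on UNIV (c g)" "\<And>g z. \<bar>c g z\<bar> \<le> 1"
      "\<And>g. g \<notin> E \<Longrightarrow> c g = (\<lambda>_. 1)" for p c E
    unfolding P_def using that by blast
  have PE: "\<exists>p c E. h = (\<lambda>x. p (\<lambda>g. fst (x g)) * (\<Prod>g\<in>E. c g (snd (x g)))) \<and>
      continuous_on UNIV p \<and> finite E \<and> (\<forall>g. continuous_on UNIV (c g)) \<and> (\<forall>g z. \<bar>c g z\<bar> \<le> 1) \<and>
      (\<forall>g. g \<notin> E \<longrightarrow> c g = (\<lambda>_. 1))" if "h \<in> P" for h
    using that unfolding P_def mem_Collect_eq .
  have AF: "A f" if "continuous_on UNIV f" for f
  proof (rule continuous_function_induct[OF compact_UNIV_fun[OF cptac] that, where P = P])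
    show "continuous_on UNIV h" if hP: "h \<in> P" for h
    proof -
      obtain p c E where h: "h = (\<lambda>x. p (\<lambda>g. fst (x g)) * (\<Prod>g\<in>E. c g (snd (x g))))"
        "continuous_on UNIV p" "\<And>g. continuous_on UNIV (c g)"
        using PE[OF hP] by blast
      show ?thesis
        unfolding h(1)
        by (intro continuous_intros continuous_on_compose2[OF h(2)] continuous_on_compose2[OF h(3)]) auto
    qed
    show "(\<lambda>_. a) \<in> P" for a
      using PI[of "\<lambda>_. a" "{}" "\<lambda>_ _. 1"] by simp
    show "(\<lambda>x. h x * k x) \<in> P" if hk: "h \<in> P" "k \<in> P" for h k
    proof -
      obtain p c E where h: "h = (\<lambda>x. p (\<lambda>g. fst (x g)) * (\<Prod>g\<in>E. c g (snd (x g))))"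
        "continuous_on UNIV p" "finite E" "\<And>g. continuous_on UNIV (c g)" "\<And>g z. \<bar>c g z\<bar> \<le> 1"
        "\<And>g. g \<notin> E \<Longrightarrow> c g = (\<lambda>_. 1)"
        using PE[OF hk(1)] by blast
      obtain q d D where k: "k = (\<lambda>x. q (\<lambda>g. fst (x g)) * (\<Prod>g\<in>D. d g (snd (x g))))"
        "continuous_on UNIV q" "finite D" "\<And>g. continuous_on UNIV (d g)" "\<And>g z. \<bar>d g z\<bar> \<le> 1"
        "\<And>g. g \<notin> D \<Longrightarrow> d g = (\<lambda>_. 1)"
        using PE[OF hk(2)] by blast
      have "(\<Prod>g\<in>E. c g (snd (x g))) = (\<Prod>g\<in>E \<union> D. c g (snd (x g)))" for x :: "'g \<Rightarrow> 'a \<times> 'c"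
        using h(3,6) k(3) by (intro prod.mono_neutral_left) auto
      moreover have "(\<Prod>g\<in>D. d g (snd (x g))) = (\<Prod>g\<in>E \<union> D. d g (snd (x g)))" for x :: "'g \<Rightarrow> 'a \<times> 'c"
        using k(3,6) h(3) by (intro prod.mono_neutral_left) auto
      ultimately have eq: "(\<lambda>x. h x * k x) = (\<lambda>x. (p (\<lambda>g. fst (x g)) * q (\<lambda>g. fst (x g))) *
          (\<Prod>g\<in>E \<union> D. c g (snd (x g)) * d g (snd (x g))))"
        unfolding h(1) k(1) by (simp add: prod.distrib mult.assoc mult.left_commute)
      show ?thesis
        unfolding eq
      proof (rule PI[of "\<lambda>y. p y * q y" "E \<union> D" "\<lambda>g z. c g z * d g z"])
        show "\<bar>c g z * d g z\<bar> \<le> 1" for g z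
          unfolding abs_mult using h(5) k(5) by (intro mult_le_one) auto
      qed (use h k in \<open>auto intro!: continuous_on_mult\<close>)
    qed
    show "\<exists>p\<in>P. p x \<noteq> p y" if xy: "x \<noteq> y" for x y
    proof -
      obtain g where g: "x g \<noteq> y g" using xy by auto
      show ?thesis
      proof (cases "fst (x g) = fst (y g)")
        case False
        have "continuous_on UNIV (\<lambda>w :: 'g \<Rightarrow> 'a. dist (w g) (fst (x g)))"
          by (intro continuous_on_dist continuous_on_const) simp
        from PI[OF this, of "{}" "\<lambda>_ _. 1"] False show ?thesis
          by (intro bexI) auto
      next
        case True
        then have "snd (x g) \<noteq> snd (y g)" using g by (simp add: prod_eq_iff)
        define c where "c h = (if h = g then (\<lambda>z. min 1 (dist z (snd (x g)))) else (\<lambda>_. 1))" for h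
        have "continuous_on UNIV (c h)" for h
          unfolding c_def by (auto intro!: continuous_on_min continuous_on_dist continuous_on_const continuous_on_id)
        then have "(\<lambda>w. 1 * (\<Prod>h\<in>{g}. c h (snd (w h)))) \<in> P"
          by (intro PI[of "\<lambda>_. 1" "{g}" c]) (auto simp: c_def)
        then show ?thesis
          by (rule bexI[rotated]) (use \<open>snd (x g) \<noteq> snd (y g)\<close> in \<open>auto simp: c_def min_def\<close>)
      qed
    qed
    show "A h" if hP: "h \<in> P" for h
      unfolding A_def
    proof (intro allI impI)
      fix \<tau> :: real assume \<tau>: "\<tau> > 0"
      obtain p c E where h: "h = (\<lambda>x. p (\<lambda>g. fst (x g)) * (\<Prod>g\<in>E. c g (snd (x g))))"
        "continuous_on UNIV p" "finite E" "\<And>g. continuous_on UNIV (c g)" "\<And>g z. \<bar>c g z\<bar> \<le> 1"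
        using PE[OF hP] by blast
      obtain B where B: "B > 0" "\<And>x. \<bar>p x\<bar> \<le> B"
        using continuous_bounded_compact[OF compact_UNIV_fun[OF cpt(1)] h(2)] by blast
      define \<theta> where "\<theta> = \<tau> / (4 * B * real (card E) + 1)"
      have pos: "4 * B * real (card E) + 1 > 0"
        using B(1) by (simp add: add_nonneg_pos)
      then have \<theta>: "\<theta> > 0" "(4 * B * real (card E) + 1) * \<theta> = \<tau>"
        using \<tau> by (auto simp: \<theta>_def)
      have "\<forall>\<^sub>F k in sequentially. \<forall>g\<in>E. tamely_approximates \<mu> (\<lambda>x. c g (\<Phi> k x)) (\<lambda>x. c g (\<phi> x 0)) \<theta>"
        using h(3) by (intro eventually_ball_finite ballI \<Phi> h(4,5) \<theta>(1))
      then show "\<forall>\<^sub>F k in sequentially. for_good_models V \<sigma> \<mu> (\<lambda>n w. \<bar>orbit_mean (V n) (\<sigma> n) h (lift k n w) - I h\<bar> < \<tau>)"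
      proof eventually_elim
        case (elim k)
        then obtain U \<rho> where U:
          "\<forall>g\<in>E. continuous_on UNIV (U g) \<and> continuous_on UNIV (\<rho> g) \<and> (\<forall>x. \<bar>U g x\<bar> \<le> 1) \<and>
        (\<forall>x. \<bar>c g (\<Phi> k x) - U g x\<bar> \<le> \<rho> g x) \<and> integral\<^sup>L \<mu> (\<rho> g) < \<theta> \<and> (\<integral>x. \<bar>U g x - c g (\<phi> x 0)\<bar> \<partial>\<mu>) < \<theta>"
          unfolding tamely_approximates_def bchoice_iff by (elim exE)
        have Ih: "I h = (\<integral>w. p w * (\<Prod>g\<in>E. c g (\<phi> w g)) \<partial>\<mu>)"
          unfolding I_def h(1) by simp
        show ?case
          unfolding lift_def Ih \<theta>(2)[symmetric] unfolding h(1)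
          by (rule lift_models_product[OF sof cpt(1) \<mu> \<phi> h(2) B(2,1) h(4,5,3), where U = U and \<rho> = \<rho>])
             (use U \<theta>(1) in blast)+
      qed
    qed
    show "A (\<lambda>x. h x + k x)" if hk: "continuous_on UNIV h" "continuous_on UNIV k" "A h" "A k" for h k
      unfolding A_def
    proof (intro allI impI)
      fix \<tau> :: real assume "\<tau> > 0"
      then have \<tau>: "\<tau>/2 > 0" by simp
      have I: "I (\<lambda>x. h x + k x) = I h + I k"
        unfolding I_def by (rule Bochner_Integration.integral_add[OF int[OF hk(1)] int[OF hk(2)]])
      from hk(3)[unfolded A_def, rule_format, OF \<tau>] hk(4)[unfolded A_def, rule_format, OF \<tau>]
      show "\<forall>\<^sub>F j in sequentially. for_good_models V \<sigma> \<mu>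
          (\<lambda>n w. \<bar>orbit_mean (V n) (\<sigma> n) (\<lambda>x. h x + k x) (lift j n w) - I (\<lambda>x. h x + k x)\<bar> < \<tau>)"
      proof eventually_elim
        case (elim j)
        show ?case
          unfolding orbit_mean_add I
          by (rule for_good_models_mono[OF for_good_models_conj[OF elim]], intro always_eventually allI impI)
             linarith
      qed
    qed
    show "A h" if h: "continuous_on UNIV h"
      "\<And>\<epsilon>. \<epsilon> > 0 \<Longrightarrow> \<exists>k. continuous_on UNIV k \<and> A k \<and> (\<forall>x. \<bar>h x - k x\<bar> < \<epsilon>)" for h
      unfolding A_def
    proof (intro allI impI)
      fix \<tau> :: real assume "\<tau> > 0"
      then have \<tau>: "\<tau>/2 > 0" "\<tau>/4 > 0" by auto
      from h(2)[OF \<tau>(2)] obtain k where k: "continuous_on UNIV k" "A k" "\<And>x. \<bar>h x - k x\<bar> < \<tau>/4"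
        by blast
      have Ihk: "\<bar>I h - I k\<bar> \<le> \<tau>/4"
        unfolding I_def by (rule integral_uniform_close[OF \<mu>(1) int[OF h(1)] int[OF k(1)] k(3)])
      have oc: "\<bar>orbit_mean (V n) (\<sigma> n) h x - orbit_mean (V n) (\<sigma> n) k x\<bar> \<le> \<tau>/4" for n x
        by (rule orbit_mean_uniform_close[OF V(1,2) k(3)])
      from k(2)[unfolded A_def, rule_format, OF \<tau>(1)]
      show "\<forall>\<^sub>F j in sequentially. for_good_models V \<sigma> \<mu>
          (\<lambda>n w. \<bar>orbit_mean (V n) (\<sigma> n) h (lift j n w) - I h\<bar> < \<tau>)"
      proof eventually_elim
        case (elim j)
        have "\<bar>orbit_mean (V n) (\<sigma> n) h (lift j n w) - I h\<bar> < \<tau>"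
          if "\<bar>orbit_mean (V n) (\<sigma> n) k (lift j n w) - I k\<bar> < \<tau>/2" for n w
          using that Ihk oc[of n "lift j n w"] by linarith
        then show ?case
          by (intro for_good_models_mono[OF elim] always_eventually) blast
      qed
    qed
  qed
  have "\<forall>\<^sub>F k in sequentially. \<forall>f\<in>F.
      for_good_models V \<sigma> \<mu> (\<lambda>n w. \<bar>orbit_mean (V n) (\<sigma> n) f (lift k n w) - I f\<bar> < \<eta>)"
    using AF F(2) \<open>\<eta> > 0\<close> unfolding A_def by (intro eventually_ball_finite[OF F(1)]) blast
  from eventually_happens'[OF sequentially_bot this] obtain k where k: "\<forall>f\<in>F.
      for_good_models V \<sigma> \<mu> (\<lambda>n w. \<bar>orbit_mean (V n) (\<sigma> n) f (lift k n w) - I f\<bar> < \<eta>)" ..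
  have "for_good_models V \<sigma> \<mu> (\<lambda>n w. \<forall>f\<in>F. \<bar>orbit_mean (V n) (\<sigma> n) f (lift k n w) - I f\<bar> < \<eta>)"
    by (intro for_good_models_ball[OF F(1)] bspec[OF k] for_good_models_True \<mu>)
  then show ?thesis
  proof (rule for_good_models_mono, intro always_eventually allI impI)
    fix n w assume w: "\<forall>f\<in>F. \<bar>orbit_mean (V n) (\<sigma> n) f (lift k n w) - I f\<bar> < \<eta>"
    define z where "z = (\<lambda>v\<in>V n. \<Phi> k (pullback_name (\<sigma> n) v w))"
    have "lift k n w = (\<lambda>v\<in>V n. (w v, z v))"
      by (auto simp: lift_def z_def restrict_def)
    with w show "\<exists>z \<in> V n \<rightarrow>\<^sub>E UNIV. \<forall>f\<in>F.
        \<bar>orbit_mean (V n) (\<sigma> n) f (\<lambda>v\<in>V n. (w v, z v)) - (\<integral>w. f (\<lambda>g. (w g, \<phi> w g)) \<partial>\<mu>)\<bar> < \<eta>"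
      by (intro bexI[of _ z]) (auto simp: z_def I_def)
  qed
qed

section \<open>Lifts of separated models are separated\<close>

text \<open>
  Since \<open>\<phi>\<close> is injective, the distances of \<open>w 0\<close> from the points of a finite net are functions of
  \<open>\<phi> w\<close>, approximated in mean by continuous ones. For a pair \<open>(w, z)\<close> resembling the graph of \<open>\<phi>\<close>
  these distances can therefore be read off from \<open>z\<close>, stably under small changes of \<open>z\<close>.
\<close>

lemma lift_separates:
  fixes \<mu> :: "('g::{group_add,countable} \<Rightarrow> 'a::{complete_space, second_countable_topology}) measure"
    and \<phi> :: "('g \<Rightarrow> 'a) \<Rightarrow> ('g \<Rightarrow> 'c::{complete_space, second_countable_topology})"
    and \<psi> :: "('g \<Rightarrow> 'c) \<Rightarrow> ('g \<Rightarrow> 'a)"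
  assumes cpt: "compact (UNIV :: 'a set)" "compact (UNIV :: 'c set)"
    and \<mu>: "prob_space \<mu>" "sets \<mu> = sets (seq_space UNIV)"
    and \<phi>: "\<phi> \<in> \<mu> \<rightarrow>\<^sub>M seq_space UNIV" and \<psi>: "\<psi> \<in> seq_space UNIV \<rightarrow>\<^sub>M seq_space UNIV"
    and inv: "AE w in \<mu>. \<psi> (\<phi> w) = w" and \<delta>: "\<delta> > 0"
  obtains F \<eta> \<delta>' where "finite F" "\<And>f. f \<in> F \<Longrightarrow> continuous_on UNIV f" "\<eta> > 0" "\<delta>' > 0"
    "\<And>(V :: 'v set) s w z w' z'. finite V \<Longrightarrow> V \<noteq> {} \<Longrightarrow> (\<And>g. bij_betw (s g) V V) \<Longrightarrow>
      (\<And>f. f \<in> F \<Longrightarrow> \<bar>orbit_mean V s f (\<lambda>v\<in>V. (w v, z v)) - (\<integral>w. f (\<lambda>g. (w g, \<phi> w g)) \<partial>\<mu>)\<bar> < \<eta>) \<Longrightarrow>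
      (\<And>f. f \<in> F \<Longrightarrow> \<bar>orbit_mean V s f (\<lambda>v\<in>V. (w' v, z' v)) - (\<integral>w. f (\<lambda>g. (w g, \<phi> w g)) \<partial>\<mu>)\<bar> < \<eta>) \<Longrightarrow>
      hamming_dist V z z' < \<delta>' \<Longrightarrow> hamming_dist V w w' < \<delta>"
proof -
  interpret prob_space \<mu> by fact
  define \<gamma> where "\<gamma> = distr \<mu> (seq_space UNIV) \<phi>"
  have \<gamma>: "prob_space \<gamma>" "sets \<gamma> = sets (seq_space UNIV)"
    unfolding \<gamma>_def by (auto intro: prob_space_distr \<phi>)
  interpret \<gamma>: prob_space \<gamma> by (rule \<gamma>)
  have borel: "sets \<gamma> = sets borel"
    using \<gamma>(2) sets_PiM_equal_borel by blast
  have cover: "UNIV \<subseteq> (\<Union>c\<in>UNIV. ball c (\<delta>/8) :: 'a set)"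
    using \<delta> by (auto intro!: exI)
  obtain D where D: "finite D" "UNIV \<subseteq> (\<Union>p\<in>D. ball p (\<delta>/8) :: 'a set)"
    by (rule compactE_image[OF cpt(1) open_ball cover])
  define \<kappa> where "\<kappa> = \<delta> / (12 * (real (card D) + 1))"
  have \<kappa>: "\<kappa> > 0" "6 * real (card D) * \<kappa> < \<delta>/2"
    using \<delta> by (auto simp: \<kappa>_def field_simps add_pos_nonneg)
  obtain b where b: "\<And>x y :: 'a. dist x y \<le> b"
    using bounded_two_points[of "UNIV :: 'a set"] compact_imp_bounded[OF cpt(1)] by auto
  define h where "h p z = dist (\<psi> z 0) p" for p z
  have "\<forall>p. \<exists>q. continuous_on UNIV q \<and> (\<integral>z. \<bar>h p z - q z\<bar> \<partial>\<gamma>) < \<kappa>"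
  proof
    fix p
    have "(\<lambda>z. \<psi> z 0) \<in> borel_measurable (seq_space UNIV)"
      by (rule measurable_compose[OF \<psi> measurable_component_singleton]) simp
    then have "h p \<in> borel_measurable \<gamma>"
      unfolding h_def measurable_cong_sets[OF \<gamma>(2) refl] by measurable
    then have "integrable \<gamma> (h p)"
      by (rule \<gamma>.integrable_const_bound[where B = b, rotated]) (auto simp: h_def b)
    then show "\<exists>q. continuous_on UNIV q \<and> (\<integral>z. \<bar>h p z - q z\<bar> \<partial>\<gamma>) < \<kappa>"
      by (rule integrable_approx_continuous[OF \<gamma>(1) borel compact_UNIV_fun[OF cpt(2)] _ \<kappa>(1)])
  qed
  then obtain q where q: "\<And>p. continuous_on UNIV (q p)" "\<And>p. (\<integral>z. \<bar>h p z - q p z\<bar> \<partial>\<gamma>) < \<kappa>"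
    by metis
  define est where "est p L \<longleftrightarrow> (\<forall>(V :: 'v set) (s :: 'g \<Rightarrow> 'v \<Rightarrow> 'v) z z'. finite V \<longrightarrow> V \<noteq> {} \<longrightarrow> (\<forall>g. bij_betw (s g) V V) \<longrightarrow>
      mean V (\<lambda>v. \<bar>q p (pullback_name s v z) - q p (pullback_name s v z')\<bar>) \<le> \<kappa> + L * hamming_dist V z z')" for p L
  have "\<forall>p. \<exists>L>0. est p L"
  proof
    fix p
    obtain k C where C: "C > 0"
      "\<And>x y. \<bar>q p x - q p y\<bar> \<le> \<kappa> + C * (\<Sum>i\<le>k. dist (x (from_nat i :: 'g)) (y (from_nat i)))"
      using continuous_almost_Lipschitz[OF cpt(2) q(1) \<kappa>(1)] by metis
    show "\<exists>L>0. est p L"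
      unfolding est_def
    proof (intro exI[of _ "C * real (Suc k)"] conjI allI impI)
      fix V :: "'v set" and s :: "'g \<Rightarrow> 'v \<Rightarrow> 'v" and z z' :: "'v \<Rightarrow> 'c"
      assume V: "finite V" "V \<noteq> {}" "\<forall>g. bij_betw (s g) V V"
      have "mean V (\<lambda>v. \<bar>q p (pullback_name s v z) - q p (pullback_name s v z')\<bar>)
        \<le> mean V (\<lambda>v. \<kappa> + C * (\<Sum>i\<le>k. dist (z (s (from_nat i) v)) (z' (s (from_nat i) v))))"
        by (rule mean_mono, rule order.trans[OF C(2)]) (simp add: pullback_name_def)
      also have "\<dots> = mean V (\<lambda>_. \<kappa>) + C * (\<Sum>i\<le>k. mean V (\<lambda>v. dist (z (s (from_nat i) v)) (z' (s (from_nat i) v))))"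
        unfolding mean_add mean_cmult mean_sum ..
      also have "\<dots> = \<kappa> + C * (\<Sum>i\<le>k. hamming_dist V z z')"
        using V by (simp add: mean_bij[where h = "\<lambda>v. dist (z v) (z' v)"] hamming_dist_def)
      finally show "mean V (\<lambda>v. \<bar>q p (pullback_name s v z) - q p (pullback_name s v z')\<bar>)
          \<le> \<kappa> + C * real (Suc k) * hamming_dist V z z'"
        by (simp add: algebra_simps)
    qed (use C(1) in simp)
  qed
  then obtain L where L: "\<And>p. L p > 0" "\<And>p. est p (L p)"
    by metis
  define \<delta>' where "\<delta>' = \<kappa> / (sum L D + 1)"
  have SL: "0 \<le> sum L D" using L(1) by (intro sum_nonneg) (simp add: less_imp_le)
  have \<delta>': "\<delta>' > 0" using SL \<kappa>(1) by (simp add: \<delta>'_def add_nonneg_pos)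
  have L\<delta>: "L p * \<delta>' \<le> \<kappa>" if "p \<in> D" for p
  proof -
    have "L p \<le> sum L D"
      by (rule member_le_sum[OF that _ D(1)]) (simp add: L(1) less_imp_le)
    then have "L p * \<delta>' \<le> (sum L D + 1) * \<delta>'"
      using \<delta>' by (intro mult_right_mono) auto
    also have "\<dots> = \<kappa>"
      using SL by (simp add: \<delta>'_def)
    finally show ?thesis .
  qed
  define f where "f p x = \<bar>dist (fst (x 0)) p - q p (\<lambda>g. snd (x g))\<bar>" for p and x :: "'g \<Rightarrow> 'a \<times> 'c"
  have fI: "(\<integral>w. f p (\<lambda>g. (w g, \<phi> w g)) \<partial>\<mu>) < \<kappa>" for p
  proof -
    have hm: "(\<lambda>z. \<bar>h p z - q p z\<bar>) \<in> borel_measurable (seq_space UNIV)"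
    proof -
      have [measurable]: "(\<lambda>z. \<psi> z 0) \<in> borel_measurable (seq_space UNIV)"
        by (rule measurable_compose[OF \<psi> measurable_component_singleton]) simp
      have [measurable]: "q p \<in> borel_measurable (seq_space UNIV)"
        by (rule continuous_measurable_seq_space[OF q(1)])
      show ?thesis unfolding h_def by measurable
    qed
    have [measurable]: "(\<lambda>w. w 0) \<in> borel_measurable \<mu>"
      using measurable_component_singleton[of 0 UNIV "\<lambda>_. borel"] measurable_cong_sets[OF \<mu>(2) refl] by blast
    have [measurable]: "(\<lambda>w. q p (\<phi> w)) \<in> borel_measurable \<mu>"
      by (rule measurable_compose[OF \<phi> continuous_measurable_seq_space[OF q(1)]])
    have "(\<integral>w. f p (\<lambda>g. (w g, \<phi> w g)) \<partial>\<mu>) = (\<integral>w. \<bar>h p (\<phi> w) - q p (\<phi> w)\<bar> \<partial>\<mu>)"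
    proof (rule integral_cong_AE)
      show "(\<lambda>w. f p (\<lambda>g. (w g, \<phi> w g))) \<in> borel_measurable \<mu>"
        unfolding f_def by simp
      show "(\<lambda>w. \<bar>h p (\<phi> w) - q p (\<phi> w)\<bar>) \<in> borel_measurable \<mu>"
        by (rule measurable_compose[OF \<phi> hm])
      show "AE w in \<mu>. f p (\<lambda>g. (w g, \<phi> w g)) = \<bar>h p (\<phi> w) - q p (\<phi> w)\<bar>"
        using inv by eventually_elim (simp add: f_def h_def)
    qed
    also have "\<dots> = (\<integral>z. \<bar>h p z - q p z\<bar> \<partial>\<gamma>)"
      unfolding \<gamma>_def by (rule integral_distr[symmetric, OF \<phi> hm])
    finally show ?thesis using q(2)[of p] by simp
  qed
  show thesis
  proof (rule that[of "f ` D" \<kappa> \<delta>'])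
    show "finite (f ` D)" using D(1) by simp
    show "continuous_on UNIV k" if k: "k \<in> f ` D" for k
    proof -
      obtain p where p: "k = f p" using k by blast
      show ?thesis
        unfolding p f_def by (intro continuous_intros continuous_on_compose2[OF q(1)]) auto
    qed
    fix V :: "'v set" and s :: "'g \<Rightarrow> 'v \<Rightarrow> 'v" and w z w' z'
    assume V: "finite V" "V \<noteq> {}" "\<And>g. bij_betw (s g) V V"
      and 1: "\<And>k. k \<in> f ` D \<Longrightarrow> \<bar>orbit_mean V s k (\<lambda>v\<in>V. (w v, z v)) - (\<integral>w. k (\<lambda>g. (w g, \<phi> w g)) \<partial>\<mu>)\<bar> < \<kappa>"
      and 2: "\<And>k. k \<in> f ` D \<Longrightarrow> \<bar>orbit_mean V s k (\<lambda>v\<in>V. (w' v, z' v)) - (\<integral>w. k (\<lambda>g. (w g, \<phi> w g)) \<partial>\<mu>)\<bar> < \<kappa>"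
      and zz: "hamming_dist V z z' < \<delta>'"
    have sV: "s g v \<in> V" if "v \<in> V" for g v
      using bij_betwE[OF V(3)] that by blast
    \<comment> \<open>The coordinate at \<open>0\<close> of the name of \<open>v\<close> is \<open>w (s 0 v)\<close> rather than \<open>w v\<close>. This does not change means,
      because \<open>s 0\<close> is a bijection.\<close>
    have om: "orbit_mean V s (f p) (\<lambda>v\<in>V. (w v, z v)) = mean V (\<lambda>v. \<bar>dist (w (s 0 v)) p - q p (pullback_name s v z)\<bar>)"
      for p and w :: "'v \<Rightarrow> 'a" and z
      unfolding orbit_mean_eq_mean f_def
      by (intro arg_cong2[where f = "(/)"] sum.cong refl)
         (use pullback_name_pair[of s _ V] sV in \<open>simp add: pullback_name_def\<close>)
    let ?e = "\<lambda>p v. \<bar>dist (w (s 0 v)) p - dist (w' (s 0 v)) p\<bar>"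
    let ?q = "\<lambda>p v. \<bar>q p (pullback_name s v z) - q p (pullback_name s v z')\<bar>"
    have e: "mean V (?e p) \<le> 6 * \<kappa>" if p: "p \<in> D" for p
    proof -
      have "mean V (?e p) \<le> mean V (\<lambda>v. \<bar>dist (w (s 0 v)) p - q p (pullback_name s v z)\<bar> +
          ?q p v +
          \<bar>dist (w' (s 0 v)) p - q p (pullback_name s v z')\<bar>)"
        by (rule mean_mono) linarith
      also have "\<dots> = orbit_mean V s (f p) (\<lambda>v\<in>V. (w v, z v)) +
          mean V (?q p) +
          orbit_mean V s (f p) (\<lambda>v\<in>V. (w' v, z' v))"
        unfolding mean_add om ..
      also have "\<dots> \<le> 2 * \<kappa> + 2 * \<kappa> + 2 * \<kappa>"
      proof (intro add_mono)
        show "orbit_mean V s (f p) (\<lambda>v\<in>V. (w v, z v)) \<le> 2 * \<kappa>"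
          using 1[of "f p"] fI[of p] p by force
        show "orbit_mean V s (f p) (\<lambda>v\<in>V. (w' v, z' v)) \<le> 2 * \<kappa>"
          using 2[of "f p"] fI[of p] p by force
        have "L p * hamming_dist V z z' \<le> L p * \<delta>'"
          using zz L(1)[of p] by (intro mult_left_mono) auto
        moreover have "mean V (?q p)
            \<le> \<kappa> + L p * hamming_dist V z z'"
          using L(2)[of p, unfolded est_def] V by blast
        ultimately show "mean V (?q p) \<le> 2 * \<kappa>"
          using L\<delta>[OF p] by linarith
      qed
      finally show ?thesis by simp
    qed
    have "hamming_dist V w w' = mean V (\<lambda>v. dist (w (s 0 v)) (w' (s 0 v)))"
      unfolding hamming_dist_def by (rule mean_bij[OF V(3), symmetric])
    also have "\<dots> \<le> mean V (\<lambda>v. \<delta>/4 + (\<Sum>p\<in>D. ?e p v))"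
    proof (rule mean_mono)
      fix v
      obtain p where p: "p \<in> D" "dist p (w' (s 0 v)) < \<delta>/8"
        using D(2) by (auto simp: subset_iff)
      have "?e p v \<le> (\<Sum>p\<in>D. ?e p v)"
        using D(1) p(1) by (intro member_le_sum) auto
      then show "dist (w (s 0 v)) (w' (s 0 v)) \<le> \<delta>/4 + (\<Sum>p\<in>D. ?e p v)"
        using p(2) dist_triangle[of "w (s 0 v)" "w' (s 0 v)" p] dist_commute[of p "w' (s 0 v)"] by linarith
    qed
    also have "\<dots> = mean V (\<lambda>_. \<delta>/4) + (\<Sum>p\<in>D. mean V (?e p))"
      unfolding mean_add mean_sum ..
    also have "\<dots> \<le> \<delta>/4 + (\<Sum>p\<in>D. 6 * \<kappa>)"
      using e V(1,2) by (intro add_mono sum_mono) auto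
    also have "\<dots> < \<delta>"
      using \<kappa>(2) \<delta> by simp
    finally show "hamming_dist V w w' < \<delta>" .
  qed (use \<kappa>(1) \<delta>' in auto)
qed

section \<open>Isomorphisms of systems\<close>

text \<open>
  The process \<open>\<gamma>\<close> is given as a model of the product system. It is identified with the joint process of
  \<open>\<alpha>\<close> and \<open>\<beta>\<close> by composing isomorphisms, which requires them to be symmetric, transitive and compatible with
  products.
\<close>

lemma AE_transfer:
  assumes "f \<in> M \<rightarrow>\<^sub>M N" "distr M N f = N" "AE y in N. P y"
  shows "AE x in M. P (f x)"
  using assms by (metis AE_distrD)

lemma isomorphic_systems_sym:
  assumes iso: "isomorphic_systems M T N S"
    and T: "\<And>g. T g \<in> M \<rightarrow>\<^sub>M M" "\<And>g. distr M M (T g) = M"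
  shows "isomorphic_systems N S M T"
proof -
  obtain \<phi> \<psi> where \<phi>: "\<phi> \<in> M \<rightarrow>\<^sub>M N" "distr M N \<phi> = N" and \<psi>: "\<psi> \<in> N \<rightarrow>\<^sub>M M" "distr N M \<psi> = M"
    and inv: "AE x in M. \<psi> (\<phi> x) = x" "AE y in N. \<phi> (\<psi> y) = y"
    and eq: "\<And>g. AE x in M. \<phi> (T g x) = S g (\<phi> x)"
    using iso unfolding isomorphic_systems_def by blast
  have "AE y in N. \<psi> (S g y) = T g (\<psi> y)" for g
  proof -
    have "AE x in M. \<psi> (\<phi> (T g x)) = T g x"
      by (rule AE_transfer[OF T inv(1)])
    then have "AE y in N. \<psi> (\<phi> (T g (\<psi> y))) = T g (\<psi> y)"
      by (rule AE_transfer[OF \<psi>])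
    moreover have "AE y in N. \<phi> (T g (\<psi> y)) = S g (\<phi> (\<psi> y))"
      by (rule AE_transfer[OF \<psi> eq])
    ultimately show ?thesis
      using inv(2) by eventually_elim simp
  qed
  with \<phi> \<psi> inv show ?thesis unfolding isomorphic_systems_def by blast
qed

lemma isomorphic_systems_trans:
  assumes "isomorphic_systems M T N S" "isomorphic_systems N S L R"
  shows "isomorphic_systems M T L R"
proof -
  obtain \<phi> \<psi> where \<phi>: "\<phi> \<in> M \<rightarrow>\<^sub>M N" "distr M N \<phi> = N" and \<psi>: "\<psi> \<in> N \<rightarrow>\<^sub>M M" "distr N M \<psi> = M"
    and inv: "AE x in M. \<psi> (\<phi> x) = x" "AE y in N. \<phi> (\<psi> y) = y"
    and eq: "\<And>g. AE x in M. \<phi> (T g x) = S g (\<phi> x)"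
    using assms(1) unfolding isomorphic_systems_def by blast
  obtain \<phi>' \<psi>' where \<phi>': "\<phi>' \<in> N \<rightarrow>\<^sub>M L" "distr N L \<phi>' = L" and \<psi>': "\<psi>' \<in> L \<rightarrow>\<^sub>M N" "distr L N \<psi>' = N"
    and inv': "AE x in N. \<psi>' (\<phi>' x) = x" "AE y in L. \<phi>' (\<psi>' y) = y"
    and eq': "\<And>g. AE x in N. \<phi>' (S g x) = R g (\<phi>' x)"
    using assms(2) unfolding isomorphic_systems_def by blast
  have "AE x in M. \<psi>' (\<phi>' (\<phi> x)) = \<phi> x"
    by (rule AE_transfer[OF \<phi> inv'(1)])
  with inv(1) have 1: "AE x in M. (\<psi> \<circ> \<psi>') ((\<phi>' \<circ> \<phi>) x) = x"
    by eventually_elim simp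
  have "AE y in L. \<phi> (\<psi> (\<psi>' y)) = \<psi>' y"
    by (rule AE_transfer[OF \<psi>' inv(2)])
  with inv'(2) have 2: "AE y in L. (\<phi>' \<circ> \<phi>) ((\<psi> \<circ> \<psi>') y) = y"
    by eventually_elim simp
  have 3: "AE x in M. (\<phi>' \<circ> \<phi>) (T g x) = R g ((\<phi>' \<circ> \<phi>) x)" for g
  proof -
    have "AE x in M. \<phi>' (S g (\<phi> x)) = R g (\<phi>' (\<phi> x))"
      by (rule AE_transfer[OF \<phi> eq'])
    with eq[of g] show ?thesis by eventually_elim simp
  qed
  have "distr M L (\<phi>' \<circ> \<phi>) = L" "distr L M (\<psi> \<circ> \<psi>') = M"
    using distr_distr[OF \<phi>'(1) \<phi>(1)] distr_distr[OF \<psi>(1) \<psi>'(1)] \<phi> \<phi>' \<psi> \<psi>' by simp_all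
  then show ?thesis
    unfolding isomorphic_systems_def using 1 2 3 measurable_comp[OF \<phi>(1) \<phi>'(1)] measurable_comp[OF \<psi>'(1) \<psi>(1)]
    by (intro exI[of _ "\<phi>' \<circ> \<phi>"] exI[of _ "\<psi> \<circ> \<psi>'"]) blast
qed

lemma distr_pair_snd:
  assumes "prob_space M" "prob_space N"
  shows "distr (M \<Otimes>\<^sub>M N) N snd = N"
proof -
  interpret M: prob_space M by fact
  interpret N: prob_space N by fact
  interpret P: pair_sigma_finite M N ..
  have "distr (M \<Otimes>\<^sub>M N) N snd = distr (distr (N \<Otimes>\<^sub>M M) (M \<Otimes>\<^sub>M N) (\<lambda>(x, y). (y, x))) N snd"
    by (subst P.distr_pair_swap) simp
  also have "\<dots> = distr (N \<Otimes>\<^sub>M M) N fst"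
    by (subst distr_distr) (auto simp: comp_def split_beta')
  finally show ?thesis by (simp add: M.distr_pair_fst)
qed

lemma AE_pair_components:
  assumes "prob_space M" "prob_space N" "AE x in M. P x" "AE y in N. Q y"
  shows "AE z in M \<Otimes>\<^sub>M N. P (fst z) \<and> Q (snd z)"
proof -
  have "AE z in M \<Otimes>\<^sub>M N. P (fst z)"
    by (rule AE_transfer[OF measurable_fst prob_space.distr_pair_fst[OF assms(2)] assms(3)])
  moreover have "AE z in M \<Otimes>\<^sub>M N. Q (snd z)"
    by (rule AE_transfer[OF measurable_snd distr_pair_snd[OF assms(1,2)] assms(4)])
  ultimately show ?thesis by eventually_elim simp
qed

lemma distr_map_prod:
  assumes "f \<in> M \<rightarrow>\<^sub>M M'" "g \<in> N \<rightarrow>\<^sub>M N'" "distr M M' f = M'" "distr N N' g = N'" "prob_space N'"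
  shows "distr (M \<Otimes>\<^sub>M N) (M' \<Otimes>\<^sub>M N') (map_prod f g) = M' \<Otimes>\<^sub>M N'"
  using pair_measure_distr[OF assms(1,2)] assms(3,4,5)
  by (simp add: map_prod_def prob_space_imp_sigma_finite)

lemma measurable_map_prod:
  assumes "f \<in> M \<rightarrow>\<^sub>M M'" "g \<in> N \<rightarrow>\<^sub>M N'"
  shows "map_prod f g \<in> M \<Otimes>\<^sub>M N \<rightarrow>\<^sub>M M' \<Otimes>\<^sub>M N'"
  using assms unfolding map_prod_def split_beta' by measurable

lemma isomorphic_systems_prod:
  assumes "isomorphic_systems M T M' T'" "isomorphic_systems N S N' S'"
    and prob: "prob_space M" "prob_space N" "prob_space M'" "prob_space N'"
  shows "isomorphic_systems (M \<Otimes>\<^sub>M N) (\<lambda>g. map_prod (T g) (S g)) (M' \<Otimes>\<^sub>M N') (\<lambda>g. map_prod (T' g) (S' g))"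
proof -
  obtain \<phi> \<psi> where \<phi>: "\<phi> \<in> M \<rightarrow>\<^sub>M M'" "distr M M' \<phi> = M'" and \<psi>: "\<psi> \<in> M' \<rightarrow>\<^sub>M M" "distr M' M \<psi> = M"
    and inv: "AE x in M. \<psi> (\<phi> x) = x" "AE y in M'. \<phi> (\<psi> y) = y"
    and eq: "\<And>g. AE x in M. \<phi> (T g x) = T' g (\<phi> x)"
    using assms(1) unfolding isomorphic_systems_def by blast
  obtain \<phi>' \<psi>' where \<phi>': "\<phi>' \<in> N \<rightarrow>\<^sub>M N'" "distr N N' \<phi>' = N'" and \<psi>': "\<psi>' \<in> N' \<rightarrow>\<^sub>M N" "distr N' N \<psi>' = N"
    and inv': "AE x in N. \<psi>' (\<phi>' x) = x" "AE y in N'. \<phi>' (\<psi>' y) = y"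
    and eq': "\<And>g. AE x in N. \<phi>' (S g x) = S' g (\<phi>' x)"
    using assms(2) unfolding isomorphic_systems_def by blast
  let ?\<phi> = "map_prod \<phi> \<phi>'" and ?\<psi> = "map_prod \<psi> \<psi>'"
  have "AE z in M \<Otimes>\<^sub>M N. ?\<psi> (?\<phi> z) = z" "AE z in M' \<Otimes>\<^sub>M N'. ?\<phi> (?\<psi> z) = z"
    using AE_pair_components[OF prob(1,2) inv(1) inv'(1)] AE_pair_components[OF prob(3,4) inv(2) inv'(2)]
    by (auto simp: map_prod_def split_beta')
  moreover have "AE z in M \<Otimes>\<^sub>M N. ?\<phi> (map_prod (T g) (S g) z) = map_prod (T' g) (S' g) (?\<phi> z)" for g
    using AE_pair_components[OF prob(1,2) eq[of g] eq'[of g]] by (auto simp: map_prod_def split_beta')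
  ultimately show ?thesis
    unfolding isomorphic_systems_def
    using measurable_map_prod[OF \<phi>(1) \<phi>'(1)] measurable_map_prod[OF \<psi>(1) \<psi>'(1)]
      distr_map_prod[OF \<phi>(1) \<phi>'(1) \<phi>(2) \<phi>'(2) prob(4)] distr_map_prod[OF \<psi>(1) \<psi>'(1) \<psi>(2) \<psi>'(2) prob(2)]
    by (intro exI[of _ ?\<phi>] exI[of _ ?\<psi>]) blast
qed

lemma joint_measure_process:
  fixes \<alpha> :: "('g::{group_add,countable} \<Rightarrow> 'a::second_countable_topology) measure"
    and \<beta> :: "('g \<Rightarrow> 'b::second_countable_topology) measure"
  assumes \<alpha>: "prob_space \<alpha>" "sets \<alpha> = sets (seq_space UNIV)" "\<And>g. distr \<alpha> \<alpha> (shift g) = \<alpha>"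
    and \<beta>: "prob_space \<beta>" "sets \<beta> = sets (seq_space UNIV)" "\<And>g. distr \<beta> \<beta> (shift g) = \<beta>"
  shows "isomorphic_systems (joint_measure UNIV \<alpha> \<beta>) shift (\<alpha> \<Otimes>\<^sub>M \<beta>) (\<lambda>g. map_prod (shift g) (shift g))"
    and "distr (joint_measure UNIV \<alpha> \<beta>) (joint_measure UNIV \<alpha> \<beta>) (shift g) = joint_measure UNIV \<alpha> \<beta>"
proof -
  let ?J = "joint_measure UNIV \<alpha> \<beta>"
  let ?j = "\<lambda>z g. (fst z g, snd z g)"
  let ?u = "\<lambda>w. (\<lambda>g. fst (w g), \<lambda>g. snd (w g))"
  have J: "?J = distr (\<alpha> \<Otimes>\<^sub>M \<beta>) (seq_space UNIV) ?j" and jm: "?j \<in> \<alpha> \<Otimes>\<^sub>M \<beta> \<rightarrow>\<^sub>M seq_space UNIV"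
    using measurable_joint[OF \<alpha>(2) \<beta>(2)] by (simp_all add: joint_measure_def split_beta' restrict_def)
  have jm': "?j \<in> \<alpha> \<Otimes>\<^sub>M \<beta> \<rightarrow>\<^sub>M ?J"
    using jm measurable_cong_sets[OF refl sets_joint_measure] by blast
  have component: "(\<lambda>w. w g) \<in> ?J \<rightarrow>\<^sub>M borel" for g
    using measurable_component_singleton[of g UNIV "\<lambda>_. borel"] measurable_cong_sets[OF sets_joint_measure refl] by blast
  have "(\<lambda>w g. fst (w g)) \<in> ?J \<rightarrow>\<^sub>M seq_space UNIV" "(\<lambda>w g. snd (w g)) \<in> ?J \<rightarrow>\<^sub>M seq_space UNIV"
    by (intro measurable_PiM_single' measurable_compose[OF component]
          borel_measurable_continuous_onI continuous_intros; simp)+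
  then have um: "?u \<in> ?J \<rightarrow>\<^sub>M \<alpha> \<Otimes>\<^sub>M \<beta>"
    using measurable_cong_sets[OF refl \<alpha>(2)] measurable_cong_sets[OF refl \<beta>(2)]
    by (intro measurable_Pair) auto
  have "distr ?J (\<alpha> \<Otimes>\<^sub>M \<beta>) ?u = distr (\<alpha> \<Otimes>\<^sub>M \<beta>) (\<alpha> \<Otimes>\<^sub>M \<beta>) (?u \<circ> ?j)"
    unfolding J using um by (intro distr_distr jm) (simp add: J)
  also have "?u \<circ> ?j = (\<lambda>z. z)" by auto
  finally have ud: "distr ?J (\<alpha> \<Otimes>\<^sub>M \<beta>) ?u = \<alpha> \<Otimes>\<^sub>M \<beta>" by simp
  have jd: "distr (\<alpha> \<Otimes>\<^sub>M \<beta>) ?J ?j = ?J"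
    by (subst (2) J) (simp cong: distr_cong)
  show "isomorphic_systems ?J shift (\<alpha> \<Otimes>\<^sub>M \<beta>) (\<lambda>g. map_prod (shift g) (shift g))"
    unfolding isomorphic_systems_def
    by (intro exI[of _ ?u] exI[of _ ?j] conjI um ud jm' jd) (auto simp: shift_def)
  have mp: "map_prod (shift g) (shift g) \<in> \<alpha> \<Otimes>\<^sub>M \<beta> \<rightarrow>\<^sub>M \<alpha> \<Otimes>\<^sub>M \<beta>"
    by (intro measurable_map_prod measurable_shift \<alpha> \<beta>)
  have "distr ?J ?J (shift g) = distr (\<alpha> \<Otimes>\<^sub>M \<beta>) ?J (shift g \<circ> ?j)"
    using distr_distr[OF measurable_shift[OF sets_joint_measure] jm'] by (simp add: jd)
  also have "shift g \<circ> ?j = ?j \<circ> map_prod (shift g) (shift g)"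
    by (auto simp: shift_def)
  also have "distr (\<alpha> \<Otimes>\<^sub>M \<beta>) ?J (?j \<circ> map_prod (shift g) (shift g))
      = distr (distr (\<alpha> \<Otimes>\<^sub>M \<beta>) (\<alpha> \<Otimes>\<^sub>M \<beta>) (map_prod (shift g) (shift g))) ?J ?j"
    by (rule distr_distr[symmetric, OF jm' mp])
  also have "\<dots> = ?J"
    unfolding distr_map_prod[OF measurable_shift[OF \<alpha>(2)] measurable_shift[OF \<beta>(2)] \<alpha>(3) \<beta>(3) \<beta>(1)] jd ..
  finally show "distr ?J ?J (shift g) = ?J" .
qed

section \<open>Counting\<close>

text \<open>
  Models \<open>y\<close> from a maximal separated set and models \<open>x\<close> from the large set \<open>G y\<close> give points
  \<open>L x y\<close>, each close to a centre of a given cover. A centre determines \<open>y\<close>, and determines \<open>x\<close>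
  up to a small distance. So the centres belonging to a fixed \<open>y\<close> number at least
  the covering number of the measure \<open>m\<close>, and different \<open>y\<close> have disjoint sets of centres.
\<close>

lemma cov_measure_mult_cov_le:
  fixes m :: "'x measure" and Y :: "'y set" and Z :: "'z set"
  assumes prob: "prob_space m"
    and lift: "\<And>y x. y \<in> Y \<Longrightarrow> x \<in> G y \<Longrightarrow> L x y \<in> Z"
    and G: "\<And>y. y \<in> Y \<Longrightarrow> G y \<subseteq> space m" "\<And>y. y \<in> Y \<Longrightarrow> measure m (G y) > 1 - \<epsilon>"
    and meas: "\<And>f. f \<in> space m \<Longrightarrow> {x \<in> space m. dX f x < \<delta>1} \<in> sets m"
    and sep: "\<And>y y' x x'. y \<in> Y \<Longrightarrow> y' \<in> Y \<Longrightarrow> x \<in> G y \<Longrightarrow> x' \<in> G y' \<Longrightarrow>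
        dZ (L x y) (L x' y') < 2 * \<delta>' \<Longrightarrow> dX x x' < \<delta>1 \<and> dY y y' < \<delta>2"
    and dY: "\<And>y. dY y y < \<delta>2" "\<And>y y'. dY y y' = dY y' y"
    and dZ: "\<And>a b. dZ a b = dZ b a" "\<And>a b c. dZ a c \<le> dZ a b + dZ b (c :: 'z) "
  shows "cov_measure \<epsilon> \<delta>1 m dX * cov \<delta>2 Y dY \<le> cov \<delta>' Z dZ"
proof (cases "cov_measure \<epsilon> \<delta>1 m dX = 0")
  case False
  interpret prob_space m by fact
  define c where "c = cov_measure \<epsilon> \<delta>1 m dX"
  have c_le: "c \<le> enat (card F)" if F: "finite F" "F \<subseteq> space m" "y \<in> Y" "\<And>x. x \<in> G y \<Longrightarrow> \<exists>f\<in>F. dX f x < \<delta>1" for F y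
    unfolding c_def cov_measure_def
  proof (rule INF_lower, intro CollectI conjI F(1,2))
    have eq: "{x \<in> space m. \<exists>f\<in>F. dX f x < \<delta>1} = (\<Union>f\<in>F. {x \<in> space m. dX f x < \<delta>1})"
      by auto
    have "{x \<in> space m. \<exists>f\<in>F. dX f x < \<delta>1} \<in> sets m"
      unfolding eq using F(1,2) meas by (intro sets.finite_UN) auto
    moreover have "G y \<subseteq> {x \<in> space m. \<exists>f\<in>F. dX f x < \<delta>1}"
      using G(1)[OF F(3)] F(4) by blast
    ultimately show "1 - \<epsilon> < prob {x \<in> space m. \<exists>f\<in>F. dX f x < \<delta>1}"
      using G(2)[OF F(3)] finite_measure_mono by (meson less_le_trans)
  qed
  show ?thesis
    unfolding cov_def[of \<delta>' Z dZ]
  proof (rule INF_greatest)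
    fix F assume "F \<in> {F. finite F \<and> F \<subseteq> Z \<and> (\<forall>z\<in>Z. \<exists>y\<in>F. dZ y z < \<delta>')}"
    then have F: "finite F" "\<And>z. z \<in> Z \<Longrightarrow> \<exists>f\<in>F. dZ f z < \<delta>'" by auto
    define e where "e x y = (SOME f. f \<in> F \<and> dZ f (L x y) < \<delta>')" for x y
    have e: "e x y \<in> F" "dZ (e x y) (L x y) < \<delta>'" if "y \<in> Y" "x \<in> G y" for x y
      using someI_ex[of "\<lambda>f. f \<in> F \<and> dZ f (L x y) < \<delta>'"] F(2)[OF lift[OF that]] unfolding e_def by auto
    have same: "dX x x' < \<delta>1 \<and> dY y y' < \<delta>2"
      if "y \<in> Y" "y' \<in> Y" "x \<in> G y" "x' \<in> G y'" "e x y = e x' y'" for x x' y y'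
    proof (rule sep[OF that(1-4)])
      have "dZ (L x y) (L x' y') \<le> dZ (L x y) (e x y) + dZ (e x y) (L x' y')" by (rule dZ(2))
      also have "\<dots> < 2 * \<delta>'"
        using e(2)[OF that(1,3)] e(2)[OF that(2,4)] that(5) dZ(1)[of "L x y"] by simp
      finally show "dZ (L x y) (L x' y') < 2 * \<delta>'" .
    qed
    define K where "K y = (\<lambda>x. e x y) ` G y" for y
    have KF: "K y \<subseteq> F" if "y \<in> Y" for y
      using e(1)[OF that] by (auto simp: K_def)
    have cK: "c \<le> enat (card (K y))" if y: "y \<in> Y" for y
    proof -
      define r where "r f = (SOME x. x \<in> G y \<and> e x y = f)" for f
      have r: "r f \<in> G y" "e (r f) y = f" if "f \<in> K y" for f
        using someI_ex[of "\<lambda>x. x \<in> G y \<and> e x y = f"] that unfolding r_def K_def by auto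
      have fin: "finite (K y)" using KF[OF y] F(1) finite_subset by blast
      have "c \<le> enat (card (r ` K y))"
      proof (rule c_le[OF _ _ y])
        show "r ` K y \<subseteq> space m" using r(1) G(1)[OF y] by blast
        fix x assume x: "x \<in> G y"
        then have "e x y \<in> K y" by (simp add: K_def)
        then show "\<exists>f\<in>r ` K y. dX f x < \<delta>1"
          using same[OF y y r(1) x r(2)] by blast
      qed (use fin in simp)
      also have "\<dots> \<le> enat (card (K y))"
        using fin by (simp add: card_image_le)
      finally show ?thesis .
    qed
    define separated where "separated A \<longleftrightarrow> finite A \<and> A \<subseteq> Y \<and> (\<forall>y\<in>A. \<forall>y'\<in>A. y \<noteq> y' \<longrightarrow> \<not> dY y y' < \<delta>2)" for A
    have bound: "c * enat (card A) \<le> enat (card F)" if A: "separated A" for A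
    proof -
      have A': "finite A" "A \<subseteq> Y" using A by (auto simp: separated_def)
      have "c * enat (card A) = (\<Sum>y\<in>A. c)"
        by (simp add: of_nat_eq_enat[symmetric] mult.commute)
      also have "\<dots> \<le> (\<Sum>y\<in>A. enat (card (K y)))"
        using cK A' by (intro sum_mono) auto
      also have "\<dots> = enat (\<Sum>y\<in>A. card (K y))"
        by (simp add: of_nat_eq_enat[symmetric])
      also have "(\<Sum>y\<in>A. card (K y)) = card (\<Union>y\<in>A. K y)"
      proof (rule card_UN_disjoint[symmetric, OF A'(1)])
        show "\<forall>y\<in>A. finite (K y)" using A' KF F(1) finite_subset by blast
        show "\<forall>y\<in>A. \<forall>y'\<in>A. y \<noteq> y' \<longrightarrow> K y \<inter> K y' = {}"
          using A same unfolding separated_def K_def by blast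
      qed
      also have "\<dots> \<le> card F"
        using KF A' F(1) by (intro card_mono) auto
      finally show ?thesis by simp
    qed
    \<comment> \<open>As \<open>c\<close> is positive, separated sets have bounded cardinality, and so there is a maximal one.\<close>
    have cardle: "card A \<le> card F" if "separated A" for A
    proof -
      have "1 \<le> c"
        using False ileI1[of 0 c] by (simp add: c_def one_eSuc)
      then have "1 * enat (card A) \<le> c * enat (card A)"
        by (intro mult_right_mono) auto
      from order_trans[OF this bound[OF that]] show ?thesis by simp
    qed
    have "separated {}" by (simp add: separated_def)
    then have "\<exists>A. separated A \<and> (\<forall>B. separated B \<longrightarrow> card B \<le> card A)"
      by (rule ex_has_greatest_nat[where b = "Suc (card F)"]) (use cardle in \<open>simp add: less_Suc_eq_le\<close>)
    then obtain A where A: "separated A" "\<And>B. separated B \<Longrightarrow> card B \<le> card A"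
      by (elim exE conjE) simp
    have "cov \<delta>2 Y dY \<le> enat (card A)"
      unfolding cov_def
    proof (rule INF_lower, intro CollectI conjI ballI)
      show "finite A" "A \<subseteq> Y" using A(1) by (auto simp: separated_def)
      fix z assume z: "z \<in> Y"
      show "\<exists>y\<in>A. dY y z < \<delta>2"
      proof (rule ccontr)
        assume n: "\<not> ?thesis"
        then have "z \<notin> A" using dY(1) by blast
        moreover have "separated (insert z A)"
          using n A(1) z dY(2) unfolding separated_def by (metis finite_insert insert_iff insert_subset)
        ultimately show False
          using A(2)[of "insert z A"] A(1) by (simp add: separated_def)
      qed
    qed
    then have "c * cov \<delta>2 Y dY \<le> c * enat (card A)"
      by (intro mult_left_mono) auto
    also have "\<dots> \<le> enat (card F)" by (rule bound[OF A(1)])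
    finally show "cov_measure \<epsilon> \<delta>1 m dX * cov \<delta>2 Y dY \<le> enat (card F)"
      by (simp add: c_def)
  qed
qed simp

lemma log_enat_mult_le:
  assumes "k * l \<le> r" "N > 0" "ereal a < log_enat k / ereal N" "ereal b < log_enat l / ereal N"
  shows "ereal (a + b) < log_enat r / ereal N"
proof (cases r)
  case infinity
  then show ?thesis using assms(2) by (simp add: log_enat_def)
next
  case (enat r')
  have ne: "k \<noteq> 0" "l \<noteq> 0"
    using assms(2-4) by (auto simp: log_enat_def zero_enat_def)
  then obtain k' l' where kl: "k = enat k'" "l = enat l'"
    using assms(1) enat by (cases k; cases l) (auto simp: zero_enat_def split: if_splits)
  have pos: "k' > 0" "l' > 0" using ne kl by (auto simp: zero_enat_def)
  have le: "k' * l' \<le> r'" using assms(1) kl enat by simp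
  then have r': "r' > 0" using pos by (metis gr0I le_zero_eq mult_is_0 neq0_conv)
  have "a < ln (real k') / N" "b < ln (real l') / N"
    using assms(2-4) kl pos by (simp_all add: log_enat_def)
  then have "a + b < ln (real k') / N + ln (real l') / N" by simp
  also have "\<dots> = ln (real (k' * l')) / N"
    using pos by (simp add: ln_mult add_divide_distrib)
  also have "\<dots> \<le> ln (real r') / N"
    using le pos r' assms(2) by (intro divide_right_mono) (auto simp del: of_nat_mult)
  finally show ?thesis
    using enat r' assms(2) by (simp add: log_enat_def)
qed

lemma ereal_add_le_approx:
  fixes x y c :: ereal
  assumes "x \<noteq> -\<infinity>" "y \<noteq> -\<infinity>"
    and le: "\<And>a b :: real. ereal a < x \<Longrightarrow> ereal b < y \<Longrightarrow> ereal (a + b) \<le> c"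
  shows "x + y \<le> c"
proof (rule dense_le)
  fix t assume t: "t < x + y"
  have "\<exists>a b :: real. ereal a < x \<and> ereal b < y \<and> t \<le> ereal (a + b)"
  proof (cases x; cases y)
    fix r s assume xy: "x = ereal r" "y = ereal s"
    show ?thesis
    proof (cases t)
      case (real u)
      then show ?thesis
        using t xy by (intro exI[of _ "r - (r + s - u) / 2"] exI[of _ "s - (r + s - u) / 2"]) (auto simp: field_simps)
    next
      case MInf
      then show ?thesis using xy by (intro exI[of _ "r - 1"] exI[of _ "s - 1"]) auto
    qed (use t xy in auto)
  next
    fix r assume xy: "x = ereal r" "y = \<infinity>"
    have "t \<le> ereal ((r - 1) + (real_of_ereal t - (r - 1)))"
      using t xy by (cases t) auto
    then show ?thesis
      using xy by (intro exI[of _ "r - 1"] exI[of _ "real_of_ereal t - (r - 1)"]) auto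
  next
    fix s assume xy: "x = \<infinity>" "y = ereal s"
    have "t \<le> ereal ((real_of_ereal t - (s - 1)) + (s - 1))"
      using t xy by (cases t) auto
    then show ?thesis
      using xy by (intro exI[of _ "real_of_ereal t - (s - 1)"] exI[of _ "s - 1"]) auto
  next
    assume xy: "x = \<infinity>" "y = \<infinity>"
    have "t \<le> ereal (0 + real_of_ereal t)"
      using t xy by (cases t) auto
    then show ?thesis
      using xy by (intro exI[of _ 0] exI[of _ "real_of_ereal t"]) auto
  qed (use assms in auto)
  then show "t \<le> c" using le order_trans by blast
qed

section \<open>The entropy inequality\<close>

lemma hamming_dist_commute: "hamming_dist V x y = hamming_dist V y x"
  by (simp add: hamming_dist_def dist_commute)

lemma hamming_dist_triangle: "hamming_dist V x z \<le> hamming_dist V x y + hamming_dist V y z"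
  unfolding hamming_dist_def mean_add[symmetric] by (intro mean_mono dist_triangle)

lemma hamming_dist_pair_ge:
  "hamming_dist V x x' \<le> hamming_dist V (\<lambda>v\<in>V. (x v, y v)) (\<lambda>v\<in>V. (x' v, y' v))"
  "hamming_dist V y y' \<le> hamming_dist V (\<lambda>v\<in>V. (x v, y v)) (\<lambda>v\<in>V. (x' v, y' v))"
proof -
  have "dist (x v) (x' v) \<le> dist (x v, y v) (x' v, y' v)" "dist (y v) (y' v) \<le> dist (x v, y v) (x' v, y' v)" for v
    using dist_fst_le[of "(x v, y v)" "(x' v, y' v)"] dist_snd_le[of "(x v, y v)" "(x' v, y' v)"] by simp_all
  then show "hamming_dist V x x' \<le> hamming_dist V (\<lambda>v\<in>V. (x v, y v)) (\<lambda>v\<in>V. (x' v, y' v))"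
    "hamming_dist V y y' \<le> hamming_dist V (\<lambda>v\<in>V. (x v, y v)) (\<lambda>v\<in>V. (x' v, y' v))"
    unfolding hamming_dist_def by (auto intro!: mean_mono)
qed

lemma measurable_hamming_ball:
  fixes m :: "('v \<Rightarrow> 'a::{metric_space, second_countable_topology}) measure"
  assumes "sets m = sets (seq_space V)"
  shows "{x \<in> space m. hamming_dist V f x < \<delta>} \<in> sets m"
proof -
  have "hamming_dist V f \<in> borel_measurable (seq_space V)"
    unfolding hamming_dist_def
    by (intro borel_measurable_divide borel_measurable_sum borel_measurable_dist borel_measurable_const
          measurable_component_singleton)
  then have [measurable]: "hamming_dist V f \<in> borel_measurable m"
    using measurable_cong_sets[OF assms refl] by blast
  show ?thesis by measurable
qed

text \<open>
  All good models \<open>y\<close> of \<open>\<beta>\<close> pair well with most samples \<open>x\<close> of a doubly-quenched sequence, the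
  pairs lift to models of \<open>\<gamma>\<close>, and the lifts of separated pairs are separated. The covering
  numbers multiply accordingly.
\<close>

lemma cov_lift_ge:
  fixes V :: "nat \<Rightarrow> 'v set" and \<sigma> :: "nat \<Rightarrow> 'g::{group_add,countable} \<Rightarrow> 'v \<Rightarrow> 'v"
    and \<alpha> :: "('g \<Rightarrow> 'a::polish_space) measure" and \<beta> :: "('g \<Rightarrow> 'b::polish_space) measure"
    and \<gamma> :: "('g \<Rightarrow> 'c::polish_space) measure"
  assumes sof: "sofic_approximation V \<sigma>"
    and \<alpha>: "metric_process \<alpha>" and \<beta>: "metric_process \<beta>" and \<gamma>: "metric_process \<gamma>"
    and iso: "isomorphic_systems (joint_measure UNIV \<alpha> \<beta>) shift \<gamma> shift"
    and r: "strict_mono r" and dq: "doubly_quenched_converges (\<lambda>i. V (r i)) (\<lambda>i. \<sigma> (r i)) m \<alpha>"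
    and pos: "\<epsilon> > 0" "\<delta>1 > 0" "\<delta>2 > 0"
  obtains \<delta>' where "\<delta>' > 0" "\<And>\<O>. \<O> \<in> weak_star_nhds \<gamma> \<Longrightarrow>
    \<exists>\<O>' \<in> weak_star_nhds \<beta>. \<forall>\<^sub>F i in sequentially.
      cov_measure \<epsilon> \<delta>1 (m i) (hamming_dist (V (r i))) *
      cov \<delta>2 (good_models \<O>' (V (r i)) (\<sigma> (r i))) (hamming_dist (V (r i)))
      \<le> cov \<delta>' (good_models \<O> (V (r i)) (\<sigma> (r i))) (hamming_dist (V (r i)))"
proof -
  note V = sofic_approximationD[OF sof]
  let ?J = "joint_measure UNIV \<alpha> \<beta>"
  have \<alpha>: "compact (UNIV :: 'a set)" "prob_space \<alpha>" "sets \<alpha> = sets (seq_space UNIV)" "\<And>g. distr \<alpha> \<alpha> (shift g) = \<alpha>"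
    and \<beta>: "compact (UNIV :: 'b set)" "prob_space \<beta>" "sets \<beta> = sets (seq_space UNIV)" "\<And>g. distr \<beta> \<beta> (shift g) = \<beta>"
    and \<gamma>: "compact (UNIV :: 'c set)" "prob_space \<gamma>" "sets \<gamma> = sets (seq_space UNIV)"
    using \<alpha> \<beta> \<gamma> by (auto simp: metric_process_def)
  have cptab: "compact (UNIV :: ('a \<times> 'b) set)"
    by (rule compact_UNIV_prod[OF \<alpha>(1) \<beta>(1)])
  have J: "prob_space ?J" "sets ?J = sets (seq_space UNIV)" "\<And>g. distr ?J ?J (shift g) = ?J"
    using prob_space_joint_measure[OF \<alpha>(2) \<beta>(2) \<alpha>(3) \<beta>(3)] joint_measure_process(2)[OF \<alpha>(2-4) \<beta>(2-4)]
    by auto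
  obtain \<phi> \<psi> where \<phi>: "\<phi> \<in> ?J \<rightarrow>\<^sub>M \<gamma>" "distr ?J \<gamma> \<phi> = \<gamma>" and \<psi>: "\<psi> \<in> \<gamma> \<rightarrow>\<^sub>M ?J"
    and inv: "AE w in ?J. \<psi> (\<phi> w) = w" and eq: "\<And>g. AE w in ?J. \<phi> (shift g w) = shift g (\<phi> w)"
    using iso unfolding isomorphic_systems_def by blast
  have \<phi>m: "\<phi> \<in> ?J \<rightarrow>\<^sub>M seq_space UNIV"
    using \<phi>(1) measurable_cong_sets[OF refl \<gamma>(3)] by blast
  have \<psi>m: "\<psi> \<in> seq_space UNIV \<rightarrow>\<^sub>M seq_space UNIV"
    using \<psi> measurable_cong_sets[OF \<gamma>(3) J(2)] by blast
  have m: "prob_space (m i)" "sets (m i) = sets (seq_space (V (r i)))" for i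
    using dq unfolding doubly_quenched_converges_def by auto
  define I where "I f = (\<integral>w. f (\<lambda>g. (w g, \<phi> w g)) \<partial>?J)" for f :: "('g \<Rightarrow> ('a \<times> 'b) \<times> 'c) \<Rightarrow> real"
  obtain F1 \<eta>1 \<delta>' where F1: "finite F1" "\<And>f. f \<in> F1 \<Longrightarrow> continuous_on UNIV f" "\<eta>1 > 0" "\<delta>' > 0"
    and sep: "\<And>(V :: 'v set) s w z w' z'. finite V \<Longrightarrow> V \<noteq> {} \<Longrightarrow> (\<And>g. bij_betw (s g) V V) \<Longrightarrow>
      (\<And>f. f \<in> F1 \<Longrightarrow> \<bar>orbit_mean V s f (\<lambda>v\<in>V. (w v, z v)) - I f\<bar> < \<eta>1) \<Longrightarrow>
      (\<And>f. f \<in> F1 \<Longrightarrow> \<bar>orbit_mean V s f (\<lambda>v\<in>V. (w' v, z' v)) - I f\<bar> < \<eta>1) \<Longrightarrow>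
      hamming_dist V z z' < \<delta>' \<Longrightarrow> hamming_dist V w w' < min \<delta>1 \<delta>2"
  proof -
    have \<delta>: "min \<delta>1 \<delta>2 > 0" using pos by simp
    show thesis
      by (rule lift_separates[OF cptab \<gamma>(1) J(1,2) \<phi>m \<psi>m inv \<delta>, folded I_def]) (fact that)
  qed
  let ?le = "\<lambda>\<O> \<O>' i. cov_measure \<epsilon> \<delta>1 (m i) (hamming_dist (V (r i))) *
      cov \<delta>2 (good_models \<O>' (V (r i)) (\<sigma> (r i))) (hamming_dist (V (r i)))
      \<le> cov (\<delta>' / 2) (good_models \<O> (V (r i)) (\<sigma> (r i))) (hamming_dist (V (r i)))"
  show thesis
  proof (rule that[of "\<delta>' / 2"])
    show "\<delta>' / 2 > 0" using F1 by simp
    fix \<O> assume "\<O> \<in> weak_star_nhds \<gamma>"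
    then obtain F2 \<eta>2 where F2: "finite F2" "\<And>f. f \<in> F2 \<Longrightarrow> continuous_on UNIV f" "\<eta>2 > 0"
      "weak_star_ball F2 \<eta>2 \<gamma> \<subseteq> \<O>"
      using weak_star_nhd_contains_ball by blast
    define up where "up f x = f (\<lambda>g. snd (x g))" for f :: "('g \<Rightarrow> 'c) \<Rightarrow> real" and x :: "'g \<Rightarrow> ('a \<times> 'b) \<times> 'c"
    have up: "continuous_on UNIV (up f)" "I (up f) = integral\<^sup>L \<gamma> f" if "f \<in> F2" for f
    proof -
      show "continuous_on UNIV (up f)"
        unfolding up_def by (intro continuous_intros continuous_on_compose2[OF F2(2)[OF that]]) auto
      have "f \<in> borel_measurable \<gamma>"
        using continuous_measurable_seq_space[OF F2(2)[OF that]] measurable_cong_sets[OF \<gamma>(3) refl] by blast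
      from integral_distr[OF \<phi>(1) this] show "I (up f) = integral\<^sup>L \<gamma> f"
        by (simp add: I_def up_def \<phi>(2))
    qed
    define F where "F = F1 \<union> up ` F2"
    define \<eta> where "\<eta> = min \<eta>1 \<eta>2"
    define lifted where "lifted n w z \<longleftrightarrow> z \<in> V n \<rightarrow>\<^sub>E UNIV \<and>
        (\<forall>f\<in>F. \<bar>orbit_mean (V n) (\<sigma> n) f (\<lambda>v\<in>V n. (w v, z v)) - I f\<bar> < \<eta>)" for n w z
    have "for_good_models V \<sigma> ?J (\<lambda>n w. \<exists>z \<in> V n \<rightarrow>\<^sub>E UNIV. \<forall>f\<in>F.
        \<bar>orbit_mean (V n) (\<sigma> n) f (\<lambda>v\<in>V n. (w v, z v)) - (\<integral>w. f (\<lambda>g. (w g, \<phi> w g)) \<partial>?J)\<bar> < \<eta>)"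
    proof (rule lift_models[OF sof cptab \<gamma>(1) J \<phi>m eq])
      show "finite F" "\<eta> > 0" using F1 F2 by (auto simp: F_def \<eta>_def)
      show "continuous_on UNIV f" if "f \<in> F" for f
        using that F1(2) up(1) by (auto simp: F_def)
    qed
    then have "for_good_models V \<sigma> ?J (\<lambda>n w. \<exists>z. lifted n w z)"
      unfolding lifted_def I_def by (rule for_good_models_mono) (intro always_eventually, blast)
    then obtain \<O>1 where \<O>1: "\<O>1 \<in> weak_star_nhds ?J"
      "\<forall>\<^sub>F n in sequentially. \<forall>w \<in> good_models \<O>1 (V n) (\<sigma> n). \<exists>z. lifted n w z"
      unfolding for_good_models_def by blast
    obtain F3 \<eta>3 where F3: "finite F3" "\<And>f. f \<in> F3 \<Longrightarrow> continuous_on UNIV f" "\<eta>3 > 0"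
      "weak_star_ball F3 \<eta>3 ?J \<subseteq> \<O>1"
      using weak_star_nhd_contains_ball[OF \<O>1(1)] by blast
    define bad where "bad i f y = {x \<in> space (m i). \<eta>3 \<le> \<bar>orbit_mean (V (r i)) (\<sigma> (r i)) f (\<lambda>v\<in>V (r i). (x v, y v))
        - integral\<^sup>L ?J f\<bar>}" for i f y
    have bad_sets: "bad i f y \<in> sets (m i)" if "f \<in> F3" for i f y
    proof -
      note [measurable] = measurable_pair_orbit_mean[OF m(2) V(4) F3(2)[OF that]]
      show ?thesis unfolding bad_def by measurable
    qed
    define \<theta> where "\<theta> = \<epsilon> / (real (card F3) + 1)"
    have \<theta>: "\<theta> > 0" "real (card F3) * \<theta> < \<epsilon>"
      using pos(1) by (auto simp: \<theta>_def field_simps)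
    have "for_good_models (\<lambda>i. V (r i)) (\<lambda>i. \<sigma> (r i)) \<beta> (\<lambda>i y. \<forall>f\<in>F3. measure (m i) (bad i f y) < \<theta>)"
    proof (rule for_good_models_ball[OF F3(1) _ for_good_models_True[OF \<beta>(2,3)]])
      fix f assume "f \<in> F3"
      then show "for_good_models (\<lambda>i. V (r i)) (\<lambda>i. \<sigma> (r i)) \<beta> (\<lambda>i y. measure (m i) (bad i f y) < \<theta>)"
        unfolding bad_def
        by (intro generic_product[OF \<alpha>(1) \<beta>(1) \<alpha>(2,3) \<beta>(2,3) V(1,2) V(4) dq] F3 \<theta>(1))
    qed
    then obtain \<O>' where \<O>': "\<O>' \<in> weak_star_nhds \<beta>" "\<forall>\<^sub>F i in sequentially.
        \<forall>y \<in> good_models \<O>' (V (r i)) (\<sigma> (r i)). \<forall>f\<in>F3. measure (m i) (bad i f y) < \<theta>"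
      unfolding for_good_models_def by blast
    have "\<forall>\<^sub>F i in sequentially. \<forall>w \<in> good_models \<O>1 (V (r i)) (\<sigma> (r i)). \<exists>z. lifted (r i) w z"
      using \<O>1(2) filterlim_subseq[OF r] unfolding filterlim_iff by blast
    with \<O>'(2) have "\<forall>\<^sub>F i in sequentially. ?le \<O> \<O>' i"
    proof eventually_elim
      case (elim i)
      let ?V = "V (r i)" and ?s = "\<sigma> (r i)"
      let ?w = "\<lambda>x y. \<lambda>v\<in>?V. (x v, y v)"
      interpret M: prob_space "m i" by (rule m)
      define G where "G y = space (m i) - (\<Union>f\<in>F3. bad i f y)" for y
      define L where "L x y = (SOME z. lifted (r i) (?w x y) z)" for x y
      have L: "lifted (r i) (?w x y) (L x y)" if "y \<in> good_models \<O>' ?V ?s" "x \<in> G y" for x y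
      proof -
        have "?w x y \<in> good_models (weak_star_ball F3 \<eta>3 ?J) ?V ?s"
          using that(2) by (intro good_models_weak_star_ballI V(1,2) F3(2)) (auto simp: G_def bad_def not_le)
        then have "?w x y \<in> good_models \<O>1 ?V ?s"
          using F3(4) by (auto simp: good_models_def)
        then show ?thesis
          unfolding L_def using elim(2) by (intro someI_ex[of "lifted (r i) (?w x y)"]) blast
      qed
      have lift_close: "\<bar>orbit_mean ?V ?s f (\<lambda>v\<in>?V. (?w x y v, L x y v)) - I f\<bar> < \<eta>"
        if "y \<in> good_models \<O>' ?V ?s" "x \<in> G y" "f \<in> F" for x y f
        using L[OF that(1,2)] that(3) unfolding lifted_def by blast
      show ?case
      proof (rule cov_measure_mult_cov_le[where G = G and L = L, OF m(1)])
        fix y assume y: "y \<in> good_models \<O>' ?V ?s"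
        show "G y \<subseteq> space (m i)" by (auto simp: G_def)
        have U: "(\<Union>f\<in>F3. bad i f y) \<in> sets (m i)"
          using bad_sets F3(1) by (intro sets.finite_UN) auto
        have "M.prob (\<Union>f\<in>F3. bad i f y) \<le> (\<Sum>f\<in>F3. M.prob (bad i f y))"
          using bad_sets by (intro M.finite_measure_subadditive_finite F3(1)) auto
        also have "\<dots> \<le> (\<Sum>f\<in>F3. \<theta>)"
          using elim(1) y less_imp_le by (intro sum_mono) blast
        also have "\<dots> < \<epsilon>" using \<theta>(2) by simp
        finally show "M.prob (G y) > 1 - \<epsilon>"
          unfolding G_def using M.prob_compl[OF U] by simp
      next
        fix y x assume yx: "y \<in> good_models \<O>' ?V ?s" "x \<in> G y"
        have "L x y \<in> good_models (weak_star_ball F2 \<eta>2 \<gamma>) ?V ?s"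
        proof (rule good_models_weak_star_ballI[OF V(1,2) F2(2)])
          show "L x y \<in> ?V \<rightarrow>\<^sub>E UNIV" using L[OF yx] by (simp add: lifted_def)
          fix f assume f: "f \<in> F2"
          have "orbit_mean ?V ?s (up f) (\<lambda>v\<in>?V. (?w x y v, L x y v)) = orbit_mean ?V ?s f (L x y)"
            unfolding orbit_mean_def up_def
            by (intro arg_cong2[where f = "(/)"] sum.cong refl) (simp add: pullback_name_pair V)
          then show "\<bar>orbit_mean ?V ?s f (L x y) - integral\<^sup>L \<gamma> f\<bar> < \<eta>2"
            using lift_close[OF yx, of "up f"] f up(2)[OF f] by (simp add: F_def \<eta>_def)
        qed
        then show "L x y \<in> good_models \<O> ?V ?s"
          using F2(4) by (auto simp: good_models_def)
      next
        fix y y' x x'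
        assume yx: "y \<in> good_models \<O>' ?V ?s" "y' \<in> good_models \<O>' ?V ?s" "x \<in> G y" "x' \<in> G y'"
          and d: "hamming_dist ?V (L x y) (L x' y') < 2 * (\<delta>' / 2)"
        have "hamming_dist ?V (?w x y) (?w x' y') < min \<delta>1 \<delta>2"
        proof (rule sep[OF V(1,2,3)])
          show "\<bar>orbit_mean ?V ?s f (\<lambda>v\<in>?V. (?w x y v, L x y v)) - I f\<bar> < \<eta>1" if "f \<in> F1" for f
            using lift_close[OF yx(1,3), of f] that by (simp add: F_def \<eta>_def)
          show "\<bar>orbit_mean ?V ?s f (\<lambda>v\<in>?V. (?w x' y' v, L x' y' v)) - I f\<bar> < \<eta>1" if "f \<in> F1" for f
            using lift_close[OF yx(2,4), of f] that by (simp add: F_def \<eta>_def)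
        qed (use d in simp)
        then show "hamming_dist ?V x x' < \<delta>1 \<and> hamming_dist ?V y y' < \<delta>2"
          using hamming_dist_pair_ge[of ?V x x' y y'] hamming_dist_pair_ge[of ?V y y' x x'] by linarith
      next
        show "hamming_dist ?V y y < \<delta>2" for y :: "'v \<Rightarrow> 'b"
          using pos(3) by (simp add: hamming_dist_def)
      qed (simp_all add: measurable_hamming_ball[OF m(2)] hamming_dist_commute hamming_dist_triangle)
    qed
    with \<O>'(1) show "\<exists>\<O>' \<in> weak_star_nhds \<beta>. \<forall>\<^sub>F i in sequentially. ?le \<O> \<O>' i"
      by blast
  qed
qed

text \<open>
  The number of models of \<open>\<beta>\<close> has to be large along the subsequence on which the doubly-quenched
  sequence lives; this is why \<open>b\<close> lies below the lower entropy.
\<close>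

lemma sofic_entropy_ge_dq_plus_lower:
  fixes V :: "nat \<Rightarrow> 'v set" and \<sigma> :: "nat \<Rightarrow> 'g::{group_add,countable} \<Rightarrow> 'v \<Rightarrow> 'v"
    and \<alpha> :: "('g \<Rightarrow> 'a::polish_space) measure" and \<beta> :: "('g \<Rightarrow> 'b::polish_space) measure"
    and \<gamma> :: "('g \<Rightarrow> 'c::polish_space) measure"
  assumes sof: "sofic_approximation V \<sigma>"
    and procs: "metric_process \<alpha>" "metric_process \<beta>" "metric_process \<gamma>"
    and iso: "isomorphic_systems (joint_measure UNIV \<alpha> \<beta>) shift \<gamma> shift"
    and a: "ereal a < dq_entropy V \<sigma> \<alpha>" and b: "ereal b < lower_sofic_entropy V \<sigma> \<beta>"
  shows "ereal (a + b) \<le> sofic_entropy V \<sigma> \<gamma>"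
proof -
  note V = sofic_approximationD[OF sof]
  obtain r m \<delta>1 \<epsilon> where r: "strict_mono r" and dq: "doubly_quenched_converges (\<lambda>i. V (r i)) (\<lambda>i. \<sigma> (r i)) m \<alpha>"
    and pos: "\<delta>1 > 0" "\<epsilon> > 0"
    and a': "ereal a < limsup (\<lambda>i. log_enat (cov_measure \<epsilon> \<delta>1 (m i) (hamming_dist (V (r i)))) / ereal (real (card (V (r i)))))"
  proof -
    let ?R = "{(r :: nat \<Rightarrow> nat, m). strict_mono r \<and>
        doubly_quenched_converges (\<lambda>i. V (r i)) (\<lambda>i. \<sigma> (r i)) m \<alpha>}"
    let ?l = "\<lambda>r m \<delta> \<epsilon>. limsup (\<lambda>i. log_enat (cov_measure \<epsilon> \<delta> (m i) (hamming_dist (V (r i))))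
        / ereal (real (card (V (r i)))))"
    obtain p where p: "p \<in> ?R" "ereal a < (case p of (r, m) \<Rightarrow> SUP (\<delta>, \<epsilon>) \<in> {0<..} \<times> {0<..}. ?l r m \<delta> \<epsilon>)"
      using a unfolding dq_entropy_def less_SUP_iff by (elim bexE)
    obtain r m where rm: "p = (r, m)" by (cases p)
    have "\<exists>q \<in> {0<..} \<times> {0<..}. ereal a < (case q of (\<delta>, \<epsilon>) \<Rightarrow> ?l r m \<delta> \<epsilon>)"
      using p(2) unfolding rm prod.case less_SUP_iff .
    then obtain q where q: "q \<in> {0<..} \<times> {0<..}" "ereal a < (case q of (\<delta>, \<epsilon>) \<Rightarrow> ?l r m \<delta> \<epsilon>)" ..
    obtain \<delta> \<epsilon> where de: "q = (\<delta>, \<epsilon>)" by (cases q)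
    show thesis
      by (rule that[of r m \<delta> \<epsilon>]) (use p(1) q in \<open>simp_all only: rm de prod.case mem_Collect_eq mem_Times_iff fst_conv snd_conv greaterThan_iff\<close>)
  qed
  obtain \<delta>2 where \<delta>2: "\<delta>2 > 0" and b': "ereal b < (INF \<O> \<in> weak_star_nhds \<beta>.
        liminf (\<lambda>n. log_enat (cov \<delta>2 (good_models \<O> (V n) (\<sigma> n)) (hamming_dist (V n))) / ereal (real (card (V n)))))"
    using b unfolding lower_sofic_entropy_def less_SUP_iff by auto
  let ?le = "\<lambda>\<delta>' \<O> \<O>' i. cov_measure \<epsilon> \<delta>1 (m i) (hamming_dist (V (r i))) *
      cov \<delta>2 (good_models \<O>' (V (r i)) (\<sigma> (r i))) (hamming_dist (V (r i)))
      \<le> cov \<delta>' (good_models \<O> (V (r i)) (\<sigma> (r i))) (hamming_dist (V (r i)))"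
  obtain \<delta>' where \<delta>': "\<delta>' > 0" and le: "\<And>\<O>. \<O> \<in> weak_star_nhds \<gamma> \<Longrightarrow>
    \<exists>\<O>' \<in> weak_star_nhds \<beta>. \<forall>\<^sub>F i in sequentially. ?le \<delta>' \<O> \<O>' i"
  proof -
    show thesis by (rule cov_lift_ge[OF sof procs iso r dq pos(2,1) \<delta>2]) (fact that)
  qed
  have "ereal (a + b) \<le> limsup (\<lambda>n. log_enat (cov \<delta>' (good_models \<O> (V n) (\<sigma> n)) (hamming_dist (V n)))
      / ereal (real (card (V n))))" (is "_ \<le> limsup ?h") if \<O>: "\<O> \<in> weak_star_nhds \<gamma>" for \<O>
  proof (rule ccontr)
    assume "\<not> ?thesis"
    then have "\<forall>\<^sub>F n in sequentially. ?h n < ereal (a + b)"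
      by (intro Limsup_lessD) simp
    then have small: "\<forall>\<^sub>F i in sequentially. ?h (r i) < ereal (a + b)"
      using filterlim_subseq[OF r] unfolding filterlim_iff by blast
    obtain \<O>' where \<O>': "\<O>' \<in> weak_star_nhds \<beta>" "\<forall>\<^sub>F i in sequentially. ?le \<delta>' \<O> \<O>' i"
      using le[OF \<O>] by blast
    let ?k = "\<lambda>n. log_enat (cov \<delta>2 (good_models \<O>' (V n) (\<sigma> n)) (hamming_dist (V n))) / ereal (real (card (V n)))"
    have "ereal b < liminf ?k"
      using b' INF_lower[OF \<O>'(1)] by (rule less_le_trans)
    then have "\<forall>\<^sub>F n in sequentially. ereal b < ?k n"
      by (rule less_LiminfD)
    then have "\<forall>\<^sub>F i in sequentially. ereal b < ?k (r i)"
      using filterlim_subseq[OF r] unfolding filterlim_iff by blast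
    with small \<O>'(2) have "\<forall>\<^sub>F i in sequentially.
        log_enat (cov_measure \<epsilon> \<delta>1 (m i) (hamming_dist (V (r i)))) / ereal (real (card (V (r i)))) \<le> ereal a"
    proof eventually_elim
      case (elim i)
      have N: "real (card (V (r i))) > 0"
        using V(1,2)[of "r i"] by (simp add: card_gt_0_iff)
      show ?case
      proof (rule ccontr)
        assume "\<not> ?thesis"
        then have "ereal (a + b) < ?h (r i)"
          using log_enat_mult_le[OF elim(2) N _ elim(3), of a] by simp
        with elim(1) show False by simp
      qed
    qed
    from Limsup_bounded[OF this] a' show False by simp
  qed
  then have "ereal (a + b) \<le> (INF \<O> \<in> weak_star_nhds \<gamma>. limsup (\<lambda>n. log_enat (cov \<delta>' (good_models \<O> (V n) (\<sigma> n))
      (hamming_dist (V n))) / ereal (real (card (V n)))))"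
    by (intro INF_greatest)
  also have "\<dots> \<le> sofic_entropy V \<sigma> \<gamma>"
    unfolding sofic_entropy_def using \<delta>' by (intro SUP_upper) simp
  finally show ?thesis .
qed

theorem theoremB:
  fixes V :: "nat \<Rightarrow> 'v set"
    and \<sigma> :: "nat \<Rightarrow> 'g::{group_add,countable} \<Rightarrow> 'v \<Rightarrow> 'v"
    and M :: "'x measure" and T :: "'g \<Rightarrow> 'x \<Rightarrow> 'x"
    and N :: "'y measure" and S :: "'g \<Rightarrow> 'y \<Rightarrow> 'y"
    and \<alpha> :: "('g \<Rightarrow> 'a::polish_space) measure"
    and \<beta> :: "('g \<Rightarrow> 'b::polish_space) measure"
    and \<gamma> :: "('g \<Rightarrow> 'c::polish_space) measure"
  assumes "sofic_approximation V \<sigma>"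
    and "G_system M T"
    and "G_system N S"
    and "metric_model M T \<alpha>"
    and "metric_model N S \<beta>"
    and "metric_model (M \<Otimes>\<^sub>M N) (\<lambda>g. map_prod (T g) (S g)) \<gamma>"
    and "sofic_entropy V \<sigma> \<beta> = lower_sofic_entropy V \<sigma> \<beta>"
  shows "sofic_entropy V \<sigma> \<gamma> \<ge> entropy_plus (dq_entropy V \<sigma> \<alpha>) (sofic_entropy V \<sigma> \<beta>)"
proof (cases "dq_entropy V \<sigma> \<alpha> = -\<infinity> \<or> sofic_entropy V \<sigma> \<beta> = -\<infinity>")
  case True
  then have "entropy_plus (dq_entropy V \<sigma> \<alpha>) (sofic_entropy V \<sigma> \<beta>) = -\<infinity>"
    unfolding entropy_plus_def by (rule if_P)
  then show ?thesis
    by (simp only: ereal_less_eq)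
next
  case False
  have procs: "metric_process \<alpha>" "metric_process \<beta>" "metric_process \<gamma>"
    using assms by (auto simp: metric_model_def)
  have \<alpha>: "prob_space \<alpha>" "sets \<alpha> = sets (seq_space UNIV)" "\<And>g. distr \<alpha> \<alpha> (shift g) = \<alpha>"
    and \<beta>: "prob_space \<beta>" "sets \<beta> = sets (seq_space UNIV)" "\<And>g. distr \<beta> \<beta> (shift g) = \<beta>"
    using procs by (auto simp: metric_process_def)
  have M: "prob_space M" "\<And>g. T g \<in> M \<rightarrow>\<^sub>M M" "\<And>g. distr M M (T g) = M"
    and N: "prob_space N" "\<And>g. S g \<in> N \<rightarrow>\<^sub>M N" "\<And>g. distr N N (S g) = N"
    using assms(2,3) by (auto simp: G_system_def)
  have "isomorphic_systems \<alpha> shift M T" "isomorphic_systems \<beta> shift N S"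
    using isomorphic_systems_sym[OF _ M(2,3)] isomorphic_systems_sym[OF _ N(2,3)] assms(4,5)
    by (auto simp: metric_model_def)
  from isomorphic_systems_prod[OF this \<alpha>(1) \<beta>(1) M(1) N(1)]
  have "isomorphic_systems (joint_measure UNIV \<alpha> \<beta>) shift (M \<Otimes>\<^sub>M N) (\<lambda>g. map_prod (T g) (S g))"
    by (rule isomorphic_systems_trans[OF joint_measure_process(1)[OF \<alpha> \<beta>]])
  then have iso: "isomorphic_systems (joint_measure UNIV \<alpha> \<beta>) shift \<gamma> shift"
    using assms(6) unfolding metric_model_def by (blast intro: isomorphic_systems_trans)
  have "dq_entropy V \<sigma> \<alpha> + sofic_entropy V \<sigma> \<beta> \<le> sofic_entropy V \<sigma> \<gamma>"
  proof (rule ereal_add_le_approx)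
    fix a b assume "ereal a < dq_entropy V \<sigma> \<alpha>" "ereal b < sofic_entropy V \<sigma> \<beta>"
    then show "ereal (a + b) \<le> sofic_entropy V \<sigma> \<gamma>"
      by (intro sofic_entropy_ge_dq_plus_lower[OF assms(1) procs iso]) (simp_all add: assms(7))
  qed (use False in auto)
  then show ?thesis
    using False by (simp add: entropy_plus_def)
qed

end
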